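(* Let $B$ be an orbispace, let $\chi\in H^2(B;\mathbb Z)$, and let $P_\chi\to B$ be the $U(1)$-principal bundle classified by $\chi$. Let $h_\chi:LB\to U(1)^\delta$ be the function associated to the principal bundle $P_\chi$, and let $\bar\chi:LB\to U(1)$ be the function associated to the class $\chi$. Then $$h_\chi=\bar\chi .$$
   Context: **Stacks.** A stack in topological spaces is a stack of groupoids on the site of topological spaces with open coverings; spaces are stacks via Yoneda and fibre products are $2$-categorical. An atlas of a stack $X$ is a representable, surjective map $A\to X$ from a space which admits local sections; $X$ is a topological stack if it has an atlas. A topological groupoid $A^1\rightrightarrows A^0$ (source $s$, range $r$) is separated if its identity map $A^0\to A^1$ is a closed map; proper if $(s,r):A^1\to A^0\times A^0$ is proper; étale if $s,r$ are étale; a proper étale groupoid is very proper if there is a continuous $c:A^0\to[0,1]$ with $r:\mathrm{supp}(s^*c)\to A^0$ proper and $\sum_{y\in r^{-1}(x)}c(s(y))=1$ for all $x\in A^0$. An orbispace is a topological stack having an atlas $A\to X$ such that $A\times_XA\rightrightarrows A$ is very proper, étale and separated. Its cohomology is $H^*(X;\mathbb Z):=H^*(|A^\cdot|;\mathbb Z)$, where $|A^\cdot|$ is the realization of the simplicial space $A^n=A\times_X\cdots\times_XA$ ($n+1$ factors). Isomorphism classes of $U(1)$-principal bundles over an orbispace $B$ are classified by $H^2(B;\mathbb Z)$ (first Chern class), naturally in $B$. **Loop stack.** $LX$ has as objects over $T$ the pairs $(u,\phi)$, $u\in X(T)$, $\phi\in\mathrm{Aut}(u)$, and as morphisms $(u,\phi)\to(u',\phi')$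 the morphisms $k:u\to u'$ with $\phi'k=k\phi$. **The function $h$.** A $U(1)$-principal bundle over $B$ is a map $p:B\to\mathcal BU(1):=[*/U(1)]$, with underlying map of stacks $P=B\times_{\mathcal BU(1)}*\to B$. For $(u,\phi)\in LB(T)$, $p(\phi)$ is an automorphism of the principal $U(1)$-bundle $p(u)$ on $T$, hence multiplication by a function $T\to U(1)$; this defines $h:LB\to U(1)$. (Equivalently, $h$ is $LB\to L\mathcal BU(1)\cong[U(1)/U(1)]\to U(1)$; on fibres $\gamma x=xh(\gamma)$.) As $B$ is an orbispace, $h$ factors over the discrete group $U(1)^\delta$. For $P_\chi$ it is denoted $h_\chi$. **The function $\bar\chi$.** For a finite group $\Gamma$, the Bockstein boundary for $0\to\mathbb Z\to\mathbb R^\delta\to U(1)^\delta\to0$ gives $\hat\Gamma:=\mathrm{Hom}(\Gamma,U(1))=H^1(\Gamma;U(1)^\delta)\cong H^2(\Gamma;\mathbb Z)\cong H^2([*/\Gamma];\mathbb Z)$; a character $\chi\in\hat\Gamma$ defines $\bar\chi:L[*/\Gamma]\cong[\Gamma/\Gamma]\to U(1)^\delta$, $\gamma\mapsto\chi(\gamma)$. For a general orbispace $B$ and $\chi\in H^2(B;\mathbb Z)$, the function $\bar\chi$ is defined at a point $u:*\to LB$, given by a point $p_u$ of $B$ and $\gamma_u\in\mathrm{Aut}(p_u)$, as $\bar\chi(u):=\overline{\tilde u^*\chi}(\gamma_u)$, where $\Gamma_u$ is the finite cyclic group generated by $\gamma_u$ and $\tilde u:[*/\Gamma_u]\to B$ is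 the induced map. (No continuity of $\bar\chi$ is assumed a priori.) *)

theory Defs
  imports "HOL-Analysis.Analysis" "HOL-Homology.Homology"
begin

section \<open>Stacks in topological spaces\<close>

text \<open>
  The site consists of all topologies on subsets of a type \<open>'u\<close>, which plays the role of a
  universe: it is arbitrary, so that it may be taken to contain (up to homeomorphism) any given set
  of spaces.  Nothing below needs a lower bound on its size, but \<open>'u\<close> must have at least the
  cardinality of the continuum for there to be any \<open>U(1)\<close>-bundle over a nonempty space.

  A stack is presented as a category fibred in groupoids over this site.  An object \<open>x\<close> lies over
  the space \<open>sp X x\<close> and a morphism \<open>m\<close> over the continuous map \<open>mp X m\<close>; maps between spaces are
  identified with extensional functions.  A space \<open>A\<close> is the stack represented by it, and by Yoneda
  a map \<open>A \<rightarrow> X\<close> is an object of \<open>X\<close> over \<open>A\<close>.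
\<close>

record ('u, 'o, 'm) fibred =
  Ob :: "'o set"
  Mor :: "'m set"
  Dom :: "'m \<Rightarrow> 'o"
  Cod :: "'m \<Rightarrow> 'o"
  Idm :: "'o \<Rightarrow> 'm"
  Cmp :: "'m \<Rightarrow> 'm \<Rightarrow> 'm"    \<comment> \<open>\<open>Cmp X g f\<close> is \<open>g\<close> after \<open>f\<close>\<close>
  sp :: "'o \<Rightarrow> 'u topology"
  mp :: "'m \<Rightarrow> 'u \<Rightarrow> 'u"

definition Homs :: "('u, 'o, 'm) fibred \<Rightarrow> 'o \<Rightarrow> 'o \<Rightarrow> 'm set" where
  "Homs X x y = {m \<in> Mor X. Dom X m = x \<and> Cod X m = y}"

definition space_map :: "'u topology \<Rightarrow> 'u topology \<Rightarrow> ('u \<Rightarrow> 'u) \<Rightarrow> bool" where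
  "space_map S T f \<longleftrightarrow> continuous_map S T f \<and> f \<in> extensional (topspace S)"

definition category_over_spaces :: "('u, 'o, 'm) fibred \<Rightarrow> bool" where
  "category_over_spaces X \<longleftrightarrow>
     (\<forall>m\<in>Mor X. Dom X m \<in> Ob X \<and> Cod X m \<in> Ob X) \<and>
     (\<forall>x\<in>Ob X. Idm X x \<in> Homs X x x) \<and>
     (\<forall>f\<in>Mor X. \<forall>g\<in>Mor X. Cod X f = Dom X g \<longrightarrow> Cmp X g f \<in> Homs X (Dom X f) (Cod X g)) \<and>
     (\<forall>f\<in>Mor X. Cmp X f (Idm X (Dom X f)) = f \<and> Cmp X (Idm X (Cod X f)) f = f) \<and>
     (\<forall>f\<in>Mor X. \<forall>g\<in>Mor X. \<forall>h\<in>Mor X. Cod X f = Dom X g \<longrightarrow> Cod X g = Dom X h \<longrightarrow>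
        Cmp X h (Cmp X g f) = Cmp X (Cmp X h g) f) \<and>
     (\<forall>m\<in>Mor X. space_map (sp X (Dom X m)) (sp X (Cod X m)) (mp X m)) \<and>
     (\<forall>x\<in>Ob X. mp X (Idm X x) = restrict id (topspace (sp X x))) \<and>
     (\<forall>f\<in>Mor X. \<forall>g\<in>Mor X. Cod X f = Dom X g \<longrightarrow>
        mp X (Cmp X g f) = compose (topspace (sp X (Dom X f))) (mp X g) (mp X f))"

definition fibred_in_groupoids :: "('u, 'o, 'm) fibred \<Rightarrow> bool" where
  "fibred_in_groupoids X \<longleftrightarrow> category_over_spaces X \<and>
     (\<forall>y\<in>Ob X. \<forall>T f. space_map T (sp X y) f \<longrightarrow>
        (\<exists>x\<in>Ob X. sp X x = T \<and> (\<exists>m\<in>Homs X x y. mp X m = f))) \<and>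
     (\<forall>w\<in>Ob X. \<forall>x\<in>Ob X. \<forall>y\<in>Ob X. \<forall>m\<in>Homs X x y. \<forall>n\<in>Homs X w y. \<forall>f.
        space_map (sp X w) (sp X x) f \<longrightarrow> mp X n = compose (topspace (sp X w)) (mp X m) f \<longrightarrow>
        (\<exists>!k. k \<in> Homs X w x \<and> mp X k = f \<and> Cmp X m k = n))"

text \<open>
  Restrictions to open subsets are not chosen: they are given by a morphism over the inclusion map.
  A morphism \<open>x' \<rightarrow> y\<close> over an inclusion thus stands for an isomorphism from \<open>x'\<close> to a restriction
  of \<open>y\<close>.
\<close>

definition open_cover :: "'u topology \<Rightarrow> 'u set set \<Rightarrow> bool" where
  "open_cover T \<U> \<longleftrightarrow> (\<forall>U\<in>\<U>. openin T U) \<and> \<Union>\<U> = topspace T"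

definition incl_homs :: "('u, 'o, 'm) fibred \<Rightarrow> 'o \<Rightarrow> 'o \<Rightarrow> 'm set" where
  "incl_homs X x y = {m \<in> Homs X x y. mp X m = restrict id (topspace (sp X x))}"

definition descent_morphisms :: "('u, 'o, 'm) fibred \<Rightarrow> bool" where
  "descent_morphisms X \<longleftrightarrow>
     (\<forall>x\<in>Ob X. \<forall>y\<in>Ob X. \<forall>\<U> r i k.
        sp X x = sp X y \<longrightarrow> open_cover (sp X x) \<U> \<longrightarrow>
        (\<forall>U\<in>\<U>. r U \<in> Ob X \<and> sp X (r U) = subtopology (sp X x) U \<and>
           i U \<in> incl_homs X (r U) x \<and> k U \<in> incl_homs X (r U) y) \<longrightarrow>
        (\<forall>U\<in>\<U>. \<forall>V\<in>\<U>. \<forall>w\<in>Ob X. \<forall>a\<in>incl_homs X w (r U). \<forall>b\<in>incl_homs X w (r V).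
           sp X w = subtopology (sp X x) (U \<inter> V) \<longrightarrow>
           Cmp X (i U) a = Cmp X (i V) b \<longrightarrow> Cmp X (k U) a = Cmp X (k V) b) \<longrightarrow>
        (\<exists>!m. m \<in> incl_homs X x y \<and> (\<forall>U\<in>\<U>. Cmp X m (i U) = k U)))"

text \<open>
  In a descent datum the gluing isomorphism between the restrictions of \<open>r U\<close> and \<open>r V\<close> to
  \<open>U \<inter> V\<close> is given by the span of \<open>a U V : w U V \<rightarrow> r U\<close> and \<open>b U V : w U V \<rightarrow> r V\<close>.  Two
  morphisms \<open>t \<rightarrow> r U\<close>, \<open>t \<rightarrow> r V\<close> over inclusions correspond under it precisely if they factor
  through the span.
\<close>

definition descent_objects :: "('u, 'o, 'm) fibred \<Rightarrow> bool" where
  "descent_objects X \<longleftrightarrow>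
     (\<forall>T \<U> r w a b.
        open_cover T \<U> \<longrightarrow>
        (\<forall>U\<in>\<U>. r U \<in> Ob X \<and> sp X (r U) = subtopology T U) \<longrightarrow>
        (\<forall>U\<in>\<U>. \<forall>V\<in>\<U>. w U V \<in> Ob X \<and> sp X (w U V) = subtopology T (U \<inter> V) \<and>
           a U V \<in> incl_homs X (w U V) (r U) \<and> b U V \<in> incl_homs X (w U V) (r V)) \<longrightarrow>
        (\<forall>U\<in>\<U>. \<forall>V\<in>\<U>. \<forall>W\<in>\<U>. \<forall>t\<in>Ob X. \<forall>j\<in>incl_homs X t (w U V). \<forall>k\<in>incl_homs X t (w V W).
           sp X t = subtopology T (U \<inter> V \<inter> W) \<longrightarrow>
           Cmp X (b U V) j = Cmp X (a V W) k \<longrightarrow>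
           (\<exists>l\<in>incl_homs X t (w U W).
              Cmp X (a U W) l = Cmp X (a U V) j \<and> Cmp X (b U W) l = Cmp X (b V W) k)) \<longrightarrow>
        (\<exists>x\<in>Ob X. \<exists>i. sp X x = T \<and> (\<forall>U\<in>\<U>. i U \<in> incl_homs X (r U) x) \<and>
           (\<forall>U\<in>\<U>. \<forall>V\<in>\<U>. Cmp X (i U) (a U V) = Cmp X (i V) (b U V))))"

definition stack :: "('u, 'o, 'm) fibred \<Rightarrow> bool" where
  "stack X \<longleftrightarrow> fibred_in_groupoids X \<and> descent_morphisms X \<and> descent_objects X"

definition stack_map ::
  "('u, 'o, 'm) fibred \<Rightarrow> ('u, 'p, 'n) fibred \<Rightarrow> ('o \<Rightarrow> 'p) \<Rightarrow> ('m \<Rightarrow> 'n) \<Rightarrow> bool" where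
  "stack_map X Y F\<^sub>o F\<^sub>m \<longleftrightarrow>
     (\<forall>x\<in>Ob X. F\<^sub>o x \<in> Ob Y \<and> sp Y (F\<^sub>o x) = sp X x \<and> F\<^sub>m (Idm X x) = Idm Y (F\<^sub>o x)) \<and>
     (\<forall>m\<in>Mor X. F\<^sub>m m \<in> Homs Y (F\<^sub>o (Dom X m)) (F\<^sub>o (Cod X m)) \<and> mp Y (F\<^sub>m m) = mp X m) \<and>
     (\<forall>f\<in>Mor X. \<forall>g\<in>Mor X. Cod X f = Dom X g \<longrightarrow> F\<^sub>m (Cmp X g f) = Cmp Y (F\<^sub>m g) (F\<^sub>m f))"


section \<open>Fibre products and atlases\<close>

text \<open>
  Let \<open>a\<close> and \<open>t\<close> be objects over \<open>A\<close> and \<open>T\<close>.  A point over \<open>W\<close> of the 2-fibre product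
  \<open>A \<times>\<^sub>X T\<close> consists of maps \<open>f: W \<rightarrow> A\<close>, \<open>g: W \<rightarrow> T\<close> and an isomorphism from \<open>f\<^sup>*a\<close> to \<open>g\<^sup>*t\<close>, that
  is, up to unique isomorphism, of an object over \<open>W\<close> with morphisms to \<open>a\<close> over \<open>f\<close> and to \<open>t\<close>
  over \<open>g\<close>.  Hence the space \<open>sp X z\<close> with such a span on \<open>z\<close> represents \<open>A \<times>\<^sub>X T\<close> iff the span is
  universal.
\<close>

definition fibre_product ::
  "('u, 'o, 'm) fibred \<Rightarrow> 'o \<Rightarrow> 'o \<Rightarrow> 'o \<Rightarrow> 'm \<Rightarrow> 'm \<Rightarrow> bool" where
  "fibre_product X a t z k l \<longleftrightarrow> z \<in> Ob X \<and> k \<in> Homs X z a \<and> l \<in> Homs X z t \<and>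
     (\<forall>w\<in>Ob X. \<forall>k'\<in>Homs X w a. \<forall>l'\<in>Homs X w t.
        \<exists>!m. m \<in> Homs X w z \<and> Cmp X k m = k' \<and> Cmp X l m = l')"

definition admits_local_sections :: "'u topology \<Rightarrow> 'u topology \<Rightarrow> ('u \<Rightarrow> 'u) \<Rightarrow> bool" where
  "admits_local_sections S T f \<longleftrightarrow>
     (\<forall>x\<in>topspace T. \<exists>U e. openin T U \<and> x \<in> U \<and>
        continuous_map (subtopology T U) S e \<and> (\<forall>y\<in>U. f (e y) = y))"

definition is_atlas :: "('u, 'o, 'm) fibred \<Rightarrow> 'o \<Rightarrow> bool" where
  "is_atlas X a \<longleftrightarrow> a \<in> Ob X \<and>
     (\<forall>t\<in>Ob X. \<exists>z k l. fibre_product X a t z k l \<and>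
        mp X l ` topspace (sp X z) = topspace (sp X t) \<and>
        admits_local_sections (sp X z) (sp X t) (mp X l))"


section \<open>Topological groupoids\<close>

record ('b, 'g) tgroupoid =
  obj :: "'b topology"
  arr :: "'g topology"
  src :: "'g \<Rightarrow> 'b"
  rng :: "'g \<Rightarrow> 'b"
  ident :: "'b \<Rightarrow> 'g"
  prd :: "'g \<Rightarrow> 'g \<Rightarrow> 'g"    \<comment> \<open>\<open>prd G g h\<close> is \<open>g\<close> after \<open>h\<close>, for \<open>src G g = rng G h\<close>\<close>

definition etale_map :: "'a topology \<Rightarrow> 'b topology \<Rightarrow> ('a \<Rightarrow> 'b) \<Rightarrow> bool" where
  "etale_map S T f \<longleftrightarrow> continuous_map S T f \<and>
     (\<forall>x\<in>topspace S. \<exists>U. openin S U \<and> x \<in> U \<and> openin T (f ` U) \<and>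
        homeomorphic_map (subtopology S U) (subtopology T (f ` U)) f)"

definition etale_groupoid :: "('b, 'g) tgroupoid \<Rightarrow> bool" where
  "etale_groupoid G \<longleftrightarrow> etale_map (arr G) (obj G) (src G) \<and> etale_map (arr G) (obj G) (rng G)"

definition separated_groupoid :: "('b, 'g) tgroupoid \<Rightarrow> bool" where
  "separated_groupoid G \<longleftrightarrow> closed_map (obj G) (arr G) (ident G)"

definition proper_groupoid :: "('b, 'g) tgroupoid \<Rightarrow> bool" where
  "proper_groupoid G \<longleftrightarrow>
     proper_map (arr G) (prod_topology (obj G) (obj G)) (\<lambda>g. (src G g, rng G g))"

definition very_proper_groupoid :: "('b, 'g) tgroupoid \<Rightarrow> bool" where
  "very_proper_groupoid G \<longleftrightarrow> proper_groupoid G \<and> etale_groupoid G \<and>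
     (\<exists>c. continuous_map (obj G) (top_of_set {0..1::real}) c \<and>
        proper_map (subtopology (arr G) (arr G closure_of {g \<in> topspace (arr G). c (src G g) \<noteq> 0}))
          (obj G) (rng G) \<and>
        (\<forall>x\<in>topspace (obj G). ((\<lambda>g. c (src G g)) has_sum 1) {g \<in> topspace (arr G). rng G g = x}))"

text \<open>
  An atlas \<open>A \<rightarrow> X\<close> given by an object \<open>atl D\<close> over \<open>A\<close>, together with a universal span
  \<open>atl D \<leftarrow> dbl D \<rightarrow> atl D\<close>, so that \<open>A \<times>\<^sub>X A\<close> is the space underlying \<open>dbl D\<close>.
\<close>

record ('o, 'm) atlas_data =
  atl :: 'o
  dbl :: 'o
  p_src :: 'm
  p_rng :: 'm

text \<open>
  The groupoid \<open>A \<times>\<^sub>X A\<close> over \<open>A\<close> is obtained by applying to the span the functor which sends an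
  object to its underlying space.  A span \<open>(k, l)\<close> from an object over a one-point space to \<open>atl D\<close>
  determines an arrow, namely the isomorphism \<open>l \<circ> k\<^sup>-\<^sup>1\<close> between two restrictions of
  \<open>atl D\<close>; the product of the arrows of \<open>(k\<^sub>1, l\<^sub>1)\<close> and \<open>(k\<^sub>2, l\<^sub>2)\<close> with \<open>k\<^sub>1 = l\<^sub>2\<close> is that of
  \<open>(k\<^sub>2, l\<^sub>1)\<close>.  The construction is stated for an arbitrary functor \<open>(F, f)\<close> to spaces, since it will
  also be applied to the total spaces of a bundle over \<open>X\<close>.
\<close>

definition span_groupoid ::
  "('u, 'o, 'm) fibred \<Rightarrow> ('o, 'm) atlas_data \<Rightarrow> ('o \<Rightarrow> 'v topology) \<Rightarrow> ('m \<Rightarrow> 'v \<Rightarrow> 'v)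
     \<Rightarrow> ('v, 'v) tgroupoid" where
  "span_groupoid X D F f =
     \<lparr> obj = F (atl D),
       arr = F (dbl D),
       src = f (p_src D),
       rng = f (p_rng D),
       ident = f (THE d. d \<in> Homs X (atl D) (dbl D) \<and>
                    Cmp X (p_src D) d = Idm X (atl D) \<and> Cmp X (p_rng D) d = Idm X (atl D)),
       prd = (\<lambda>g\<^sub>1 g\<^sub>2. THE g. \<exists>w\<in>Ob X. \<exists>m\<^sub>1\<in>Homs X w (dbl D). \<exists>m\<^sub>2\<in>Homs X w (dbl D).
                \<exists>m\<in>Homs X w (dbl D). \<exists>y\<in>topspace (F w).
                  Cmp X (p_src D) m\<^sub>1 = Cmp X (p_rng D) m\<^sub>2 \<and>
                  Cmp X (p_src D) m = Cmp X (p_src D) m\<^sub>2 \<and>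
                  Cmp X (p_rng D) m = Cmp X (p_rng D) m\<^sub>1 \<and>
                  f m\<^sub>1 y = g\<^sub>1 \<and> f m\<^sub>2 y = g\<^sub>2 \<and> f m y = g) \<rparr>"

definition atlas_groupoid ::
  "('u, 'o, 'm) fibred \<Rightarrow> ('o, 'm) atlas_data \<Rightarrow> ('u, 'u) tgroupoid" where
  "atlas_groupoid X D = span_groupoid X D (sp X) (mp X)"

definition orbispace_atlas :: "('u, 'o, 'm) fibred \<Rightarrow> ('o, 'm) atlas_data \<Rightarrow> bool" where
  "orbispace_atlas X D \<longleftrightarrow> is_atlas X (atl D) \<and>
     fibre_product X (atl D) (atl D) (dbl D) (p_src D) (p_rng D) \<and>
     very_proper_groupoid (atlas_groupoid X D) \<and> etale_groupoid (atlas_groupoid X D) \<and>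
     separated_groupoid (atlas_groupoid X D)"

definition orbispace :: "('u, 'o, 'm) fibred \<Rightarrow> bool" where
  "orbispace X \<longleftrightarrow> stack X \<and> (\<exists>D. orbispace_atlas X D)"


section \<open>Realization of the simplicial space of a groupoid\<close>

text \<open>
  A point of \<open>A\<^sup>n = A \<times>\<^sub>X \<dots> \<times>\<^sub>X A\<close> (\<open>n + 1\<close> factors) is a family of \<open>n + 1\<close> points with compatible
  isomorphisms between their images in \<open>X\<close>, i.e. a functor to the groupoid from the groupoid with objects
  \<open>0, \<dots>, n\<close> and exactly one arrow \<open>g (i, j)\<close> from \<open>j\<close> to \<open>i\<close> for all \<open>i\<close> and \<open>j\<close>.
\<close>

definition nerve_space :: "('b, 'g) tgroupoid \<Rightarrow> nat \<Rightarrow> (nat \<times> nat \<Rightarrow> 'g) topology" where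
  "nerve_space G n =
     subtopology (product_topology (\<lambda>_. arr G) ({..n} \<times> {..n}))
       {g. \<forall>i\<le>n. \<forall>j\<le>n. \<forall>k\<le>n. src G (g (i, j)) = rng G (g (j, k)) \<and>
             prd G (g (i, j)) (g (j, k)) = g (i, k)}"

definition nerve_op :: "nat \<Rightarrow> (nat \<Rightarrow> nat) \<Rightarrow> (nat \<times> nat \<Rightarrow> 'g) \<Rightarrow> nat \<times> nat \<Rightarrow> 'g" where
  "nerve_op m \<theta> g = restrict (\<lambda>(i, j). g (\<theta> i, \<theta> j)) ({..m} \<times> {..m})"

definition simplex_op :: "nat \<Rightarrow> (nat \<Rightarrow> nat) \<Rightarrow> (nat \<Rightarrow> real) \<Rightarrow> nat \<Rightarrow> real" where
  "simplex_op m \<theta> t = (\<lambda>j. \<Sum>i | i \<le> m \<and> \<theta> i = j. t i)"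

type_synonym 'g cell = "nat \<times> (nat \<times> nat \<Rightarrow> 'g) \<times> (nat \<Rightarrow> real)"

definition cells :: "('b, 'g) tgroupoid \<Rightarrow> 'g cell topology" where
  "cells G = sum_topology
     (\<lambda>n. prod_topology (nerve_space G n) (subtopology (powertop_real UNIV) (standard_simplex n))) UNIV"

definition glue :: "('b, 'g) tgroupoid \<Rightarrow> 'g cell rel" where
  "glue G = {((m, nerve_op m \<theta> g, t), (n, g, simplex_op m \<theta> t)) | m n \<theta> g t.
      mono_on {..m} \<theta> \<and> \<theta> ` {..m} \<subseteq> {..n} \<and> g \<in> topspace (nerve_space G n) \<and>
      t \<in> standard_simplex m}"

definition rcls :: "('b, 'g) tgroupoid \<Rightarrow> 'g cell \<Rightarrow> 'g cell set" where
  "rcls G x = ((glue G \<union> (glue G)\<inverse>)\<^sup>*) `` {x}"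

definition realization :: "('b, 'g) tgroupoid \<Rightarrow> 'g cell set topology" where
  "realization G =
     topology (\<lambda>U. U \<subseteq> rcls G ` topspace (cells G) \<and>
                   openin (cells G) {x \<in> topspace (cells G). rcls G x \<in> U})"

lemma openin_realization:
  "openin (realization G) U \<longleftrightarrow> U \<subseteq> rcls G ` topspace (cells G) \<and>
     openin (cells G) {x \<in> topspace (cells G). rcls G x \<in> U}"
proof -
  let ?P = "\<lambda>U. U \<subseteq> rcls G ` topspace (cells G) \<and>
                openin (cells G) {x \<in> topspace (cells G). rcls G x \<in> U}"
  have "istopology ?P"
    unfolding istopology_def
  proof (intro conjI allI impI)
    fix S T assume "?P S" "?P T"
    moreover have "{x \<in> topspace (cells G). rcls G x \<in> S \<inter> T} =
        {x \<in> topspace (cells G). rcls G x \<in> S} \<inter> {x \<in> topspace (cells G). rcls G x \<in> T}" by auto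
    ultimately show "S \<inter> T \<subseteq> rcls G ` topspace (cells G)"
      "openin (cells G) {x \<in> topspace (cells G). rcls G x \<in> S \<inter> T}" by auto
  next
    fix K assume K: "\<forall>U\<in>K. ?P U"
    have "{x \<in> topspace (cells G). rcls G x \<in> \<Union>K} =
        \<Union>((\<lambda>U. {x \<in> topspace (cells G). rcls G x \<in> U}) ` K)" by auto
    with K show "\<Union>K \<subseteq> rcls G ` topspace (cells G)"
      "openin (cells G) {x \<in> topspace (cells G). rcls G x \<in> \<Union>K}" by auto
  qed
  then show ?thesis by (simp add: realization_def topology_inverse')
qed

text \<open>The map of realizations induced by the map \<open>\<alpha>\<close> on arrows of a functor with target \<open>H\<close>.\<close>

definition realization_map :: "('b, 'h) tgroupoid \<Rightarrow> ('g \<Rightarrow> 'h) \<Rightarrow> 'g cell set \<Rightarrow> 'h cell set" where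
  "realization_map H \<alpha> C =
     (case (SOME x. x \<in> C) of (n, g, t) \<Rightarrow> rcls H (n, restrict (\<alpha> \<circ> g) ({..n} \<times> {..n}), t))"


section \<open>Singular cohomology with integer coefficients\<close>

text \<open>
  The singular chain groups being free, a cochain is a function on singular simplices, extended
  by zero to functions which are not singular simplices.
\<close>

type_synonym 'a cochain = "((nat \<Rightarrow> real) \<Rightarrow> 'a) \<Rightarrow> int"

definition cochain_set :: "nat \<Rightarrow> 'a topology \<Rightarrow> 'a cochain set" where
  "cochain_set n Y = {c. \<forall>\<tau>. \<tau> \<notin> singular_simplex_set n Y \<longrightarrow> c \<tau> = 0}"

definition coboundary :: "nat \<Rightarrow> 'a topology \<Rightarrow> 'a cochain \<Rightarrow> 'a cochain" where
  "coboundary n Y c = (\<lambda>\<tau>. if \<tau> \<in> singular_simplex_set (Suc n) Y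
      then \<Sum>k\<le>Suc n. (-1) ^ k * c (singular_face (Suc n) k \<tau>) else 0)"

definition cocycle_group :: "nat \<Rightarrow> 'a topology \<Rightarrow> 'a cochain monoid" where
  "cocycle_group n Y =
     \<lparr> carrier = {c \<in> cochain_set n Y. coboundary n Y c = (\<lambda>_. 0)},
       monoid.mult = (\<lambda>c d \<tau>. c \<tau> + d \<tau>), one = (\<lambda>_. 0) \<rparr>"

definition coboundary_set :: "nat \<Rightarrow> 'a topology \<Rightarrow> 'a cochain set" where
  "coboundary_set n Y =
     (case n of 0 \<Rightarrow> {\<lambda>_. 0} | Suc m \<Rightarrow> coboundary m Y ` cochain_set m Y)"

definition cohomology_group :: "nat \<Rightarrow> 'a topology \<Rightarrow> 'a cochain set monoid" where
  "cohomology_group n Y = cocycle_group n Y Mod coboundary_set n Y"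

definition cochain_pullback ::
  "nat \<Rightarrow> 'a topology \<Rightarrow> ('a \<Rightarrow> 'b) \<Rightarrow> 'b cochain \<Rightarrow> 'a cochain" where
  "cochain_pullback n Y f c =
     (\<lambda>\<tau>. if \<tau> \<in> singular_simplex_set n Y then c (simplex_map n f \<tau>) else 0)"

definition cohomology_pullback ::
  "nat \<Rightarrow> 'a topology \<Rightarrow> ('a \<Rightarrow> 'b) \<Rightarrow> 'b cochain set \<Rightarrow> 'a cochain set" where
  "cohomology_pullback n Y f \<xi> =
     coboundary_set n Y #>\<^bsub>cocycle_group n Y\<^esub> cochain_pullback n Y f (SOME c. c \<in> \<xi>)"

definition orbispace_cohomology ::
  "nat \<Rightarrow> ('u, 'o, 'm) fibred \<Rightarrow> ('o, 'm) atlas_data \<Rightarrow> 'u cell set cochain set monoid" where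
  "orbispace_cohomology n X D = cohomology_group n (realization (atlas_groupoid X D))"


section \<open>Principal \<open>U(1)\<close>-bundles\<close>

definition U1 :: "complex monoid" where
  "U1 = \<lparr> carrier = sphere 0 1, monoid.mult = (*), one = 1 \<rparr>"

definition U1_top :: "complex topology" where
  "U1_top = top_of_set (sphere 0 1)"

record 'u pbundle =
  base :: "'u topology"
  tot :: "'u topology"
  prj :: "'u \<Rightarrow> 'u"
  act :: "'u \<Rightarrow> complex \<Rightarrow> 'u"

definition principal_bundle :: "'u pbundle \<Rightarrow> bool" where
  "principal_bundle P \<longleftrightarrow>
     continuous_map (tot P) (base P) (prj P) \<and>
     continuous_map (prod_topology (tot P) U1_top) (tot P) (\<lambda>(x, \<zeta>). act P x \<zeta>) \<and>
     (\<forall>x\<in>topspace (tot P). act P x 1 = x \<and>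
        (\<forall>\<zeta>\<in>sphere 0 1. prj P (act P x \<zeta>) = prj P x \<and>
           (\<forall>\<xi>\<in>sphere 0 1. act P (act P x \<zeta>) \<xi> = act P x (\<zeta> * \<xi>)))) \<and>
     (\<forall>t\<in>topspace (base P). \<exists>U e. openin (base P) U \<and> t \<in> U \<and>
        continuous_map (subtopology (base P) U) (tot P) e \<and> (\<forall>y\<in>U. prj P (e y) = y) \<and>
        homeomorphic_map (prod_topology (subtopology (base P) U) U1_top)
          (subtopology (tot P) {x \<in> topspace (tot P). prj P x \<in> U})
          (\<lambda>(y, \<zeta>). act P (e y) \<zeta>))"

record 'u pmorphism =
  bdom :: "'u pbundle"
  bcod :: "'u pbundle"
  bmap :: "'u \<Rightarrow> 'u"
  tmap :: "'u \<Rightarrow> 'u"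

definition bundle_morphism :: "'u pmorphism \<Rightarrow> bool" where
  "bundle_morphism m \<longleftrightarrow> principal_bundle (bdom m) \<and> principal_bundle (bcod m) \<and>
     space_map (base (bdom m)) (base (bcod m)) (bmap m) \<and>
     space_map (tot (bdom m)) (tot (bcod m)) (tmap m) \<and>
     (\<forall>x\<in>topspace (tot (bdom m)). prj (bcod m) (tmap m x) = bmap m (prj (bdom m) x) \<and>
        (\<forall>\<zeta>\<in>sphere 0 1. tmap m (act (bdom m) x \<zeta>) = act (bcod m) (tmap m x) \<zeta>))"

text \<open>The classifying stack \<open>[*/U(1)]\<close>.\<close>

definition BU1 :: "('u, 'u pbundle, 'u pmorphism) fibred" where
  "BU1 =
     \<lparr> Ob = {P. principal_bundle P},
       Mor = {m. bundle_morphism m},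
       Dom = bdom,
       Cod = bcod,
       Idm = (\<lambda>P. \<lparr> bdom = P, bcod = P, bmap = restrict id (topspace (base P)),
                    tmap = restrict id (topspace (tot P)) \<rparr>),
       Cmp = (\<lambda>m n. \<lparr> bdom = bdom n, bcod = bcod m,
                      bmap = compose (topspace (base (bdom n))) (bmap m) (bmap n),
                      tmap = compose (topspace (tot (bdom n))) (tmap m) (tmap n) \<rparr>),
       sp = base,
       mp = bmap \<rparr>"

text \<open>
  The first Chern class of a circle bundle \<open>q: E \<rightarrow> Y\<close> with right action \<open>R\<close> of \<open>U(1)\<close>, that is,
  the Euler class, defined through a global angular form (Bott and Tu, section 6, where \<open>d\<psi> = -\<pi>\<^sup>*e\<close>)
  in singular cochains: \<open>\<kappa>\<close> is the class of a cocycle \<open>c\<close> such that \<open>-q\<^sup>*c\<close> is the coboundary of a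
  cochain \<open>\<omega>\<close> on \<open>E\<close> which restricts on each fibre to a cocycle representing the generator of
  \<open>H\<^sup>1\<close> determined by the orientation of \<open>U(1)\<close>.
\<close>

definition fibre_loop :: "('e \<Rightarrow> complex \<Rightarrow> 'e) \<Rightarrow> 'e \<Rightarrow> (nat \<Rightarrow> real) \<Rightarrow> 'e" where
  "fibre_loop R x = restrict (\<lambda>t. R x (exp (2 * of_real pi * \<i> * of_real (t 1)))) (standard_simplex 1)"

definition is_chern_class ::
  "'e topology \<Rightarrow> 'y topology \<Rightarrow> ('e \<Rightarrow> 'y) \<Rightarrow> ('e \<Rightarrow> complex \<Rightarrow> 'e) \<Rightarrow> 'y cochain set \<Rightarrow> bool" where
  "is_chern_class E Y q R \<kappa> \<longleftrightarrow> \<kappa> \<in> carrier (cohomology_group 2 Y) \<and>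
     (\<exists>c\<in>\<kappa>. \<exists>\<omega>\<in>cochain_set 1 E.
        coboundary 1 E \<omega> = (\<lambda>\<tau>. - cochain_pullback 2 E q c \<tau>) \<and>
        (\<forall>y\<in>topspace Y. \<forall>\<tau>\<in>singular_simplex_set 2 (subtopology E {x \<in> topspace E. q x = y}).
           coboundary 1 E \<omega> \<tau> = 0) \<and>
        (\<forall>x\<in>topspace E. \<omega> (fibre_loop R x) = 1))"

text \<open>
  A principal \<open>U(1)\<close>-bundle over \<open>X\<close> is a stack map \<open>(p\<^sub>o, p\<^sub>m)\<close> from \<open>X\<close> to \<open>BU1\<close>.  The pullback
  \<open>Q = A \<times>\<^sub>X P\<close> of its underlying stack \<open>P\<close> to the atlas is the total space of \<open>p\<^sub>o (atl D)\<close>, an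
  atlas of \<open>P\<close>; and \<open>Q \<times>\<^sub>P Q\<close> is the total space of \<open>p\<^sub>o (dbl D)\<close>.  The realization of
  the simplicial space of \<open>Q \<rightarrow> P\<close> is a circle bundle over that of \<open>A \<rightarrow> X\<close>, and the Chern class of
  \<open>P\<close> is the Chern class of this bundle.
\<close>

definition bundle_groupoid ::
  "('u, 'o, 'm) fibred \<Rightarrow> ('o, 'm) atlas_data \<Rightarrow> ('o \<Rightarrow> 'u pbundle) \<Rightarrow> ('m \<Rightarrow> 'u pmorphism)
     \<Rightarrow> ('u, 'u) tgroupoid" where
  "bundle_groupoid X D p\<^sub>o p\<^sub>m = span_groupoid X D (\<lambda>x. tot (p\<^sub>o x)) (\<lambda>m. tmap (p\<^sub>m m))"

definition classified_by ::
  "('u, 'o, 'm) fibred \<Rightarrow> ('o, 'm) atlas_data \<Rightarrow> ('o \<Rightarrow> 'u pbundle) \<Rightarrow> ('m \<Rightarrow> 'u pmorphism)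
     \<Rightarrow> 'u cell set cochain set \<Rightarrow> bool" where
  "classified_by X D p\<^sub>o p\<^sub>m \<kappa> \<longleftrightarrow>
     is_chern_class (realization (bundle_groupoid X D p\<^sub>o p\<^sub>m)) (realization (atlas_groupoid X D))
       (realization_map (atlas_groupoid X D) (prj (p\<^sub>o (dbl D))))
       (\<lambda>x \<zeta>. realization_map (bundle_groupoid X D p\<^sub>o p\<^sub>m) (\<lambda>g. act (p\<^sub>o (dbl D)) g \<zeta>) x) \<kappa>"


section \<open>The loop stack and the function \<open>h\<close>\<close>

definition Auts :: "('u, 'o, 'm) fibred \<Rightarrow> 'o \<Rightarrow> 'm monoid" where
  "Auts X u = \<lparr> carrier = {\<phi> \<in> Homs X u u. mp X \<phi> = restrict id (topspace (sp X u))},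
                monoid.mult = Cmp X, one = Idm X u \<rparr>"

definition loop_stack ::
  "('u, 'o, 'm) fibred \<Rightarrow> ('u, 'o \<times> 'm, ('o \<times> 'm) \<times> 'm \<times> ('o \<times> 'm)) fibred" where
  "loop_stack X =
     \<lparr> Ob = {(u, \<phi>). u \<in> Ob X \<and> \<phi> \<in> carrier (Auts X u)},
       Mor = {((u, \<phi>), k, (u', \<phi>')) | u \<phi> k u' \<phi>'. u \<in> Ob X \<and> u' \<in> Ob X \<and>
                \<phi> \<in> carrier (Auts X u) \<and> \<phi>' \<in> carrier (Auts X u') \<and>
                k \<in> Homs X u u' \<and> Cmp X \<phi>' k = Cmp X k \<phi>},
       Dom = (\<lambda>(l, k, l'). l),
       Cod = (\<lambda>(l, k, l'). l'),
       Idm = (\<lambda>(u, \<phi>). ((u, \<phi>), Idm X u, (u, \<phi>))),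
       Cmp = (\<lambda>(l', k', l'') (l, k, m). (l, Cmp X k' k, l'')),
       sp = (\<lambda>(u, \<phi>). sp X u),
       mp = (\<lambda>(l, k, l'). mp X k) \<rparr>"

definition h_fun ::
  "('u, 'o, 'm) fibred \<Rightarrow> ('o \<Rightarrow> 'u pbundle) \<Rightarrow> ('m \<Rightarrow> 'u pmorphism) \<Rightarrow> 'o \<times> 'm \<Rightarrow> 'u \<Rightarrow> complex" where
  "h_fun X p\<^sub>o p\<^sub>m = (\<lambda>(u, \<phi>). \<lambda>t\<in>topspace (sp X u). THE \<zeta>. \<zeta> \<in> sphere 0 1 \<and>
     (\<forall>x\<in>topspace (tot (p\<^sub>o u)). prj (p\<^sub>o u) x = t \<longrightarrow> tmap (p\<^sub>m \<phi>) x = act (p\<^sub>o u) x \<zeta>))"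


section \<open>Characters and second cohomology of finite groups\<close>

definition characters :: "('g, 'x) monoid_scheme \<Rightarrow> ('g \<Rightarrow> complex) set" where
  "characters \<Gamma> = hom \<Gamma> U1 \<inter> extensional (carrier \<Gamma>)"

text \<open>
  Classes in \<open>H\<^sup>2(\<Gamma>; \<int>)\<close> are cosets of the coboundaries among inhomogeneous 2-cocycles, the
  coboundary of a 1-cochain \<open>f\<close> being \<open>f h - f (g h) + f g\<close>.
\<close>

definition group_class2 :: "('g, 'x) monoid_scheme \<Rightarrow> ('g \<Rightarrow> 'g \<Rightarrow> int) \<Rightarrow> ('g \<Rightarrow> 'g \<Rightarrow> int) set" where
  "group_class2 \<Gamma> z = {z'. (\<forall>g h. \<not> (g \<in> carrier \<Gamma> \<and> h \<in> carrier \<Gamma>) \<longrightarrow> z' g h = 0) \<and>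
     (\<exists>b. \<forall>g\<in>carrier \<Gamma>. \<forall>h\<in>carrier \<Gamma>. z' g h = z g h + (b h - b (g \<otimes>\<^bsub>\<Gamma>\<^esub> h) + b g))}"

text \<open>
  The Bockstein boundary of a character: the coboundaries of all its lifts to real-valued
  1-cochains.  As \<open>f\<close> varies, these form exactly one class.
\<close>

definition bockstein :: "('g, 'x) monoid_scheme \<Rightarrow> ('g \<Rightarrow> complex) \<Rightarrow> ('g \<Rightarrow> 'g \<Rightarrow> int) set" where
  "bockstein \<Gamma> \<psi> = {z. (\<forall>g h. \<not> (g \<in> carrier \<Gamma> \<and> h \<in> carrier \<Gamma>) \<longrightarrow> z g h = 0) \<and>
     (\<exists>f :: 'g \<Rightarrow> real. (\<forall>g\<in>carrier \<Gamma>. \<psi> g = exp (2 * of_real pi * \<i> * of_real (f g))) \<and>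
        (\<forall>g\<in>carrier \<Gamma>. \<forall>h\<in>carrier \<Gamma>. real_of_int (z g h) = f h - f (g \<otimes>\<^bsub>\<Gamma>\<^esub> h) + f g))}"

text \<open>The groupoid of the atlas \<open>* \<rightarrow> [*/\<Gamma>]\<close>.\<close>

definition one_object_groupoid :: "('g, 'x) monoid_scheme \<Rightarrow> (unit, 'g) tgroupoid" where
  "one_object_groupoid \<Gamma> =
     \<lparr> obj = discrete_topology UNIV, arr = discrete_topology (carrier \<Gamma>),
       src = (\<lambda>_. ()), rng = (\<lambda>_. ()), ident = (\<lambda>_. \<one>\<^bsub>\<Gamma>\<^esub>), prd = (\<otimes>\<^bsub>\<Gamma>\<^esub>) \<rparr>"

text \<open>
  The isomorphism from \<open>H\<^sup>2([*/\<Gamma>]; \<int>)\<close> to \<open>H\<^sup>2(\<Gamma>; \<int>)\<close> evaluates a singular cocycle on the 2-simplices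
  of the bar construction.  The one given by \<open>\<gamma>\<^sub>1\<close> and \<open>\<gamma>\<^sub>2\<close> has the homogeneous coordinates
  \<open>v\<^sub>0 = 1\<close>, \<open>v\<^sub>1 = \<gamma>\<^sub>1\<close>, \<open>v\<^sub>2 = \<gamma>\<^sub>1\<gamma>\<^sub>2\<close>, and \<open>g (i, j)\<close> is the product of the inverse of \<open>v\<^sub>i\<close> with \<open>v\<^sub>j\<close>.
\<close>

definition bar_simplex2 ::
  "('g, 'x) monoid_scheme \<Rightarrow> 'g \<Rightarrow> 'g \<Rightarrow> (nat \<Rightarrow> real) \<Rightarrow> 'g cell set" where
  "bar_simplex2 \<Gamma> \<gamma>\<^sub>1 \<gamma>\<^sub>2 =
     (let v = (\<lambda>i::nat. if i = 0 then \<one>\<^bsub>\<Gamma>\<^esub> else if i = 1 then \<gamma>\<^sub>1 else \<gamma>\<^sub>1 \<otimes>\<^bsub>\<Gamma>\<^esub> \<gamma>\<^sub>2)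
      in restrict (\<lambda>t. rcls (one_object_groupoid \<Gamma>)
           (2, restrict (\<lambda>(i, j). inv\<^bsub>\<Gamma>\<^esub> (v i) \<otimes>\<^bsub>\<Gamma>\<^esub> v j) ({..2} \<times> {..2}), t))
           (standard_simplex 2))"

definition nerve_to_group_class ::
  "('g, 'x) monoid_scheme \<Rightarrow> 'g cell set cochain set \<Rightarrow> ('g \<Rightarrow> 'g \<Rightarrow> int) set" where
  "nerve_to_group_class \<Gamma> \<xi> =
     group_class2 \<Gamma> (\<lambda>\<gamma>\<^sub>1 \<gamma>\<^sub>2. (SOME c. c \<in> \<xi>) (bar_simplex2 \<Gamma> \<gamma>\<^sub>1 \<gamma>\<^sub>2))"

text \<open>The character corresponding to a class in \<open>H\<^sup>2([*/\<Gamma>]; \<int>)\<close>, for \<open>\<Gamma>\<close> finite.\<close>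

definition character_of_class ::
  "('g, 'x) monoid_scheme \<Rightarrow> 'g cell set cochain set \<Rightarrow> 'g \<Rightarrow> complex" where
  "character_of_class \<Gamma> \<xi> =
     (THE \<psi>. \<psi> \<in> characters \<Gamma> \<and> bockstein \<Gamma> \<psi> = nerve_to_group_class \<Gamma> \<xi>)"


section \<open>The function \<open>\<chi>\<close>-bar\<close>

text \<open>
  Let \<open>v\<close> be a point of \<open>X\<close>, i.e. an object over a one-point space, and let \<open>k: v \<rightarrow> atl D\<close>
  lift it to the atlas.  The map \<open>[*/\<Gamma>] \<rightarrow> X\<close> induced by a group \<open>\<Gamma>\<close> of automorphisms
  of \<open>v\<close> is then represented by the map of groupoids which sends \<open>\<gamma>\<close> to the arrow \<open>k \<circ> \<gamma> \<circ> k\<^sup>-\<^sup>1\<close> of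
  \<open>A \<times>\<^sub>X A\<close>, determined by the span \<open>(k, k \<circ> \<gamma>)\<close>.  The map on cohomology does not depend on the
  choice of \<open>k\<close>.
\<close>

definition point_arrow ::
  "('u, 'o, 'm) fibred \<Rightarrow> ('o, 'm) atlas_data \<Rightarrow> 'o \<Rightarrow> 'm \<Rightarrow> 'm \<Rightarrow> 'u" where
  "point_arrow X D v k \<gamma> =
     mp X (THE m. m \<in> Homs X v (dbl D) \<and> Cmp X (p_src D) m = k \<and> Cmp X (p_rng D) m = Cmp X k \<gamma>)
       (the_elem (topspace (sp X v)))"

definition point_pullback ::
  "('u, 'o, 'm) fibred \<Rightarrow> ('o, 'm) atlas_data \<Rightarrow> 'u cell set cochain set \<Rightarrow> 'o \<Rightarrow> 'm monoid
     \<Rightarrow> 'm cell set cochain set" where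
  "point_pullback X D \<kappa> v \<Gamma> =
     cohomology_pullback 2 (realization (one_object_groupoid \<Gamma>))
       (realization_map (atlas_groupoid X D) (point_arrow X D v (SOME k. k \<in> Homs X v (atl D)))) \<kappa>"

definition chi_bar_point ::
  "('u, 'o, 'm) fibred \<Rightarrow> ('o, 'm) atlas_data \<Rightarrow> 'u cell set cochain set \<Rightarrow> 'o \<times> 'm \<Rightarrow> complex" where
  "chi_bar_point X D \<kappa> = (\<lambda>(v, \<gamma>).
     let \<Gamma> = subgroup_generated (Auts X v) {\<gamma>}
     in character_of_class \<Gamma> (point_pullback X D \<kappa> v \<Gamma>) \<gamma>)"

text \<open>
  A function on the points of \<open>LX\<close> assigns to every object \<open>l\<close> of \<open>LX\<close> over a space \<open>T\<close> a function
  on \<open>T\<close>: its value at \<open>t\<close> is the value of the given function at the restriction of \<open>l\<close> to \<open>t\<close>.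
\<close>

definition loop_restriction ::
  "('u, 'o, 'm) fibred \<Rightarrow> 'o \<times> 'm \<Rightarrow> 'u \<Rightarrow> 'o \<times> 'm \<Rightarrow> bool" where
  "loop_restriction X l t l' \<longleftrightarrow> l' \<in> Ob (loop_stack X) \<and>
     (\<exists>y. topspace (sp (loop_stack X) l') = {y} \<and>
        (\<exists>m\<in>Homs (loop_stack X) l' l. mp (loop_stack X) m y = t))"

definition chi_bar ::
  "('u, 'o, 'm) fibred \<Rightarrow> ('o, 'm) atlas_data \<Rightarrow> 'u cell set cochain set \<Rightarrow> 'o \<times> 'm \<Rightarrow> 'u \<Rightarrow> complex" where
  "chi_bar X D \<kappa> l =
     (\<lambda>t\<in>topspace (sp (loop_stack X) l). chi_bar_point X D \<kappa> (SOME l'. loop_restriction X l t l'))"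

end

theory Submission
  imports Defs
begin

text \<open>
  Restricting to a point \<open>v\<close> with automorphism \<open>\<gamma>\<close>, the fibre of the bundle over \<open>v\<close> is a circle on which
  \<open>\<Gamma> = \<langle>\<gamma>\<rangle>\<close> acts through the character \<open>\<zeta> = h\<close>.  A choice of angles, \<open>\<zeta> = exp (2\<pi>i\<theta>)\<close>, lifts every
  simplex of the bar construction of \<open>\<Gamma>\<close> to the realization of the bundle groupoid, together with a rotation
  by an arbitrary affine function of the barycentric coordinates.  Evaluating \<open>d\<omega> = -q\<^sup>*c\<close> on such lifted
  triangles determines the angular cochain \<open>\<omega>\<close> on lifted edges up to a 1-cochain \<open>C\<close> on \<open>\<Gamma>\<close>: along a
  lift of \<open>\<gamma>\<close> it is the winding \<open>-\<theta> \<gamma>\<close>, rounded to an integer, plus \<open>C \<gamma>\<close>.  Hence \<open>c\<close> restricts on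
  \<open>\<Gamma>\<close> to \<open>d\<theta> - dC\<close>, which represents the Bockstein of \<open>\<zeta>\<close>.  The Bockstein is injective because
  \<open>\<Gamma>\<close> is finite, an isotropy group of a proper etale groupoid being compact and discrete.
\<close>

section \<open>Realizations\<close>

text \<open>The rotation of the lifts is forced by what is known about \<open>\<omega>\<close>: its
  values are prescribed on full fibre loops only. Letting the vertex angles run through the reals,
  and not through the reals modulo 1, makes such a loop one of the lifted edges, with angles
  \<open>x\<close> and \<open>x + 1\<close>. The values of \<open>\<omega>\<close> on edges over the
  identity are then differences of a function \<open>W\<close> with
  \<open>W (x + n) = W x + n\<close>, and the integer by which the chosen angles fail to be additive
  enters through this shift. The condition that \<open>\<omega>\<close> be closed along the fibres
  is applied to a single lifted triangle, the one without rotation over the identity; it makes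
  \<open>c\<close> vanish on the degenerate triangle. Cocycles, lifts to the atlas and restrictions
  to points are given by choice operators. The comparison is therefore made with cochains, every
  change of representative being recorded as a coboundary.\<close>

definition skip :: "nat \<Rightarrow> nat \<Rightarrow> nat" where
  "skip k i = (if i < k then i else Suc i)"

text \<open>\<open>skip k\<close> is the coface operator that misses \<open>k\<close>. Its fibres
  have at most one element, so pushing coordinates forward along it only inserts a zero at place
  \<open>k\<close>.\<close>

lemma simplex_op_skip:
  assumes "u \<in> standard_simplex n" "k \<le> Suc n"
  shows "simplex_op n (skip k) u = simplical_face k u"
proof
  fix j
  have "{i. i \<le> n \<and> skip k i = j} =
      (if j < k then {j} else if j = k then {} else if j - 1 \<le> n then {j - 1} else {})"
    using assms by (auto simp: skip_def split: if_splits)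
  then show "simplex_op n (skip k) u j = simplical_face k u j"
    using assms by (auto simp: simplex_op_def simplical_face_def standard_simplex_def)
qed

lemma rcls_self: "x \<in> rcls G x"
  by (simp add: rcls_def)

lemma rcls_eqI:
  assumes "(x, y) \<in> glue G \<union> (glue G)\<inverse>"
  shows "rcls G x = rcls G y"
proof -
  let ?R = "glue G \<union> (glue G)\<inverse>"
  have "sym (?R\<^sup>*)" by (simp add: sym_Un_converse sym_rtrancl)
  moreover have "(x, y) \<in> ?R\<^sup>*" using assms by blast
  ultimately show ?thesis
    unfolding rcls_def by (blast intro: rtrancl_trans dest: symD)
qed

lemma rcls_glue:
  assumes "g \<in> topspace (nerve_space G n)" "t \<in> standard_simplex m"
    and "mono_on {..m} \<theta>" "\<theta> ` {..m} \<subseteq> {..n}"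
  shows "rcls G (m, nerve_op m \<theta> g, t) = rcls G (n, g, simplex_op m \<theta> t)"
  by (rule rcls_eqI) (use assms in \<open>unfold glue_def, blast\<close>)

lemma topspace_nerve_space:
  "g \<in> topspace (nerve_space G n) \<longleftrightarrow>
     g \<in> extensional ({..n} \<times> {..n}) \<and> (\<forall>i\<le>n. \<forall>j\<le>n. g (i, j) \<in> topspace (arr G)) \<and>
     (\<forall>i\<le>n. \<forall>j\<le>n. \<forall>k\<le>n. src G (g (i, j)) = rng G (g (j, k)) \<and>
        prd G (g (i, j)) (g (j, k)) = g (i, k))"
  by (auto simp: nerve_space_def PiE_iff)

lemma topspace_realization: "topspace (realization G) = rcls G ` topspace (cells G)"
proof
  show "topspace (realization G) \<subseteq> rcls G ` topspace (cells G)"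
    using openin_realization[of G "topspace (realization G)"] by auto
  have "{x \<in> topspace (cells G). rcls G x \<in> rcls G ` topspace (cells G)} = topspace (cells G)"
    by auto
  then have "openin (realization G) (rcls G ` topspace (cells G))"
    unfolding openin_realization by simp
  then show "rcls G ` topspace (cells G) \<subseteq> topspace (realization G)"
    by (rule openin_subset)
qed

lemma continuous_map_rcls: "continuous_map (cells G) (realization G) (rcls G)"
  unfolding continuous_map_def topspace_realization by (auto simp: openin_realization)

lemma continuous_map_cell:
  assumes "continuous_map Z (nerve_space G n) \<Phi>"
    and "continuous_map Z (subtopology (powertop_real UNIV) (standard_simplex n)) \<Psi>"
  shows "continuous_map Z (realization G) (\<lambda>z. rcls G (n, \<Phi> z, \<Psi> z))"
proof -
  let ?C = "\<lambda>n. prod_topology (nerve_space G n)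
              (subtopology (powertop_real UNIV) (standard_simplex n))"
  have "continuous_map Z (?C n) (\<lambda>z. (\<Phi> z, \<Psi> z))"
    using assms by (simp add: continuous_map_paired)
  moreover have "continuous_map (?C n) (cells G) (Pair n)"
    unfolding cells_def by (rule continuous_map_component_injection) simp
  ultimately have "continuous_map Z (cells G) (Pair n \<circ> (\<lambda>z. (\<Phi> z, \<Psi> z)))"
    by (rule continuous_map_compose)
  from continuous_map_compose[OF this continuous_map_rcls] show ?thesis
    by (simp add: o_def)
qed

text \<open>A singular simplex inside the \<open>n\<close>-cells whose simplex coordinate is
  tautological. The nerve coordinate may move with \<open>u\<close>; this is how a lift can rotate
  in the fibre direction.\<close>

definition cell_simplex ::
  "('b, 'g) tgroupoid \<Rightarrow> nat \<Rightarrow> ((nat \<Rightarrow> real) \<Rightarrow> nat \<times> nat \<Rightarrow> 'g) \<Rightarrow> (nat \<Rightarrow> real) \<Rightarrow> 'g cell set"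
  where "cell_simplex G n \<Phi> = restrict (\<lambda>u. rcls G (n, \<Phi> u, u)) (standard_simplex n)"

lemma cell_simplex_cong:
  "(\<And>u. u \<in> standard_simplex n \<Longrightarrow> \<Phi> u = \<Psi> u) \<Longrightarrow> cell_simplex G n \<Phi> = cell_simplex G n \<Psi>"
  by (auto simp: cell_simplex_def intro!: restrict_ext)

lemma cell_simplex_in:
  assumes "continuous_map (subtopology (powertop_real UNIV) (standard_simplex n))
    (nerve_space G n) \<Phi>"
  shows "cell_simplex G n \<Phi> \<in> singular_simplex_set n (realization G)"
proof -
  let ?S = "subtopology (powertop_real UNIV) (standard_simplex n)"
  have "continuous_map ?S (realization G) (\<lambda>u. rcls G (n, \<Phi> u, u))"
    using assms continuous_map_cell[of ?S G n \<Phi> id] by (auto simp del: subtopology_UNIV)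
  then have "continuous_map ?S (realization G) (cell_simplex G n \<Phi>)"
    by (rule continuous_map_eq) (simp add: cell_simplex_def)
  then show ?thesis
    by (simp add: singular_simplex_def cell_simplex_def)
qed

lemma cell_simplex_in_const:
  assumes "g \<in> topspace (nerve_space G n)"
  shows "cell_simplex G n (\<lambda>_. g) \<in> singular_simplex_set n (realization G)"
  by (rule cell_simplex_in) (use assms in simp)

lemma mono_on_skip: "mono_on A (skip k)"
  by (auto simp: mono_on_def skip_def)

text \<open>On a face the simplex coordinate is pushed forward along \<open>skip k\<close>, so the
  gluing relation moves the point to a cell of one dimension less, where the simplex coordinate is
  again tautological.\<close>

lemma singular_face_cell_simplex:
  assumes "k \<le> Suc n" "\<And>u. u \<in> standard_simplex (Suc n) \<Longrightarrow> \<Phi> u \<in> topspace (nerve_space G (Suc n))"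
  shows "singular_face (Suc n) k (cell_simplex G (Suc n) \<Phi>) =
    cell_simplex G n (\<lambda>u. nerve_op n (skip k) (\<Phi> (simplical_face k u)))"
proof
  fix u
  show "singular_face (Suc n) k (cell_simplex G (Suc n) \<Phi>) u =
    cell_simplex G n (\<lambda>u. nerve_op n (skip k) (\<Phi> (simplical_face k u))) u"
  proof (cases "u \<in> standard_simplex n")
    case True
    then have f: "simplical_face k u \<in> standard_simplex (Suc n)"
      using simplical_face_in_standard_simplex[of "Suc n" k u] assms(1) by simp
    have "rcls G (n, nerve_op n (skip k) (\<Phi> (simplical_face k u)), u) =
        rcls G (Suc n, \<Phi> (simplical_face k u), simplex_op n (skip k) u)"
      using True f assms by (intro rcls_glue mono_on_skip) (auto simp: skip_def)
    with True f assms(1) show ?thesis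
      by (simp add: singular_face_def cell_simplex_def simplex_op_skip)
  qed (simp add: singular_face_def cell_simplex_def)
qed

text \<open>Stated on arrows alone because a point of the nerve is a family of arrows. Products are
  constrained only where they lie in the arrow space, as all products in a point of the nerve
  do.\<close>

definition arrow_functor :: "('b, 'g) tgroupoid \<Rightarrow> ('c, 'h) tgroupoid \<Rightarrow> ('g \<Rightarrow> 'h) \<Rightarrow> bool" where
  "arrow_functor G H \<alpha> \<longleftrightarrow> \<alpha> ` topspace (arr G) \<subseteq> topspace (arr H) \<and>
     (\<forall>a\<in>topspace (arr G). \<forall>b\<in>topspace (arr G). src G a = rng G b \<longrightarrow> prd G a b \<in> topspace (arr G) \<longrightarrow>
        src H (\<alpha> a) = rng H (\<alpha> b) \<and> prd H (\<alpha> a) (\<alpha> b) = \<alpha> (prd G a b))"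

definition nerve_map :: "nat \<Rightarrow> ('g \<Rightarrow> 'h) \<Rightarrow> (nat \<times> nat \<Rightarrow> 'g) \<Rightarrow> nat \<times> nat \<Rightarrow> 'h" where
  "nerve_map n \<alpha> g = restrict (\<alpha> \<circ> g) ({..n} \<times> {..n})"

lemma nerve_map_in:
  assumes "arrow_functor G H \<alpha>" "g \<in> topspace (nerve_space G n)"
  shows "nerve_map n \<alpha> g \<in> topspace (nerve_space H n)"
  using assms unfolding arrow_functor_def topspace_nerve_space nerve_map_def
  by (simp add: image_subset_iff)

lemma nerve_map_op:
  "\<theta> ` {..m} \<subseteq> {..n} \<Longrightarrow> nerve_map m \<alpha> (nerve_op m \<theta> g) = nerve_op m \<theta> (nerve_map n \<alpha> g)"
  by (auto simp: nerve_map_def nerve_op_def fun_eq_iff image_subset_iff)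

lemma glue_nerve_map:
  assumes "arrow_functor G H \<alpha>" "((m, g, t), (n, g', t')) \<in> glue G"
  shows "((m, nerve_map m \<alpha> g, t), (n, nerve_map n \<alpha> g', t')) \<in> glue H"
  using assms unfolding glue_def
  by (auto simp: nerve_map_op intro: nerve_map_in)

text \<open>A functor sends gluings to gluings, hence a zigzag of gluings between two
  representatives to another one; the representative picked by SOME does not matter.\<close>

lemma realization_map_rcls:
  assumes "arrow_functor G H \<alpha>"
  shows "realization_map H \<alpha> (rcls G (n, g, t)) = rcls H (n, nerve_map n \<alpha> g, t)"
proof -
  define F where "F = (\<lambda>(n, g, t). rcls H (n, nerve_map n \<alpha> g, t))"
  define x where "x = (SOME x. x \<in> rcls G (n, g, t))"
  have "x \<in> rcls G (n, g, t)"
    unfolding x_def by (rule someI[of _ "(n, g, t)"]) (rule rcls_self)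
  then have "((n, g, t), x) \<in> (glue G \<union> (glue G)\<inverse>)\<^sup>*"
    by (simp add: rcls_def)
  then have "F x = F (n, g, t)"
  proof (induction rule: rtrancl_induct)
    case (step y z)
    obtain n1 g1 t1 n2 g2 t2 where y: "y = (n1, g1, t1)" and z: "z = (n2, g2, t2)"
      by (cases y, cases z) auto
    have "F y = F z"
      using step(2) glue_nerve_map[OF assms] unfolding y z F_def prod.case
      by (intro rcls_eqI) auto
    then show ?case using step by simp
  qed simp
  then show ?thesis
    by (simp add: realization_map_def F_def nerve_map_def case_prod_unfold flip: x_def)
qed

lemma simplex_map_cell_simplex:
  assumes "arrow_functor G H \<alpha>"
  shows "simplex_map n (realization_map H \<alpha>) (cell_simplex G n \<Phi>) =
    cell_simplex H n (\<lambda>u. nerve_map n \<alpha> (\<Phi> u))"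
  by (auto simp: simplex_map_def cell_simplex_def realization_map_rcls[OF assms] fun_eq_iff restrict_def)

section \<open>Lifting the bar construction to a circle bundle\<close>

text \<open>
  Here \<open>w g h x y\<close> stands for the value of \<open>\<omega>\<close> on the lift of the edge \<open>(g, h)\<close> with vertex angles \<open>x\<close>, \<open>y\<close>,
  and \<open>c g h k\<close> for that of \<open>c\<close> on a triangle.  Degenerate triangles give the dependence of \<open>w\<close> on the angles.
\<close>

lemma (in group) angular_cochain_Bockstein:
  fixes w :: "'a \<Rightarrow> 'a \<Rightarrow> real \<Rightarrow> real \<Rightarrow> int" and c :: "'a \<Rightarrow> 'a \<Rightarrow> 'a \<Rightarrow> int" and \<theta> :: "'a \<Rightarrow> real"
  assumes cob: "\<And>g h k x y z. \<lbrakk>g \<in> carrier G; h \<in> carrier G; k \<in> carrier G\<rbrakk> \<Longrightarrow>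
      - c g h k = w h k y z - w g k x z + w g h x y"
    and trans: "\<And>g h k x y. \<lbrakk>g \<in> carrier G; h \<in> carrier G; k \<in> carrier G\<rbrakk> \<Longrightarrow>
      w (k \<otimes> g) (k \<otimes> h) x y = w g h (x - \<theta> k) (y - \<theta> k)"
    and vertex: "c \<one> \<one> \<one> = 0"
    and loop: "\<And>x. w \<one> \<one> x (x + 1) = 1"
    and \<theta>: "\<And>g h. \<lbrakk>g \<in> carrier G; h \<in> carrier G\<rbrakk> \<Longrightarrow> \<theta> g + \<theta> h - \<theta> (g \<otimes> h) \<in> \<int>"
  obtains C :: "'a \<Rightarrow> int" where "\<And>g h. \<lbrakk>g \<in> carrier G; h \<in> carrier G\<rbrakk> \<Longrightarrow>
      of_int (c \<one> g (g \<otimes> h)) = \<theta> h - \<theta> (g \<otimes> h) + \<theta> g - of_int (C h - C (g \<otimes> h) + C g)"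
proof -
  \<comment> \<open>Over the identity \<open>vertex\<close> makes \<open>w\<close> a cocycle in the
    angles; \<open>W\<close> is its primitive based at angle 0.\<close>
  define W where "W = w \<one> \<one> 0"
  have w1: "w \<one> \<one> x y = W y - W x" for x y
    using cob[of \<one> \<one> \<one> x y 0] vertex unfolding W_def by simp
  \<comment> \<open>A full turn counts 1, so \<open>W\<close> behaves like the floor function under
    integer shifts.\<close>
  have W_int: "W (x + of_int n) = W x + n" for x n
  proof (induction n rule: int_induct[where k = 0])
    case (step1 i)
    then show ?case using loop[of "x + of_int i"] w1 by (simp add: add.assoc)
  next
    case (step2 i)
    then show ?case using loop[of "x + of_int (i - 1)"] w1 by simp
  qed simp
  have wg: "w g g x y = W (y - \<theta> g) - W (x - \<theta> g)" if "g \<in> carrier G" for g x y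
    using trans[of \<one> \<one> g x y] that w1 by simp
  have c1: "c \<one> \<one> g = 0" if "g \<in> carrier G" for g
    using cob[of \<one> \<one> g 0 0 0] that w1[of 0 0] by simp
  have c2: "c \<one> g g = 0" if "g \<in> carrier G" for g
    using cob[of \<one> g g 0 0 0] that wg[of g 0 0] by simp
  \<comment> \<open>Solves the next formula at \<open>x = y = 0\<close>.\<close>
  define C where "C g = w \<one> g 0 0 - W (- \<theta> g) + W 0" for g
  \<comment> \<open>The triangle \<open>(\<one>, \<one>, g)\<close> moves the first angle to 0, and
    \<open>(\<one>, g, g)\<close> then moves the second.\<close>
  have w: "w \<one> g x y = C g + W (y - \<theta> g) - W x" if g: "g \<in> carrier G" for g x y
    using cob[of \<one> \<one> g 0 y x] cob[of \<one> g g 0 y 0] c1[OF g] c2[OF g] w1 wg[OF g] g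
    unfolding C_def by simp
  show thesis
  proof (rule that[of C])
    fix g h assume gh: "g \<in> carrier G" "h \<in> carrier G"
    obtain n :: int where n: "\<theta> g + \<theta> h - \<theta> (g \<otimes> h) = of_int n"
      using \<theta>[OF gh] by (auto elim: Ints_cases)
    \<comment> \<open>Translating the edge back to start at \<open>\<one>\<close> turns both angles
      0 into \<open>- \<theta> g\<close>. Its end then contributes
      \<open>W (- \<theta> g - \<theta> h)\<close>, while the edge of the product contributes
      \<open>W (- \<theta> (g \<otimes> h))\<close>; these differ by \<open>n\<close>.\<close>
    have "w g (g \<otimes> h) 0 0 = w \<one> h (- \<theta> g) (- \<theta> g)"
      using trans[of \<one> h g 0 0] gh by simp
    moreover have "W (- \<theta> (g \<otimes> h)) = W (- \<theta> g - \<theta> h) + n"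
      using W_int[of "- \<theta> g - \<theta> h" n] n[symmetric] by (simp add: algebra_simps)
    ultimately have "c \<one> g (g \<otimes> h) = n - (C h - C (g \<otimes> h) + C g)"
      using cob[of \<one> g "g \<otimes> h" 0 0 0] gh w by simp
    then show "of_int (c \<one> g (g \<otimes> h)) = \<theta> h - \<theta> (g \<otimes> h) + \<theta> g - of_int (C h - C (g \<otimes> h) + C g)"
      using n by simp
  qed
qed

section \<open>The unit circle, with angles measured in turns\<close>

definition circle :: "real \<Rightarrow> complex" where
  "circle x = exp (2 * of_real pi * \<i> * of_real x)"

lemma circle_add: "circle (x + y) = circle x * circle y"
  by (simp add: circle_def algebra_simps flip: exp_add)

lemma circle_diff: "circle (x - y) = circle x * inverse (circle y)"
  by (simp add: circle_def algebra_simps exp_diff exp_minus divide_inverse)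

lemma norm_circle [simp]: "norm (circle x) = 1"
  by (simp add: circle_def norm_exp_eq_Re)

lemma circle_eq_1: "circle x = 1 \<longleftrightarrow> x \<in> \<int>"
proof -
  have "circle x = 1 \<longleftrightarrow> (\<exists>n::int. x = of_int n)"
    by (auto simp: circle_def exp_eq_1)
  then show ?thesis by (auto elim: Ints_cases)
qed

lemma circle_surj: "norm z = 1 \<Longrightarrow> \<exists>x. z = circle x"
proof -
  assume "norm z = 1"
  then have "z = exp (\<i> * of_real (Arg z))"
    using Arg_eq[of z] by force
  then show ?thesis
    by (intro exI[of _ "Arg z / (2 * pi)"]) (simp add: circle_def)
qed

lemma continuous_map_circle: "continuous_map euclideanreal U1_top circle"
  unfolding U1_top_def circle_def
  by (auto simp: continuous_map_in_subtopology norm_exp_eq_Re intro!: continuous_intros)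

text \<open>\<open>pr\<close> and \<open>tri\<close> label the vertices of an edge and of a
  triangle, by group elements as well as by angles. Indices past the last vertex repeat its label,
  so that membership in the carrier holds for all indices.\<close>

definition pr :: "'a \<Rightarrow> 'a \<Rightarrow> nat \<Rightarrow> 'a" where
  "pr a b i = (if i = 0 then a else b)"

definition tri :: "'a \<Rightarrow> 'a \<Rightarrow> 'a \<Rightarrow> nat \<Rightarrow> 'a" where
  "tri a b c i = (if i = 0 then a else if i = 1 then b else c)"

text \<open>An affine function restricts on a face to the affine function with the restricted vertex
  values: the inserted coordinate at \<open>k\<close> is zero and the others are reindexed by
  \<open>skip k\<close>.\<close>

lemma simplical_face_sum:
  fixes u x :: "nat \<Rightarrow> real"
  assumes "k \<le> Suc n"
  shows "(\<Sum>j\<le>Suc n. simplical_face k u j * x j) = (\<Sum>i\<le>n. u i * x (skip k i))"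
proof -
  have "{..Suc n} = insert k (skip k ` {..n})"
  proof
    show "{..Suc n} \<subseteq> insert k (skip k ` {..n})"
    proof
      fix j assume j: "j \<in> {..Suc n}"
      have "j \<in> skip k ` {..n}" if "j \<noteq> k"
        using that assms j
        by (intro image_eqI[of _ _ "if j < k then j else j - 1"]) (auto simp: skip_def)
      then show "j \<in> insert k (skip k ` {..n})" by auto
    qed
  qed (use assms in \<open>auto simp: skip_def\<close>)
  moreover have "inj_on (skip k) {..n}" "k \<notin> skip k ` {..n}"
    by (auto simp: inj_on_def skip_def split: if_splits)
  moreover have "simplical_face k u k = 0" "simplical_face k u (skip k i) = u i" for i
    by (auto simp: simplical_face_def skip_def)
  ultimately show ?thesis
    by (simp add: sum.reindex)
qed

text \<open>The point of the nerve with homogeneous coordinates \<open>v\<close>, pushed forward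
  along a map \<open>a\<close> on arrows.\<close>

definition bar :: "('g, 'x) monoid_scheme \<Rightarrow> ('g \<Rightarrow> 'y) \<Rightarrow> nat \<Rightarrow> (nat \<Rightarrow> 'g) \<Rightarrow> nat \<times> nat \<Rightarrow> 'y" where
  "bar \<Gamma> a n v = restrict (\<lambda>(i, j). a (inv\<^bsub>\<Gamma>\<^esub> v i \<otimes>\<^bsub>\<Gamma>\<^esub> v j)) ({..n} \<times> {..n})"

lemma bar_cong: "(\<And>i. i \<le> n \<Longrightarrow> v i = v' i) \<Longrightarrow> bar \<Gamma> a n v = bar \<Gamma> a n v'"
  by (auto simp: bar_def fun_eq_iff restrict_def)

lemma nerve_op_bar: "k \<le> Suc n \<Longrightarrow> nerve_op n (skip k) (bar \<Gamma> a (Suc n) v) = bar \<Gamma> a n (v \<circ> skip k)"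
  by (auto simp: bar_def nerve_op_def fun_eq_iff skip_def)

lemma (in group) inv_mult_cancel:
  "\<lbrakk>x \<in> carrier G; y \<in> carrier G\<rbrakk> \<Longrightarrow> inv x \<otimes> (x \<otimes> y) = y"
  "\<lbrakk>x \<in> carrier G; y \<in> carrier G\<rbrakk> \<Longrightarrow> x \<otimes> (inv x \<otimes> y) = y"
  by (simp_all flip: m_assoc)

lemma (in group) bar_translate:
  assumes "\<And>i. i \<le> n \<Longrightarrow> v i \<in> carrier G" "g \<in> carrier G"
  shows "bar G a n (\<lambda>i. g \<otimes> v i) = bar G a n v"
  using assms by (auto simp: bar_def fun_eq_iff inv_mult_group m_assoc inv_mult_cancel restrict_def)

definition bar_cell ::
  "('b, 'y) tgroupoid \<Rightarrow> ('g, 'x) monoid_scheme \<Rightarrow> ('g \<Rightarrow> 'y) \<Rightarrow> nat \<Rightarrow> (nat \<Rightarrow> 'g) \<Rightarrow> (nat \<Rightarrow> real) \<Rightarrow> 'y cell set"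
  where "bar_cell Y \<Gamma> a n v = cell_simplex Y n (\<lambda>_. bar \<Gamma> a n v)"

definition bar_coboundary :: "('g, 'x) monoid_scheme \<Rightarrow> ('g \<Rightarrow> int) \<Rightarrow> 'g \<Rightarrow> 'g \<Rightarrow> int" where
  "bar_coboundary \<Gamma> b g h = b h - b (g \<otimes>\<^bsub>\<Gamma>\<^esub> h) + b g"

text \<open>The face opposite to vertex 0 has homogeneous coordinates \<open>g\<close> and
  \<open>g \<otimes> h\<close>, which left translation makes \<open>\<one>\<close> and
  \<open>h\<close>. This turns the alternating sum over faces into the inhomogeneous
  coboundary.\<close>

lemma (in group) coboundary_bar_cell:
  assumes nerve: "\<And>n v. (\<And>i. i \<le> n \<Longrightarrow> v i \<in> carrier G) \<Longrightarrow> bar G a n v \<in> topspace (nerve_space Y n)"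
    and gh: "g \<in> carrier G" "h \<in> carrier G"
  shows "coboundary 1 (realization Y) \<beta> (bar_cell Y G a 2 (tri \<one> g (g \<otimes> h))) =
    bar_coboundary G (\<lambda>g. \<beta> (bar_cell Y G a 1 (pr \<one> g))) g h"
proof -
  let ?v = "tri \<one> g (g \<otimes> h)"
  have v: "?v i \<in> carrier G" for i
    using gh by (simp add: tri_def)
  have in2: "bar_cell Y G a 2 ?v \<in> singular_simplex_set (Suc 1) (realization Y)"
    using cell_simplex_in_const[OF nerve[of 2 ?v, OF v]]
    unfolding bar_cell_def numeral_2_eq_2 by simp
  have face: "singular_face (Suc 1) k (bar_cell Y G a 2 ?v) = bar_cell Y G a 1 (?v \<circ> skip k)"
    if "k \<le> 2" for k
    using singular_face_cell_simplex[of k 1 "\<lambda>_. bar G a 2 ?v" Y] that nerve[of 2 ?v, OF v]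
      nerve_op_bar[of k 1 G a ?v]
    unfolding bar_cell_def by (simp add: numeral_2_eq_2)
  have "bar G a 1 (?v \<circ> skip 0) = bar G a 1 (\<lambda>i. g \<otimes> pr \<one> h i)"
    by (rule bar_cong) (use gh in \<open>auto simp: tri_def pr_def skip_def\<close>)
  also have "\<dots> = bar G a 1 (pr \<one> h)"
    by (rule bar_translate) (use gh in \<open>auto simp: pr_def\<close>)
  finally have 0: "bar_cell Y G a 1 (?v \<circ> skip 0) = bar_cell Y G a 1 (pr \<one> h)"
    by (simp add: bar_cell_def)
  have 1: "bar_cell Y G a 1 (?v \<circ> skip 1) = bar_cell Y G a 1 (pr \<one> (g \<otimes> h))"
    and 2: "bar_cell Y G a 1 (?v \<circ> skip 2) = bar_cell Y G a 1 (pr \<one> g)"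
    unfolding bar_cell_def
    by (intro arg_cong[of _ _ "\<lambda>b. cell_simplex Y 1 (\<lambda>_. b)"] bar_cong;
        auto simp: tri_def pr_def skip_def)+
  have "{..Suc 1} = {0, 1, 2::nat}" by auto
  then show ?thesis
    using in2 face[of 0] face[of 1] face[of 2] 0 1 2
    by (simp add: coboundary_def bar_coboundary_def)
qed

text \<open>The action of \<open>\<Gamma>\<close> on one fibre with a chosen base point.
  \<open>R (A g) z\<close> is to be read as the lift of the arrow \<open>a g\<close> that starts at
  the base point rotated by \<open>z\<close> and ends at the base point rotated by
  \<open>z * \<zeta> g\<close>; hence the shifted argument in \<open>src_lift\<close> and
  \<open>prd_lift\<close>.\<close>

locale circle_lift = group \<Gamma>
  for \<Gamma> :: "('g, 'x) monoid_scheme" (structure) and E :: "('b, 'e) tgroupoid"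
    and Y :: "('c, 'y) tgroupoid" and q :: "'e \<Rightarrow> 'y" and R :: "'e \<Rightarrow> complex \<Rightarrow> 'e"
    and a :: "'g \<Rightarrow> 'y" and A :: "'g \<Rightarrow> 'e" and \<zeta> :: "'g \<Rightarrow> complex" +
  assumes q: "arrow_functor E Y q"
    and R: "\<And>z. norm z = 1 \<Longrightarrow> arrow_functor E E (\<lambda>x. R x z)"
    and q_lift: "\<And>g z. \<lbrakk>g \<in> carrier \<Gamma>; norm z = 1\<rbrakk> \<Longrightarrow> q (R (A g) z) = a g"
    and continuous_lift: "\<And>g. g \<in> carrier \<Gamma> \<Longrightarrow> continuous_map U1_top (arr E) (R (A g))"
    and R_mult: "\<And>g z w. \<lbrakk>g \<in> carrier \<Gamma>; norm z = 1; norm w = 1\<rbrakk> \<Longrightarrow>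
      R (R (A g) z) w = R (A g) (z * w)"
    and \<zeta>: "\<zeta> \<in> hom \<Gamma> U1"
    and src_lift: "\<And>g h z. \<lbrakk>g \<in> carrier \<Gamma>; h \<in> carrier \<Gamma>; norm z = 1\<rbrakk> \<Longrightarrow>
      src E (R (A g) (z * \<zeta> h)) = rng E (R (A h) z)"
    and prd_lift: "\<And>g h z. \<lbrakk>g \<in> carrier \<Gamma>; h \<in> carrier \<Gamma>; norm z = 1\<rbrakk> \<Longrightarrow>
      prd E (R (A g) (z * \<zeta> h)) (R (A h) z) = R (A (g \<otimes> h)) z"
begin

lemma norm_\<zeta> [simp]: "g \<in> carrier \<Gamma> \<Longrightarrow> norm (\<zeta> g) = 1"
  using \<zeta> by (auto simp: hom_def U1_def Pi_iff)

lemma \<zeta>_nonzero [simp]: "g \<in> carrier \<Gamma> \<Longrightarrow> \<zeta> g \<noteq> 0"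
  by (metis norm_\<zeta> norm_zero zero_neq_one)

lemma \<zeta>_mult: "\<lbrakk>g \<in> carrier \<Gamma>; h \<in> carrier \<Gamma>\<rbrakk> \<Longrightarrow> \<zeta> (g \<otimes> h) = \<zeta> g * \<zeta> h"
  using \<zeta> by (auto simp: hom_def U1_def)

lemma \<zeta>_one [simp]: "\<zeta> \<one> = 1"
  using \<zeta>_mult[of \<one> \<one>] by simp

lemma \<zeta>_div: "\<lbrakk>g \<in> carrier \<Gamma>; h \<in> carrier \<Gamma>\<rbrakk> \<Longrightarrow> \<zeta> (inv g \<otimes> h) = \<zeta> h / \<zeta> g"
  using \<zeta>_mult[of "inv g" g] by (simp add: \<zeta>_mult field_simps)

lemma lift_in_arr: "\<lbrakk>g \<in> carrier \<Gamma>; norm z = 1\<rbrakk> \<Longrightarrow> R (A g) z \<in> topspace (arr E)"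
  using continuous_lift[of g] by (auto simp: continuous_map_def U1_top_def Pi_iff)

text \<open>
  The edges from vertex \<open>i\<close> to vertex \<open>j\<close> act on the fibre by \<open>\<zeta> (v\<^sub>i\<^sup>-\<^sup>1 v\<^sub>j)\<close>, so that the \<open>j\<close>-th vertex of a lift
  is obtained from its base point by \<open>\<zeta> (v\<^sub>j)\<^sup>-\<^sup>1\<close>.  The argument \<open>x\<close> gives the vertex values, in turns, of
  the additional rotation.
\<close>

definition lift :: "nat \<Rightarrow> (nat \<Rightarrow> 'g) \<Rightarrow> (nat \<Rightarrow> real) \<Rightarrow> (nat \<Rightarrow> real) \<Rightarrow> nat \<times> nat \<Rightarrow> 'e" where
  "lift n v x u = restrict (\<lambda>(i, j). R (A (inv v i \<otimes> v j))
     (circle (\<Sum>k\<le>n. u k * x k) * inverse (\<zeta> (v j)))) ({..n} \<times> {..n})"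

lemma lift_cong:
  "(\<And>i. i \<le> n \<Longrightarrow> v i = v' i) \<Longrightarrow> (\<And>i. i \<le> n \<Longrightarrow> x i = x' i) \<Longrightarrow> lift n v x = lift n v' x'"
  by (auto simp: lift_def fun_eq_iff restrict_def)

text \<open>The rotation is common to all vertices, so the starting points of the edges leaving
  vertices \<open>j\<close> and \<open>k\<close> differ by exactly
  \<open>\<zeta> (inv v j \<otimes> v k)\<close>, as \<open>src_lift\<close> and
  \<open>prd_lift\<close> require.\<close>

lemma lift_in_nerve:
  assumes v: "\<And>i. i \<le> n \<Longrightarrow> v i \<in> carrier \<Gamma>"
  shows "lift n v x u \<in> topspace (nerve_space E n)"
proof -
  define z where "z j = circle (\<Sum>k\<le>n. u k * x k) * inverse (\<zeta> (v j))" for j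
  have z: "norm (z j) = 1" if "j \<le> n" for j
    using v[OF that] by (simp add: z_def norm_mult norm_inverse)
  have zz: "z j = z k * \<zeta> (inv v j \<otimes> v k)" if "j \<le> n" "k \<le> n" for j k
    using v[OF that(1)] v[OF that(2)] by (simp add: z_def \<zeta>_div field_simps)
  have m: "inv v i \<otimes> v j \<otimes> (inv v j \<otimes> v k) = inv v i \<otimes> v k" if "i \<le> n" "j \<le> n" "k \<le> n" for i j k
    using v that by (simp add: m_assoc inv_mult_cancel)
  have "src E (R (A (inv v i \<otimes> v j)) (z j)) = rng E (R (A (inv v j \<otimes> v k)) (z k)) \<and>
    prd E (R (A (inv v i \<otimes> v j)) (z j)) (R (A (inv v j \<otimes> v k)) (z k)) = R (A (inv v i \<otimes> v k)) (z k)"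
    if "i \<le> n" "j \<le> n" "k \<le> n" for i j k
    unfolding zz[OF that(2,3)]
    using src_lift[of "inv v i \<otimes> v j" "inv v j \<otimes> v k" "z k"]
      prd_lift[of "inv v i \<otimes> v j" "inv v j \<otimes> v k" "z k"] that v z m by simp
  then show ?thesis
    unfolding topspace_nerve_space lift_def z_def[symmetric]
    using v z by (auto intro: lift_in_arr)
qed

lemma continuous_lift_nerve:
  assumes v: "\<And>i. i \<le> n \<Longrightarrow> v i \<in> carrier \<Gamma>"
  shows "continuous_map (subtopology (powertop_real UNIV) (standard_simplex n)) (nerve_space E n)
    (lift n v x)"
proof -
  let ?S = "subtopology (powertop_real UNIV) (standard_simplex n)"
  have comp: "continuous_map ?S (arr E) (\<lambda>u. lift n v x u p)" if "p \<in> {..n} \<times> {..n}" for p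
  proof -
    obtain i j where p: "p = (i, j)" "i \<le> n" "j \<le> n" using \<open>p \<in> _\<close> by auto
    \<comment> \<open>Written as an angle, the constant factor is absorbed into the affine function,
      and continuity of \<open>circle\<close> suffices.\<close>
    obtain y where y: "inverse (\<zeta> (v j)) = circle y"
      using circle_surj[of "inverse (\<zeta> (v j))"] v[OF p(3)] by (auto simp: norm_inverse)
    have "continuous_map ?S euclideanreal (\<lambda>u. (\<Sum>k\<le>n. u k * x k) + y)"
      by (intro continuous_intros continuous_map_from_subtopology continuous_map_product_projection) auto
    then have "continuous_map ?S U1_top (circle \<circ> (\<lambda>u. (\<Sum>k\<le>n. u k * x k) + y))"
      using continuous_map_circle by (rule continuous_map_compose)
    from continuous_map_compose[OF this continuous_lift[of "inv v i \<otimes> v j"]]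
    have "continuous_map ?S (arr E)
        (\<lambda>u. R (A (inv v i \<otimes> v j)) (circle (\<Sum>k\<le>n. u k * x k) * circle y))"
      using v p by (simp add: o_def circle_add)
    then show ?thesis
      using p y by (simp add: lift_def)
  qed
  have "continuous_map ?S (product_topology (\<lambda>_. arr E) ({..n} \<times> {..n})) (lift n v x)"
    using comp by (auto simp: continuous_map_componentwise lift_def)
  moreover have "lift n v x \<in> topspace ?S \<rightarrow>
      {g. \<forall>i\<le>n. \<forall>j\<le>n. \<forall>k\<le>n. src E (g (i, j)) = rng E (g (j, k)) \<and> prd E (g (i, j)) (g (j, k)) = g (i, k)}"
    using lift_in_nerve[OF v] by (simp add: nerve_space_def)
  ultimately show ?thesis
    unfolding nerve_space_def continuous_map_in_subtopology by blast
qed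

lemma nerve_map_lift:
  assumes v: "\<And>i. i \<le> n \<Longrightarrow> v i \<in> carrier \<Gamma>"
  shows "nerve_map n q (lift n v x u) = bar \<Gamma> a n v"
  using v by (auto simp: nerve_map_def lift_def bar_def fun_eq_iff q_lift norm_mult norm_inverse)

lemma bar_in_nerve:
  assumes "\<And>i. i \<le> n \<Longrightarrow> v i \<in> carrier \<Gamma>"
  shows "bar \<Gamma> a n v \<in> topspace (nerve_space Y n)"
  using nerve_map_in[OF q lift_in_nerve] nerve_map_lift assms by metis

lemma nerve_op_lift:
  assumes "k \<le> Suc n"
  shows "nerve_op n (skip k) (lift (Suc n) v x (simplical_face k u)) = lift n (v \<circ> skip k) (x \<circ> skip k) u"
  using assms simplical_face_sum[OF assms, of u x]
  by (auto simp: nerve_op_def lift_def fun_eq_iff skip_def simp del: sum.atMost_Suc)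

section \<open>Faces, translates and fibre loops of the lifted simplices\<close>

definition lift_cell :: "nat \<Rightarrow> (nat \<Rightarrow> 'g) \<Rightarrow> (nat \<Rightarrow> real) \<Rightarrow> (nat \<Rightarrow> real) \<Rightarrow> 'e cell set" where
  "lift_cell n v x = cell_simplex E n (lift n v x)"

lemma lift_cell_in:
  assumes "\<And>i. i \<le> n \<Longrightarrow> v i \<in> carrier \<Gamma>"
  shows "lift_cell n v x \<in> singular_simplex_set n (realization E)"
  unfolding lift_cell_def by (rule cell_simplex_in[OF continuous_lift_nerve]) (rule assms)

lemma simplex_map_lift_cell:
  assumes "\<And>i. i \<le> n \<Longrightarrow> v i \<in> carrier \<Gamma>"
  shows "simplex_map n (realization_map Y q) (lift_cell n v x) = bar_cell Y \<Gamma> a n v"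
  using simplex_map_cell_simplex[OF q, of n "lift n v x"] nerve_map_lift[OF assms]
  by (simp add: lift_cell_def bar_cell_def)

lemma coboundary_lift_cell:
  assumes "g \<in> carrier \<Gamma>" "h \<in> carrier \<Gamma>" "k \<in> carrier \<Gamma>"
  shows "coboundary 1 (realization E) \<omega> (lift_cell 2 (tri g h k) (tri x y z)) =
    \<omega> (lift_cell 1 (pr h k) (pr y z)) - \<omega> (lift_cell 1 (pr g k) (pr x z)) + \<omega> (lift_cell 1 (pr g h) (pr x y))"
proof -
  let ?\<tau> = "lift_cell 2 (tri g h k) (tri x y z)"
  have v: "tri g h k i \<in> carrier \<Gamma>" for i
    using assms by (simp add: tri_def)
  have in2: "?\<tau> \<in> singular_simplex_set (Suc 1) (realization E)"
    using lift_cell_in[of 2 "tri g h k" "tri x y z"] v by (simp add: numeral_2_eq_2)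
  have face: "singular_face (Suc 1) i ?\<tau> = lift_cell 1 (tri g h k \<circ> skip i) (tri x y z \<circ> skip i)"
    if "i \<le> 2" for i
    using singular_face_cell_simplex[of i 1 "lift 2 (tri g h k) (tri x y z)" E]
      lift_in_nerve[of 2 "tri g h k" "tri x y z", OF v] that nerve_op_lift[of i 1]
    unfolding lift_cell_def by (simp add: numeral_2_eq_2)
  have "lift_cell 1 (tri g h k \<circ> skip 0) (tri x y z \<circ> skip 0) = lift_cell 1 (pr h k) (pr y z)"
    "lift_cell 1 (tri g h k \<circ> skip 1) (tri x y z \<circ> skip 1) = lift_cell 1 (pr g k) (pr x z)"
    "lift_cell 1 (tri g h k \<circ> skip 2) (tri x y z \<circ> skip 2) = lift_cell 1 (pr g h) (pr x y)"
    unfolding lift_cell_def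
    by (intro arg_cong[of _ _ "cell_simplex E 1"] lift_cong; auto simp: tri_def pr_def skip_def)+
  moreover have "{..Suc 1} = {0, 1, 2::nat}" by auto
  ultimately show ?thesis
    using in2 face[of 0] face[of 1] face[of 2] by (simp add: coboundary_def)
qed

text \<open>Translation by \<open>k\<close> multiplies every starting point by
  \<open>inverse (\<zeta> k)\<close>, a rotation by \<open>- t\<close>. The barycentric coordinates
  sum to 1, so this amounts to subtracting \<open>t\<close> from both vertex values.\<close>

lemma lift_cell_translate:
  assumes "g \<in> carrier \<Gamma>" "h \<in> carrier \<Gamma>" "k \<in> carrier \<Gamma>" "\<zeta> k = circle t"
  shows "lift_cell 1 (pr (k \<otimes> g) (k \<otimes> h)) (pr x y) = lift_cell 1 (pr g h) (pr (x - t) (y - t))"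
  unfolding lift_cell_def
proof (rule cell_simplex_cong)
  fix u assume "u \<in> standard_simplex 1"
  then have u: "u 0 + u 1 = 1" by (simp add: standard_simplex_def)
  let ?s = "u 0 * x + u 1 * y"
  have "u 0 * (x - t) + u 1 * (y - t) = ?s - (u 0 + u 1) * t" by (simp add: algebra_simps)
  then have s: "circle (u 0 * (x - t) + u 1 * (y - t)) = circle ?s * inverse (\<zeta> k)"
    using u by (simp add: circle_diff assms(4))
  have sum: "(\<Sum>i\<le>1. u i * pr x y i) = u 0 * x + u 1 * y" for x y
    by (simp add: pr_def)
  have "pr (k \<otimes> g) (k \<otimes> h) i = k \<otimes> pr g h i" "pr g h i \<in> carrier \<Gamma>" for i
    using assms by (auto simp: pr_def)
  moreover have "inv (k \<otimes> b) \<otimes> (k \<otimes> c) = inv b \<otimes> c" if "b \<in> carrier \<Gamma>" "c \<in> carrier \<Gamma>" for b c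
    using that assms(3) by (simp add: inv_mult_group m_assoc inv_mult_cancel)
  ultimately show "lift 1 (pr (k \<otimes> g) (k \<otimes> h)) (pr x y) u = lift 1 (pr g h) (pr (x - t) (y - t)) u"
    using assms(3) unfolding lift_def sum s by (auto simp: fun_eq_iff \<zeta>_mult restrict_def mult.assoc)
qed

text \<open>The operator with constant value 0 collapses a totally degenerate cell to a 0-cell,
  where the only simplex coordinate is 1.\<close>

lemma rcls_const:
  assumes "e \<in> topspace (nerve_space G 0)" "u \<in> standard_simplex n"
  shows "rcls G (n, restrict (\<lambda>_. e (0, 0)) ({..n} \<times> {..n}), u) = rcls G (0, e, \<lambda>j. if j = 0 then 1 else 0)"
proof -
  have "simplex_op n (\<lambda>_. 0) u = (\<lambda>j. if j = 0 then 1 else 0)"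
    using assms(2) by (auto simp: simplex_op_def standard_simplex_def atMost_def)
  moreover have "nerve_op n (\<lambda>_. 0) e = restrict (\<lambda>_. e (0, 0)) ({..n} \<times> {..n})"
    by (auto simp: nerve_op_def fun_eq_iff)
  ultimately show ?thesis
    using rcls_glue[OF assms, of "\<lambda>_. 0"] by (simp add: mono_on_def image_subset_iff)
qed

text \<open>Over identity vertices the lift is totally degenerate for each fixed \<open>u\<close>;
  as \<open>u\<close> varies it moves through 0-cells, along the circle of rotations of one
  point.\<close>

lemma lift_vertex:
  assumes "u \<in> standard_simplex n"
  shows "rcls E (n, lift n (\<lambda>_. \<one>) x u, u) =
    rcls E (0, lift 0 (\<lambda>_. \<one>) (\<lambda>_. \<Sum>k\<le>n. u k * x k) (\<lambda>j. if j = 0 then 1 else 0), \<lambda>j. if j = 0 then 1 else 0)"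
  using rcls_const[OF lift_in_nerve assms, of "\<lambda>_. \<one>" "\<lambda>_. \<Sum>k\<le>n. u k * x k" "\<lambda>j. if j = 0 then 1 else 0"]
  by (simp add: lift_def case_prod_beta')

text \<open>With vertex values \<open>x\<close> and \<open>x + 1\<close> the affine function is
  \<open>x + u 1\<close>, so the lifted edge runs once around the fibre through \<open>p x\<close>.
  This brings in the normalisation of \<open>\<omega>\<close>.\<close>

lemma fibre_loop_lift:
  defines "p \<equiv> \<lambda>x. rcls E (0, lift 0 (\<lambda>_. \<one>) (\<lambda>_. x) (\<lambda>j. if j = 0 then 1 else 0), \<lambda>j. if j = 0 then 1 else 0)"
  shows "fibre_loop (\<lambda>x z. realization_map E (\<lambda>g. R g z) x) (p x) = lift_cell 1 (pr \<one> \<one>) (pr x (x + 1))"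
proof -
  have R1: "realization_map E (\<lambda>g. R g (circle t)) (p x) = p (x + t)" for t
    unfolding p_def realization_map_rcls[OF R[OF norm_circle]]
    by (simp add: nerve_map_def lift_def o_def case_prod_beta' R_mult circle_add cong: restrict_cong)
  have "rcls E (1, lift 1 (pr \<one> \<one>) (pr x (x + 1)) u, u) = p (x + u 1)" if "u \<in> standard_simplex 1" for u
  proof -
    have "u 0 + u 1 = 1" using that by (simp add: standard_simplex_def)
    then have s: "(\<Sum>k\<le>1. u k * pr x (x + 1) k) = x + u 1"
      by (simp add: pr_def algebra_simps flip: distrib_left)
    have one: "pr \<one> \<one> = (\<lambda>_. \<one>)" by (simp add: pr_def fun_eq_iff)
    show ?thesis
      using lift_vertex[OF that, of "pr x (x + 1)"]
      unfolding p_def s one by simp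
  qed
  then show ?thesis
    by (simp add: fibre_loop_def lift_cell_def cell_simplex_def R1 flip: circle_def cong: restrict_cong)
qed

text \<open>Applies \<open>angular_cochain_Bockstein\<close> to the values of
  \<open>\<omega>\<close> on lifted edges. The facts numbered 1 to 5 below are its
  hypotheses.\<close>

theorem circle_lift_Bockstein:
  assumes \<omega>: "coboundary 1 (realization E) \<omega> = (\<lambda>\<tau>. - cochain_pullback 2 (realization E) (realization_map Y q) c \<tau>)"
    and fib: "\<And>y \<tau>. \<lbrakk>y \<in> topspace (realization Y); \<tau> \<in> singular_simplex_set 2
        (subtopology (realization E) {x \<in> topspace (realization E). realization_map Y q x = y})\<rbrakk> \<Longrightarrow>
        coboundary 1 (realization E) \<omega> \<tau> = 0"
    and loop: "\<And>x. x \<in> topspace (realization E) \<Longrightarrow>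
        \<omega> (fibre_loop (\<lambda>x z. realization_map E (\<lambda>g. R g z) x) x) = 1"
    and \<theta>: "\<And>g. g \<in> carrier \<Gamma> \<Longrightarrow> \<zeta> g = circle (\<theta> g)"
  obtains C :: "'g \<Rightarrow> int" where "\<And>g h. \<lbrakk>g \<in> carrier \<Gamma>; h \<in> carrier \<Gamma>\<rbrakk> \<Longrightarrow>
      of_int (c (bar_cell Y \<Gamma> a 2 (tri \<one> g (g \<otimes> h)))) =
        \<theta> h - \<theta> (g \<otimes> h) + \<theta> g - of_int (bar_coboundary \<Gamma> C g h)"
proof -
  define w where "w g h x y = \<omega> (lift_cell 1 (pr g h) (pr x y))" for g h x y
  define c' where "c' g h k = c (bar_cell Y \<Gamma> a 2 (tri g h k))" for g h k
  have c': "coboundary 1 (realization E) \<omega> (lift_cell 2 (tri g h k) (tri x y z)) = - c' g h k"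
    if "g \<in> carrier \<Gamma>" "h \<in> carrier \<Gamma>" "k \<in> carrier \<Gamma>" for g h k x y z
  proof -
    have v: "tri g h k i \<in> carrier \<Gamma>" for i using that by (simp add: tri_def)
    show ?thesis
      using lift_cell_in[of 2 "tri g h k" "tri x y z"] v
        simplex_map_lift_cell[of 2 "tri g h k" "tri x y z"]
      by (simp add: \<omega> cochain_pullback_def c'_def del: One_nat_def)
  qed
  have 1: "- c' g h k = w h k y z - w g k x z + w g h x y"
    if "g \<in> carrier \<Gamma>" "h \<in> carrier \<Gamma>" "k \<in> carrier \<Gamma>" for g h k x y z
    using c'[OF that] coboundary_lift_cell[OF that] unfolding w_def by metis
  have 2: "w (k \<otimes> g) (k \<otimes> h) x y = w g h (x - \<theta> k) (y - \<theta> k)"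
    if "g \<in> carrier \<Gamma>" "h \<in> carrier \<Gamma>" "k \<in> carrier \<Gamma>" for g h k x y
    unfolding w_def lift_cell_translate[OF that \<theta>[OF that(3)]] ..
  have 3: "c' \<one> \<one> \<one> = 0"
  proof -
    let ?v = "tri \<one> \<one> \<one>" and ?x = "tri 0 0 0 :: nat \<Rightarrow> real"
    let ?\<tau> = "lift_cell 2 ?v ?x"
    \<comment> \<open>Without rotation over the identity the lifted triangle lies in the fibre over
      this vertex, so \<open>fib\<close> applies to it.\<close>
    define y where "y = rcls Y (0, bar \<Gamma> a 0 (\<lambda>_. \<one>), \<lambda>j. if j = 0 then 1 else (0::real))"
    have v: "?v = (\<lambda>_. \<one>)" by (simp add: tri_def fun_eq_iff)
    have \<tau>: "?\<tau> \<in> singular_simplex_set 2 (realization E)"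
      by (rule lift_cell_in) (simp add: v)
    have y: "y \<in> topspace (realization Y)"
      unfolding topspace_realization y_def
      by (intro imageI) (simp add: cells_def bar_in_nerve)
    have "realization_map Y q (?\<tau> u) = y" if u: "u \<in> standard_simplex 2" for u
    proof -
      have "realization_map Y q (?\<tau> u) = bar_cell Y \<Gamma> a 2 ?v u"
        using simplex_map_lift_cell[of 2 ?v ?x] u
        by (simp add: simplex_map_def v fun_eq_iff) (metis restrict_apply' comp_apply)
      also have "\<dots> = y"
        using rcls_const[OF bar_in_nerve u, of "\<lambda>_. \<one>"] u
        by (simp add: bar_cell_def cell_simplex_def v y_def bar_def case_prod_beta')
      finally show ?thesis .
    qed
    moreover have "?\<tau> u \<in> topspace (realization E)" if u: "u \<in> standard_simplex 2" for u
      using \<tau> u by (auto simp: singular_simplex_def continuous_map_def Pi_iff)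
    ultimately have "?\<tau> \<in> singular_simplex_set 2
        (subtopology (realization E) {x \<in> topspace (realization E). realization_map Y q x = y})"
      using \<tau> by (auto simp: singular_simplex_subtopology)
    from fib[OF y this] c'[of \<one> \<one> \<one>] show ?thesis by simp
  qed
  have 4: "w \<one> \<one> x (x + 1) = 1" for x
    unfolding w_def fibre_loop_lift[symmetric]
    by (rule loop, unfold topspace_realization, rule imageI) (simp add: cells_def lift_in_nerve)
  have 5: "\<theta> g + \<theta> h - \<theta> (g \<otimes> h) \<in> \<int>" if "g \<in> carrier \<Gamma>" "h \<in> carrier \<Gamma>" for g h
  proof -
    have "circle (\<theta> g + \<theta> h - \<theta> (g \<otimes> h)) = \<zeta> g * \<zeta> h * inverse (\<zeta> (g \<otimes> h))"
      using that by (simp add: circle_diff circle_add \<theta>)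
    then show ?thesis
      using that by (simp add: \<zeta>_mult field_simps flip: circle_eq_1)
  qed
  obtain C where C: "\<And>g h. \<lbrakk>g \<in> carrier \<Gamma>; h \<in> carrier \<Gamma>\<rbrakk> \<Longrightarrow>
      of_int (c' \<one> g (g \<otimes> h)) = \<theta> h - \<theta> (g \<otimes> h) + \<theta> g - of_int (C h - C (g \<otimes> h) + C g)"
  proof (rule angular_cochain_Bockstein[of c' w \<theta>])
    show "- c' g h k = w h k y z - w g k x z + w g h x y"
      if "g \<in> carrier \<Gamma>" "h \<in> carrier \<Gamma>" "k \<in> carrier \<Gamma>" for g h k x y z
      using that by (rule 1)
    show "w (k \<otimes> g) (k \<otimes> h) x y = w g h (x - \<theta> k) (y - \<theta> k)"
      if "g \<in> carrier \<Gamma>" "h \<in> carrier \<Gamma>" "k \<in> carrier \<Gamma>" for g h k x y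
      using that by (rule 2)
    show "\<theta> g + \<theta> h - \<theta> (g \<otimes> h) \<in> \<int>" if "g \<in> carrier \<Gamma>" "h \<in> carrier \<Gamma>" for g h
      using that by (rule 5)
  qed (use 3 4 in simp_all)
  show thesis
    by (rule that[of C]) (use C in \<open>simp add: c'_def bar_coboundary_def\<close>)
qed

end

section \<open>Categories fibred in groupoids\<close>

locale fibred_groupoids =
  fixes X :: "('u, 'o, 'm) fibred"
  assumes fibred: "fibred_in_groupoids X"
begin

lemma category: "category_over_spaces X"
  using fibred by (simp add: fibred_in_groupoids_def)

lemma Homs_Ob: "m \<in> Homs X x y \<Longrightarrow> x \<in> Ob X" "m \<in> Homs X x y \<Longrightarrow> y \<in> Ob X"
  using category by (auto simp: category_over_spaces_def Homs_def)

lemma Idm_Homs: "x \<in> Ob X \<Longrightarrow> Idm X x \<in> Homs X x x"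
  using category by (auto simp: category_over_spaces_def)

lemma Cmp_Homs: "\<lbrakk>g \<in> Homs X y z; f \<in> Homs X x y\<rbrakk> \<Longrightarrow> Cmp X g f \<in> Homs X x z"
  using category unfolding category_over_spaces_def by (auto simp: Homs_def)

lemma Cmp_assoc:
  "\<lbrakk>h \<in> Homs X y z; g \<in> Homs X x y; f \<in> Homs X w x\<rbrakk> \<Longrightarrow> Cmp X h (Cmp X g f) = Cmp X (Cmp X h g) f"
  using category unfolding category_over_spaces_def by (auto simp: Homs_def)

lemma Cmp_Idm: "f \<in> Homs X x y \<Longrightarrow> Cmp X f (Idm X x) = f" "f \<in> Homs X x y \<Longrightarrow> Cmp X (Idm X y) f = f"
  using category unfolding category_over_spaces_def by (auto simp: Homs_def)

lemma space_map_mp: "m \<in> Homs X x y \<Longrightarrow> space_map (sp X x) (sp X y) (mp X m)"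
  using category unfolding category_over_spaces_def by (auto simp: Homs_def)

lemma mp_in: "m \<in> Homs X x y \<Longrightarrow> t \<in> topspace (sp X x) \<Longrightarrow> mp X m t \<in> topspace (sp X y)"
  using space_map_mp[of m x y] by (auto simp: space_map_def continuous_map_def Pi_iff)

lemma mp_Idm: "x \<in> Ob X \<Longrightarrow> mp X (Idm X x) = restrict id (topspace (sp X x))"
  using category by (auto simp: category_over_spaces_def)

lemma mp_Cmp:
  "\<lbrakk>g \<in> Homs X y z; f \<in> Homs X x y\<rbrakk> \<Longrightarrow>
     mp X (Cmp X g f) = compose (topspace (sp X x)) (mp X g) (mp X f)"
  using category unfolding category_over_spaces_def by (auto simp: Homs_def)

lemma mp_Cmp_apply:
  "\<lbrakk>g \<in> Homs X y z; f \<in> Homs X x y; t \<in> topspace (sp X x)\<rbrakk> \<Longrightarrow>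
     mp X (Cmp X g f) t = mp X g (mp X f t)"
  by (simp add: mp_Cmp compose_def)

lemma pullback:
  assumes "y \<in> Ob X" "space_map T (sp X y) f"
  obtains x m where "x \<in> Ob X" "sp X x = T" "m \<in> Homs X x y" "mp X m = f"
  using assms fibred unfolding fibred_in_groupoids_def by blast

lemma cartesian:
  assumes "m \<in> Homs X x y" "n \<in> Homs X w y" "space_map (sp X w) (sp X x) f"
    and "\<And>t. t \<in> topspace (sp X w) \<Longrightarrow> mp X n t = mp X m (f t)"
  shows "\<exists>!k. k \<in> Homs X w x \<and> mp X k = f \<and> Cmp X m k = n"
proof -
  have "mp X n \<in> extensional (topspace (sp X w))"
    using space_map_mp[OF assms(2)] by (simp add: space_map_def)
  then have "mp X n = compose (topspace (sp X w)) (mp X m) f"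
    using assms(4) by (auto simp: compose_def fun_eq_iff extensional_def)
  then show ?thesis
    using assms fibred Homs_Ob[OF assms(1)] Homs_Ob[OF assms(2)]
    unfolding fibred_in_groupoids_def by blast
qed

lemma cartesian_ex:
  assumes "m \<in> Homs X x y" "n \<in> Homs X w y" "space_map (sp X w) (sp X x) f"
    and "\<And>t. t \<in> topspace (sp X w) \<Longrightarrow> mp X n t = mp X m (f t)"
  obtains k where "k \<in> Homs X w x" "mp X k = f" "Cmp X m k = n"
  using cartesian[OF assms] by blast

text \<open>Every morphism is cancellable among morphisms over the same map of spaces, by the
  uniqueness in the cartesian property.\<close>

lemma Cmp_cancel_left:
  assumes "m \<in> Homs X x y" "k \<in> Homs X w x" "k' \<in> Homs X w x"
    and "mp X k = mp X k'" "Cmp X m k = Cmp X m k'"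
  shows "k = k'"
proof -
  have "\<exists>!l. l \<in> Homs X w x \<and> mp X l = mp X k \<and> Cmp X m l = Cmp X m k"
    using assms(1,2) by (intro cartesian Cmp_Homs space_map_mp) (auto simp: mp_Cmp_apply)
  then show ?thesis using assms by metis
qed

lemma space_map_id: "space_map T T (restrict id (topspace T))"
  by (auto simp: space_map_def intro: continuous_map_eq[OF continuous_map_id])

text \<open>Compares two pullbacks of \<open>y\<close> along the same map.\<close>

lemma vertical_iso:
  assumes "m \<in> Homs X x y" "n \<in> Homs X w y" "sp X w = sp X x" "mp X m = mp X n"
  obtains k where "k \<in> Homs X w x" "mp X k = restrict id (topspace (sp X x))" "Cmp X m k = n"
proof (rule cartesian_ex[OF assms(1,2), of "restrict id (topspace (sp X x))"])
  show "space_map (sp X w) (sp X x) (restrict id (topspace (sp X x)))"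
    using space_map_id assms(3) by metis
qed (use assms that in auto)

lemma space_map_const:
  "\<lbrakk>topspace T = {p}; t \<in> topspace S\<rbrakk> \<Longrightarrow> space_map T S (\<lambda>s\<in>{p}. t)"
  by (auto simp: space_map_def intro: continuous_map_eq[of T S "\<lambda>_. t"])

section \<open>Objects over a one-point space\<close>

lemma pullback_point:
  assumes "y \<in> Ob X" "t \<in> topspace (sp X y)" "topspace T = {p}"
  obtains x m where "x \<in> Ob X" "sp X x = T" "m \<in> Homs X x y" "mp X m p = t"
  using pullback[OF assms(1) space_map_const[OF assms(3,2)]] by (metis restrict_apply' singletonI)

lemma mp_eq_point:
  assumes "m \<in> Homs X x y" "n \<in> Homs X x z" "topspace (sp X x) = {p}" "mp X m p = mp X n p"
  shows "mp X m = mp X n"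
proof -
  have "mp X m \<in> extensional {p}" "mp X n \<in> extensional {p}"
    using space_map_mp[OF assms(1)] space_map_mp[OF assms(2)] assms(3) by (auto simp: space_map_def)
  then show ?thesis
    using assms(4) by (auto intro: extensionalityI[of _ "{p}"])
qed

section \<open>Automorphism groups\<close>

lemma carrier_Auts:
  "\<phi> \<in> carrier (Auts X u) \<longleftrightarrow> \<phi> \<in> Homs X u u \<and> mp X \<phi> = restrict id (topspace (sp X u))"
  by (simp add: Auts_def)

lemma mult_Auts [simp]: "\<phi> \<otimes>\<^bsub>Auts X u\<^esub> \<psi> = Cmp X \<phi> \<psi>" and one_Auts [simp]: "\<one>\<^bsub>Auts X u\<^esub> = Idm X u"
  by (simp_all add: Auts_def)

lemma group_Auts:
  assumes u: "u \<in> Ob X"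
  shows "group (Auts X u)"
proof (rule groupI)
  fix \<phi> assume \<phi>: "\<phi> \<in> carrier (Auts X u)"
  then have "\<phi> \<in> Homs X u u" "mp X \<phi> = mp X (Idm X u)"
    using u by (auto simp: carrier_Auts mp_Idm)
  then obtain k where k: "k \<in> Homs X u u" "mp X k = restrict id (topspace (sp X u))"
    "Cmp X \<phi> k = Idm X u"
    using vertical_iso[of \<phi> u u "Idm X u" u] Idm_Homs[OF u] by auto
  \<comment> \<open>\<open>groupI\<close> asks for a left inverse; the right inverse
    \<open>k\<close> becomes one after cancelling \<open>\<phi>\<close>.\<close>
  have "Cmp X k \<phi> = Idm X u"
  proof (rule Cmp_cancel_left[OF \<open>\<phi> \<in> Homs X u u\<close>])
    show "mp X (Cmp X k \<phi>) = mp X (Idm X u)"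
      using k \<phi> by (auto simp: mp_Cmp carrier_Auts mp_Idm[OF u] compose_def fun_eq_iff)
    show "Cmp X \<phi> (Cmp X k \<phi>) = Cmp X \<phi> (Idm X u)"
      using k \<phi> Cmp_assoc[of \<phi> u u k u \<phi> u] Cmp_Idm[of \<phi> u u]
      by (simp add: carrier_Auts)
  qed (use k \<phi> u in \<open>auto simp: carrier_Auts intro: Cmp_Homs Idm_Homs\<close>)
  then show "\<exists>k\<in>carrier (Auts X u). k \<otimes>\<^bsub>Auts X u\<^esub> \<phi> = \<one>\<^bsub>Auts X u\<^esub>"
    using k by (auto simp: carrier_Auts)
qed (use u in \<open>auto simp: carrier_Auts mp_Cmp compose_def fun_eq_iff Cmp_Idm Cmp_assoc[symmetric] mp_Idm
      intro: Cmp_Homs Idm_Homs\<close>)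

end

section \<open>The groupoid of an atlas\<close>

text \<open>
  The two functors of interest send an object to its underlying space and to the total space of a
  bundle over it.  As \<open>F x\<close> is pulled back from \<open>F y\<close> along \<open>m\<close>, the fibres of \<open>q x\<close> and \<open>q y\<close> correspond.
\<close>

locale fibred_space_functor = fibred_groupoids X
  for X :: "('u, 'o, 'm) fibred" +
  fixes D :: "('o, 'm) atlas_data"
    and F :: "'o \<Rightarrow> 'v topology" and f :: "'m \<Rightarrow> 'v \<Rightarrow> 'v" and q :: "'o \<Rightarrow> 'v \<Rightarrow> 'u"
  assumes double: "fibre_product X (atl D) (atl D) (dbl D) (p_src D) (p_rng D)"
    and map_in: "\<And>m x y e. \<lbrakk>m \<in> Homs X x y; e \<in> topspace (F x)\<rbrakk> \<Longrightarrow> f m e \<in> topspace (F y)"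
    and map_Cmp: "\<And>m n x y z e. \<lbrakk>n \<in> Homs X y z; m \<in> Homs X x y; e \<in> topspace (F x)\<rbrakk> \<Longrightarrow>
      f (Cmp X n m) e = f n (f m e)"
    and proj_in: "\<And>x e. \<lbrakk>x \<in> Ob X; e \<in> topspace (F x)\<rbrakk> \<Longrightarrow> q x e \<in> topspace (sp X x)"
    and proj_map: "\<And>m x y e. \<lbrakk>m \<in> Homs X x y; e \<in> topspace (F x)\<rbrakk> \<Longrightarrow> q y (f m e) = mp X m (q x e)"
    and map_inj: "\<And>m x y e e'. \<lbrakk>m \<in> Homs X x y; e \<in> topspace (F x); e' \<in> topspace (F x);
      q x e = q x e'; f m e = f m e'\<rbrakk> \<Longrightarrow> e = e'"
    and map_surj: "\<And>m x y s d. \<lbrakk>m \<in> Homs X x y; s \<in> topspace (sp X x); d \<in> topspace (F y); q y d = mp X m s\<rbrakk> \<Longrightarrow>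
      \<exists>e\<in>topspace (F x). q x e = s \<and> f m e = d"
begin

abbreviation "G \<equiv> span_groupoid X D F f"

text \<open>The witnesses in the definition of \<open>prd\<close> in \<open>span_groupoid\<close>,
  without the point: over \<open>w\<close>, the arrow of \<open>m\<close> is that of
  \<open>m\<^sub>1\<close> after that of \<open>m\<^sub>2\<close>.\<close>

definition arrow_product :: "'o \<Rightarrow> 'm \<Rightarrow> 'm \<Rightarrow> 'm \<Rightarrow> bool" where
  "arrow_product w m\<^sub>1 m\<^sub>2 m \<longleftrightarrow> w \<in> Ob X \<and>
     m\<^sub>1 \<in> Homs X w (dbl D) \<and> m\<^sub>2 \<in> Homs X w (dbl D) \<and> m \<in> Homs X w (dbl D) \<and>
     Cmp X (p_src D) m\<^sub>1 = Cmp X (p_rng D) m\<^sub>2 \<and> Cmp X (p_src D) m = Cmp X (p_src D) m\<^sub>2 \<and>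
     Cmp X (p_rng D) m = Cmp X (p_rng D) m\<^sub>1"

lemma dbl_Homs: "p_src D \<in> Homs X (dbl D) (atl D)" "p_rng D \<in> Homs X (dbl D) (atl D)"
  using double by (auto simp: fibre_product_def)

lemma dbl_universal:
  assumes "k \<in> Homs X w (atl D)" "l \<in> Homs X w (atl D)"
  shows "\<exists>!m. m \<in> Homs X w (dbl D) \<and> Cmp X (p_src D) m = k \<and> Cmp X (p_rng D) m = l"
  using double assms Homs_Ob[OF assms(1)] unfolding fibre_product_def by blast

text \<open>Restriction to one point makes witnesses over different objects comparable.\<close>

lemma arrow_product_point:
  assumes "arrow_product w m\<^sub>1 m\<^sub>2 m" "y \<in> topspace (F w)" "topspace T = {p}"
  obtains w' n\<^sub>1 n\<^sub>2 n y' where "arrow_product w' n\<^sub>1 n\<^sub>2 n" "sp X w' = T" "y' \<in> topspace (F w')"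
    "f n\<^sub>1 y' = f m\<^sub>1 y" "f n\<^sub>2 y' = f m\<^sub>2 y" "f n y' = f m y"
proof -
  have w: "w \<in> Ob X" using assms(1) by (simp add: arrow_product_def)
  obtain w' j where j: "sp X w' = T" "j \<in> Homs X w' w" "mp X j p = q w y"
    using pullback_point[OF w proj_in[OF w assms(2)] assms(3)] by metis
  obtain y' where y': "y' \<in> topspace (F w')" "f j y' = y"
    using map_surj[OF j(2), of p y] j assms by auto
  show thesis
  proof (rule that[of w' "Cmp X m\<^sub>1 j" "Cmp X m\<^sub>2 j" "Cmp X m j" y'])
    show "arrow_product w' (Cmp X m\<^sub>1 j) (Cmp X m\<^sub>2 j) (Cmp X m j)"
      using assms(1) j Homs_Ob[OF j(2)] unfolding arrow_product_def
      by (auto simp: Cmp_assoc[OF dbl_Homs(1)] Cmp_assoc[OF dbl_Homs(2)] intro: Cmp_Homs)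
  qed (use assms j y' in \<open>auto simp: arrow_product_def map_Cmp\<close>)
qed

text \<open>Makes the THE in \<open>prd\<close> legitimate. Over a point, two witnesses are related
  by the vertical morphism that matches their second factors; it then matches the first factors by
  cancellation along \<open>p_src D\<close>, and the products by universality of the span.\<close>

lemma arrow_product_unique:
  assumes "arrow_product w m\<^sub>1 m\<^sub>2 m" "y \<in> topspace (F w)"
    and "arrow_product w' n\<^sub>1 n\<^sub>2 n" "y' \<in> topspace (F w')"
    and "f n\<^sub>1 y' = f m\<^sub>1 y" "f n\<^sub>2 y' = f m\<^sub>2 y"
  shows "f n y' = f m y"
proof -
  define p where "p = q w y"
  let ?T = "discrete_topology {p}"
  have T: "topspace ?T = {p}" by simp
  obtain v k\<^sub>1 k\<^sub>2 k z where v: "arrow_product v k\<^sub>1 k\<^sub>2 k" "sp X v = ?T" "z \<in> topspace (F v)"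
    and k: "f k\<^sub>1 z = f m\<^sub>1 y" "f k\<^sub>2 z = f m\<^sub>2 y" "f k z = f m y"
    using arrow_product_point[OF assms(1,2) T] by metis
  obtain v' l\<^sub>1 l\<^sub>2 l z' where v': "arrow_product v' l\<^sub>1 l\<^sub>2 l" "sp X v' = ?T" "z' \<in> topspace (F v')"
    and l: "f l\<^sub>1 z' = f n\<^sub>1 y'" "f l\<^sub>2 z' = f n\<^sub>2 y'" "f l z' = f n y'"
    using arrow_product_point[OF assms(3,4) T] by metis
  have Ks: "k\<^sub>1 \<in> Homs X v (dbl D)" "k\<^sub>2 \<in> Homs X v (dbl D)" "k \<in> Homs X v (dbl D)"
    and Ls: "l\<^sub>1 \<in> Homs X v' (dbl D)" "l\<^sub>2 \<in> Homs X v' (dbl D)" "l \<in> Homs X v' (dbl D)"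
    and Ob: "v \<in> Ob X" "v' \<in> Ob X"
    using v v' by (auto simp: arrow_product_def)
  have pt: "q v z = p" "q v' z' = p"
    using proj_in[OF Ob(1) v(3)] proj_in[OF Ob(2) v'(3)] v v' by auto
  have mp_eq: "mp X a = mp X b"
    if "a \<in> Homs X v (dbl D)" "b \<in> Homs X v' (dbl D)" "f a z = f b z'" for a b
  proof -
    have "mp X a p = mp X b p"
      using proj_map[OF that(1) v(3)] proj_map[OF that(2) v'(3)] that(3) pt by simp
    then show ?thesis
      using space_map_mp[OF that(1)] space_map_mp[OF that(2)] v(2) v'(2)
      by (auto simp: space_map_def intro: extensionalityI[of _ "{p}"])
  qed
  obtain \<phi> where \<phi>: "\<phi> \<in> Homs X v' v" "mp X \<phi> = restrict id {p}" "Cmp X k\<^sub>2 \<phi> = l\<^sub>2"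
    using vertical_iso[OF Ks(2) Ls(2)] v(2) v'(2) mp_eq[OF Ks(2) Ls(2)] k l assms(6) by auto
  have \<phi>z: "f \<phi> z' = z"
  proof (rule map_inj[OF Ks(2)])
    show "f k\<^sub>2 (f \<phi> z') = f k\<^sub>2 z"
      using map_Cmp[OF Ks(2) \<phi>(1) v'(3)] \<phi>(3) k l assms(6) by simp
    show "q v (f \<phi> z') = q v z"
      using proj_map[OF \<phi>(1) v'(3)] \<phi>(2) pt by simp
  qed (use \<phi> v v' map_in in auto)
  have mp\<phi>: "mp X (Cmp X a \<phi>) = mp X a" if "a \<in> Homs X v (dbl D)" for a
    using space_map_mp[OF that] v(2) v'(2) \<phi>
    by (auto simp: mp_Cmp[OF that \<phi>(1)] space_map_def compose_def intro: extensionalityI[of _ "{p}"])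
  have "Cmp X k\<^sub>1 \<phi> = l\<^sub>1"
  proof (rule Cmp_cancel_left[OF dbl_Homs(1) Cmp_Homs[OF Ks(1) \<phi>(1)] Ls(1)])
    show "mp X (Cmp X k\<^sub>1 \<phi>) = mp X l\<^sub>1"
      using mp\<phi>[OF Ks(1)] mp_eq[OF Ks(1) Ls(1)] k l assms(5) by simp
    have "Cmp X (p_src D) (Cmp X k\<^sub>1 \<phi>) = Cmp X (p_rng D) (Cmp X k\<^sub>2 \<phi>)"
      using v(1) Ks \<phi>(1) by (simp add: Cmp_assoc[OF dbl_Homs(1)] Cmp_assoc[OF dbl_Homs(2)] arrow_product_def)
    then show "Cmp X (p_src D) (Cmp X k\<^sub>1 \<phi>) = Cmp X (p_src D) l\<^sub>1"
      using v'(1) \<phi>(3) by (simp add: arrow_product_def)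
  qed
  moreover have "Cmp X (p_src D) (Cmp X k \<phi>) = Cmp X (p_src D) (Cmp X k\<^sub>2 \<phi>)"
    "Cmp X (p_rng D) (Cmp X k \<phi>) = Cmp X (p_rng D) (Cmp X k\<^sub>1 \<phi>)"
    using v(1) Ks \<phi>(1) by (simp_all add: Cmp_assoc[OF dbl_Homs(1)] Cmp_assoc[OF dbl_Homs(2)] arrow_product_def)
  ultimately have "Cmp X (p_src D) (Cmp X k \<phi>) = Cmp X (p_src D) l"
    "Cmp X (p_rng D) (Cmp X k \<phi>) = Cmp X (p_rng D) l"
    using v'(1) \<phi>(3) by (simp_all add: arrow_product_def)
  then have "Cmp X k \<phi> = l"
    using dbl_universal[OF Cmp_Homs[OF dbl_Homs(1) Ls(3)] Cmp_Homs[OF dbl_Homs(2) Ls(3)]]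
      Cmp_Homs[OF Ks(3) \<phi>(1)] Ls(3) by blast
  then show ?thesis
    using map_Cmp[OF Ks(3) \<phi>(1) v'(3)] \<phi>z k l by simp
qed

lemma prd_span_groupoid:
  assumes "arrow_product w m\<^sub>1 m\<^sub>2 m" "y \<in> topspace (F w)"
  shows "prd G (f m\<^sub>1 y) (f m\<^sub>2 y) = f m y"
  unfolding span_groupoid_def tgroupoid.simps
proof (rule the_equality)
  fix g
  assume "\<exists>w\<in>Ob X. \<exists>n\<^sub>1\<in>Homs X w (dbl D). \<exists>n\<^sub>2\<in>Homs X w (dbl D). \<exists>n\<in>Homs X w (dbl D). \<exists>z\<in>topspace (F w).
    Cmp X (p_src D) n\<^sub>1 = Cmp X (p_rng D) n\<^sub>2 \<and> Cmp X (p_src D) n = Cmp X (p_src D) n\<^sub>2 \<and>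
    Cmp X (p_rng D) n = Cmp X (p_rng D) n\<^sub>1 \<and> f n\<^sub>1 z = f m\<^sub>1 y \<and> f n\<^sub>2 z = f m\<^sub>2 y \<and> f n z = g"
  then show "g = f m y"
    using arrow_product_unique[OF assms] unfolding arrow_product_def by metis
qed (use assms in \<open>unfold arrow_product_def, blast\<close>)

lemma src_span_groupoid:
  assumes "arrow_product w m\<^sub>1 m\<^sub>2 m" "y \<in> topspace (F w)"
  shows "src G (f m\<^sub>1 y) = rng G (f m\<^sub>2 y)"
  using assms map_Cmp[OF dbl_Homs(1)] map_Cmp[OF dbl_Homs(2)]
  by (simp add: span_groupoid_def arrow_product_def) metis

text \<open>Realise \<open>a\<close> and \<open>b\<close> over one-point objects. Equality of the
  source of \<open>a\<close> with the range of \<open>b\<close> gives a vertical morphism between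
  these objects, along which the span of \<open>a\<close> is transported to that of
  \<open>b\<close>.\<close>

lemma composable_arrows:
  assumes a: "a \<in> topspace (arr G)" and b: "b \<in> topspace (arr G)" and ab: "src G a = rng G b"
  obtains w m\<^sub>1 m\<^sub>2 m y where "arrow_product w m\<^sub>1 m\<^sub>2 m" "y \<in> topspace (F w)" "f m\<^sub>1 y = a" "f m\<^sub>2 y = b"
proof -
  have a': "a \<in> topspace (F (dbl D))" and b': "b \<in> topspace (F (dbl D))" and ab': "f (p_src D) a = f (p_rng D) b"
    using assms by (auto simp: span_groupoid_def)
  have dbl: "dbl D \<in> Ob X" using Homs_Ob dbl_Homs by blast
  \<comment> \<open>Any one-point space would serve; both objects must lie over the same one to be
    compared vertically.\<close>
  let ?T = "discrete_topology {q (dbl D) a}" and ?p = "q (dbl D) a"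
  have T: "topspace ?T = {?p}" by simp
  obtain v k where k: "sp X v = ?T" "k \<in> Homs X v (dbl D)" "mp X k ?p = q (dbl D) a"
    using pullback_point[OF dbl proj_in[OF dbl a'] T] by metis
  obtain w l where l: "sp X w = ?T" "l \<in> Homs X w (dbl D)" "mp X l ?p = q (dbl D) b" "w \<in> Ob X"
    using pullback_point[OF dbl proj_in[OF dbl b'] T] by metis
  have eq: "mp X (p_src D) (q (dbl D) a) = mp X (p_rng D) (q (dbl D) b)"
    using proj_map[OF dbl_Homs(1) a'] proj_map[OF dbl_Homs(2) b'] ab' by simp
  have "mp X (Cmp X (p_src D) k) = mp X (Cmp X (p_rng D) l)"
    using k l eq by (auto simp: mp_Cmp[OF dbl_Homs(1)] mp_Cmp[OF dbl_Homs(2)] compose_def)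
  then obtain \<phi> where \<phi>: "\<phi> \<in> Homs X w v" "mp X \<phi> = restrict id {?p}"
    "Cmp X (Cmp X (p_src D) k) \<phi> = Cmp X (p_rng D) l"
    using vertical_iso[OF Cmp_Homs[OF dbl_Homs(1) k(2)] Cmp_Homs[OF dbl_Homs(2) l(2)]] k l by auto
  let ?m = "Cmp X k \<phi>"
  have m1: "?m \<in> Homs X w (dbl D)" by (rule Cmp_Homs[OF k(2) \<phi>(1)])
  obtain m where m: "m \<in> Homs X w (dbl D)" "Cmp X (p_src D) m = Cmp X (p_src D) l"
    "Cmp X (p_rng D) m = Cmp X (p_rng D) ?m"
    using dbl_universal[OF Cmp_Homs[OF dbl_Homs(1) l(2)] Cmp_Homs[OF dbl_Homs(2) m1]] by blast
  have prod: "arrow_product w ?m l m"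
    using m m1 l \<phi>(3) Cmp_assoc[OF dbl_Homs(1) k(2) \<phi>(1)] by (simp add: arrow_product_def)
  obtain y where y: "y \<in> topspace (F w)" "q w y = ?p" "f l y = b"
    using map_surj[OF l(2), of ?p b] l b' by auto
  \<comment> \<open>Both arrows lie over the same point and have the same source, and
    \<open>f (p_src D)\<close> is injective on fibres.\<close>
  have "f ?m y = a"
  proof (rule map_inj[OF dbl_Homs(1)])
    show "q (dbl D) (f ?m y) = q (dbl D) a"
      using proj_map[OF m1 y(1)] y(2) mp_Cmp_apply[OF k(2) \<phi>(1)] \<phi>(2) k l by simp
    show "f (p_src D) (f ?m y) = f (p_src D) a"
      using src_span_groupoid[OF prod y(1)] y ab by (simp add: span_groupoid_def)
  qed (use a' y map_in m1 in auto)
  with prod y show thesis using that by blast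
qed

end

text \<open>Witnesses of products involve only \<open>X\<close> and \<open>D\<close>, so both
  functors share them, and naturality of \<open>\<eta>\<close> carries the evaluation at a point
  from one to the other.\<close>

lemma arrow_functor_span_groupoid:
  assumes F: "fibred_space_functor X D F f q" and F': "fibred_space_functor X D F' f' q'"
    and in': "\<And>x e. \<lbrakk>x \<in> Ob X; e \<in> topspace (F x)\<rbrakk> \<Longrightarrow> \<eta> x e \<in> topspace (F' x)"
    and nat: "\<And>m x y e. \<lbrakk>m \<in> Homs X x y; e \<in> topspace (F x)\<rbrakk> \<Longrightarrow> \<eta> y (f m e) = f' m (\<eta> x e)"
  shows "arrow_functor (span_groupoid X D F f) (span_groupoid X D F' f') (\<eta> (dbl D))"
proof -
  interpret F: fibred_space_functor X D F f q by fact
  interpret F': fibred_space_functor X D F' f' q' by fact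
  have dbl: "dbl D \<in> Ob X" using F.dbl_Homs F.Homs_Ob by blast
  show ?thesis
    unfolding arrow_functor_def
  proof (intro conjI ballI impI)
    show "\<eta> (dbl D) ` topspace (arr (span_groupoid X D F f)) \<subseteq> topspace (arr (span_groupoid X D F' f'))"
      using in'[OF dbl] by (auto simp: span_groupoid_def)
  next
    fix a b assume ab: "a \<in> topspace (arr F.G)" "b \<in> topspace (arr F.G)" "src F.G a = rng F.G b"
    obtain w m\<^sub>1 m\<^sub>2 m y where w: "F.arrow_product w m\<^sub>1 m\<^sub>2 m" "y \<in> topspace (F w)" "f m\<^sub>1 y = a" "f m\<^sub>2 y = b"
      using F.composable_arrows[OF ab] .
    have w': "F'.arrow_product w m\<^sub>1 m\<^sub>2 m"
      using w(1) by (simp add: F.arrow_product_def F'.arrow_product_def)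
    have "w \<in> Ob X" and h: "m\<^sub>1 \<in> Homs X w (dbl D)" "m\<^sub>2 \<in> Homs X w (dbl D)" "m \<in> Homs X w (dbl D)"
      using w(1) by (auto simp: F.arrow_product_def)
    then have y': "\<eta> w y \<in> topspace (F' w)" using in' w(2) by blast
    show "src F'.G (\<eta> (dbl D) a) = rng F'.G (\<eta> (dbl D) b)"
      using F'.src_span_groupoid[OF w' y'] nat h w(2-4) by metis
    show "prd F'.G (\<eta> (dbl D) a) (\<eta> (dbl D) b) = \<eta> (dbl D) (prd F.G a b)"
      using F'.prd_span_groupoid[OF w' y'] F.prd_span_groupoid[OF w(1,2)] nat h w(2-4) by metis
  qed
qed

lemma (in fibred_groupoids) fibred_space_functor_sp:
  assumes "fibre_product X (atl D) (atl D) (dbl D) (p_src D) (p_rng D)"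
  shows "fibred_space_functor X D (sp X) (mp X) (\<lambda>_ t. t)"
  by unfold_locales (use assms in \<open>auto simp: mp_in mp_Cmp_apply\<close>)

section \<open>Principal bundles\<close>

lemma principal_bundle_prj:
  "principal_bundle P \<Longrightarrow> x \<in> topspace (tot P) \<Longrightarrow> prj P x \<in> topspace (base P)"
  by (auto simp: principal_bundle_def continuous_map_def Pi_iff)

lemma principal_bundle_act:
  assumes "principal_bundle P" "x \<in> topspace (tot P)" "norm \<zeta> = 1"
  shows "act P x \<zeta> \<in> topspace (tot P)" "prj P (act P x \<zeta>) = prj P x" "act P x 1 = x"
  using assms by (auto simp: principal_bundle_def continuous_map_def Pi_iff U1_top_def)

lemma principal_bundle_act_act:
  assumes "principal_bundle P" "x \<in> topspace (tot P)" "norm \<zeta> = 1" "norm \<xi> = 1"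
  shows "act P (act P x \<zeta>) \<xi> = act P x (\<zeta> * \<xi>)"
  using assms by (auto simp: principal_bundle_def)

lemma principal_bundle_act_continuous:
  assumes "principal_bundle P" "x \<in> topspace (tot P)"
  shows "continuous_map U1_top (tot P) (act P x)"
proof -
  have "continuous_map U1_top (prod_topology (tot P) U1_top) (\<lambda>\<zeta>. (x, \<zeta>))"
    using assms(2) by (simp add: continuous_map_paired)
  moreover have "continuous_map (prod_topology (tot P) U1_top) (tot P) (\<lambda>(x, \<zeta>). act P x \<zeta>)"
    using assms(1) by (simp add: principal_bundle_def)
  ultimately show ?thesis
    using continuous_map_compose by (fastforce simp: o_def)
qed

lemma principal_bundle_torsor:
  assumes P: "principal_bundle P" and t: "t \<in> topspace (base P)"
  obtains e where "e \<in> topspace (tot P)" "prj P e = t"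
    "\<And>x. \<lbrakk>x \<in> topspace (tot P); prj P x = t\<rbrakk> \<Longrightarrow> \<exists>!\<zeta>. norm \<zeta> = 1 \<and> act P e \<zeta> = x"
proof -
  obtain U s where U: "openin (base P) U" "t \<in> U"
    and s: "continuous_map (subtopology (base P) U) (tot P) s" "\<forall>y\<in>U. prj P (s y) = y"
    and h: "homeomorphic_map (prod_topology (subtopology (base P) U) U1_top)
          (subtopology (tot P) {x \<in> topspace (tot P). prj P x \<in> U}) (\<lambda>(y, \<zeta>). act P (s y) \<zeta>)"
    using P t unfolding principal_bundle_def by meson
  have U': "U \<subseteq> topspace (base P)" using U(1) by (rule openin_subset)
  have sU: "s y \<in> topspace (tot P)" if "y \<in> U" for y
    using s(1) that U' by (auto simp: continuous_map_def Pi_iff)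
  have top: "topspace (prod_topology (subtopology (base P) U) U1_top) = U \<times> sphere 0 1"
    using U' by (auto simp: U1_top_def)
  have inj: "inj_on (\<lambda>(y, \<zeta>). act P (s y) \<zeta>) (U \<times> sphere 0 1)"
    using homeomorphic_imp_injective_map[OF h] top by simp
  have img: "(\<lambda>(y, \<zeta>). act P (s y) \<zeta>) ` (U \<times> sphere 0 1) = {x \<in> topspace (tot P). prj P x \<in> U}"
    using homeomorphic_imp_surjective_map[OF h] top by auto
  show thesis
  proof (rule that[of "s t"])
    fix x assume x: "x \<in> topspace (tot P)" "prj P x = t"
    then have "x \<in> (\<lambda>(y, \<zeta>). act P (s y) \<zeta>) ` (U \<times> sphere 0 1)"
      using img U(2) by simp
    then obtain y \<zeta> where y: "y \<in> U" "norm \<zeta> = 1" "x = act P (s y) \<zeta>"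
      by auto
    then have "y = t"
      using principal_bundle_act(2)[OF P sU] s(2) x(2) by auto
    show "\<exists>!\<zeta>. norm \<zeta> = 1 \<and> act P (s t) \<zeta> = x"
    proof (rule ex1I[of _ \<zeta>])
      fix \<xi> assume "norm \<xi> = 1 \<and> act P (s t) \<xi> = x"
      then show "\<xi> = \<zeta>"
        using inj_onD[OF inj, of "(t, \<xi>)" "(t, \<zeta>)"] y \<open>y = t\<close> U(2) by simp
    qed (use y \<open>y = t\<close> in simp)
  qed (use sU s U in auto)
qed

text \<open>Measured from a reference point \<open>e\<close> of the fibre, \<open>x\<close> and
  \<open>y\<close> are given by scalars \<open>a\<close> and \<open>b\<close>, and
  \<open>b / a\<close> is the only candidate.\<close>

lemma principal_bundle_transitive:
  assumes P: "principal_bundle P" and xy: "x \<in> topspace (tot P)" "y \<in> topspace (tot P)" "prj P x = prj P y"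
  shows "\<exists>!\<zeta>. norm \<zeta> = 1 \<and> act P x \<zeta> = y"
proof -
  obtain e where e: "e \<in> topspace (tot P)"
    and *: "\<And>z. \<lbrakk>z \<in> topspace (tot P); prj P z = prj P x\<rbrakk> \<Longrightarrow> \<exists>!\<zeta>. norm \<zeta> = 1 \<and> act P e \<zeta> = z"
    using principal_bundle_torsor[OF P principal_bundle_prj[OF P xy(1)]] by metis
  obtain a where a: "norm a = 1" "act P e a = x" using *[of x] xy by auto
  obtain b where b: "norm b = 1" "act P e b = y" using *[of y] xy by auto
  have *: "act P x \<zeta> = act P e (a * \<zeta>)" if "norm \<zeta> = 1" for \<zeta>
    using principal_bundle_act_act[OF P e a(1) that] a by simp
  have "a \<noteq> 0" using a by auto
  show ?thesis
  proof (rule ex1I[of _ "b / a"])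
    show "norm (b / a) = 1 \<and> act P x (b / a) = y"
      using a b *[of "b / a"] \<open>a \<noteq> 0\<close> by (simp add: norm_divide)
    fix \<zeta> assume \<zeta>: "norm \<zeta> = 1 \<and> act P x \<zeta> = y"
    then have "a * \<zeta> = b"
      using *[of \<zeta>] \<open>\<And>z. _ \<Longrightarrow> _ \<Longrightarrow> \<exists>!\<zeta>. norm \<zeta> = 1 \<and> act P e \<zeta> = z\<close>[of y] a b xy
      by (auto simp: norm_mult)
    then show "\<zeta> = b / a" using \<open>a \<noteq> 0\<close> by (simp add: field_simps)
  qed
qed

lemma bundle_morphism_facts:
  assumes "bundle_morphism m"
  shows "principal_bundle (bdom m)" "principal_bundle (bcod m)"
    "x \<in> topspace (tot (bdom m)) \<Longrightarrow> tmap m x \<in> topspace (tot (bcod m))"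
    "x \<in> topspace (tot (bdom m)) \<Longrightarrow> prj (bcod m) (tmap m x) = bmap m (prj (bdom m) x)"
    "\<lbrakk>x \<in> topspace (tot (bdom m)); norm \<zeta> = 1\<rbrakk> \<Longrightarrow> tmap m (act (bdom m) x \<zeta>) = act (bcod m) (tmap m x) \<zeta>"
  using assms by (auto simp: bundle_morphism_def space_map_def continuous_map_def Pi_iff)

lemma bundle_morphism_inj:
  assumes m: "bundle_morphism m" and x: "x \<in> topspace (tot (bdom m))" and y: "y \<in> topspace (tot (bdom m))"
    and eq: "prj (bdom m) x = prj (bdom m) y" "tmap m x = tmap m y"
  shows "x = y"
proof -
  note M = bundle_morphism_facts[OF m]
  obtain \<zeta> where \<zeta>: "norm \<zeta> = 1" "act (bdom m) x \<zeta> = y"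
    using principal_bundle_transitive[OF M(1) x y eq(1)] by auto
  have "act (bcod m) (tmap m x) \<zeta> = tmap m x" "act (bcod m) (tmap m x) 1 = tmap m x"
    using M(5)[OF x \<zeta>(1)] \<zeta>(2) eq(2) principal_bundle_act(3)[OF M(2) M(3)[OF x] \<zeta>(1)] by auto
  then have "\<zeta> = 1"
    using principal_bundle_transitive[OF M(2) M(3)[OF x] M(3)[OF x]] \<zeta>(1) by auto
  then show ?thesis
    using \<zeta> principal_bundle_act(3)[OF M(1) x, of 1] by simp
qed

lemma bundle_morphism_surj:
  assumes m: "bundle_morphism m" and s: "s \<in> topspace (base (bdom m))"
    and d: "d \<in> topspace (tot (bcod m))" "prj (bcod m) d = bmap m s"
  obtains e where "e \<in> topspace (tot (bdom m))" "prj (bdom m) e = s" "tmap m e = d"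
proof -
  note M = bundle_morphism_facts[OF m]
  obtain e where e: "e \<in> topspace (tot (bdom m))" "prj (bdom m) e = s"
    using principal_bundle_torsor[OF M(1) s] by metis
  obtain \<zeta> where \<zeta>: "norm \<zeta> = 1" "act (bcod m) (tmap m e) \<zeta> = d"
    using principal_bundle_transitive[OF M(2) M(3)[OF e(1)] d(1)] M(4)[OF e(1)] e(2) d(2) by auto
  show thesis
    using that[of "act (bdom m) e \<zeta>"] principal_bundle_act[OF M(1) e(1) \<zeta>(1)] M(5)[OF e(1) \<zeta>(1)] \<zeta> e by auto
qed

section \<open>Total spaces of a bundle over a stack\<close>

lemma (in fibred_groupoids) bundle_morphism_stack_map:
  assumes "stack_map X BU1 p\<^sub>o p\<^sub>m" "m \<in> Homs X x y"
  shows "bundle_morphism (p\<^sub>m m)" "bdom (p\<^sub>m m) = p\<^sub>o x" "bcod (p\<^sub>m m) = p\<^sub>o y" "bmap (p\<^sub>m m) = mp X m"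
  using assms unfolding stack_map_def BU1_def Homs_def by auto

lemma (in fibred_groupoids) tmap_stack_map_Cmp:
  assumes "stack_map X BU1 p\<^sub>o p\<^sub>m" "g \<in> Homs X y z" "f \<in> Homs X x y" "e \<in> topspace (tot (p\<^sub>o x))"
  shows "tmap (p\<^sub>m (Cmp X g f)) e = tmap (p\<^sub>m g) (tmap (p\<^sub>m f) e)"
proof -
  have "p\<^sub>m (Cmp X g f) = Cmp BU1 (p\<^sub>m g) (p\<^sub>m f)"
    using assms(1-3) unfolding stack_map_def Homs_def by auto
  then show ?thesis
    using assms(4) bundle_morphism_stack_map(2)[OF assms(1,3)] by (simp add: BU1_def compose_def)
qed

lemma (in fibred_groupoids) bundle_stack_map:
  assumes "stack_map X BU1 p\<^sub>o p\<^sub>m" "x \<in> Ob X"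
  shows "principal_bundle (p\<^sub>o x)" "base (p\<^sub>o x) = sp X x"
  using assms unfolding stack_map_def BU1_def by auto

lemma (in fibred_groupoids) fibred_space_functor_tot:
  assumes p: "stack_map X BU1 p\<^sub>o p\<^sub>m"
    and D: "fibre_product X (atl D) (atl D) (dbl D) (p_src D) (p_rng D)"
  shows "fibred_space_functor X D (\<lambda>x. tot (p\<^sub>o x)) (\<lambda>m. tmap (p\<^sub>m m)) (\<lambda>x. prj (p\<^sub>o x))"
proof
  fix m x y assume m: "m \<in> Homs X x y"
  note M = bundle_morphism_stack_map[OF p m] and B = bundle_morphism_facts[OF bundle_morphism_stack_map(1)[OF p m]]
  show "tmap (p\<^sub>m m) e \<in> topspace (tot (p\<^sub>o y))" if "e \<in> topspace (tot (p\<^sub>o x))" for e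
    using B(3)[of e] M that by simp
  show "prj (p\<^sub>o y) (tmap (p\<^sub>m m) e) = mp X m (prj (p\<^sub>o x) e)" if "e \<in> topspace (tot (p\<^sub>o x))" for e
    using B(4)[of e] M that by simp
  show "e = e'" if "e \<in> topspace (tot (p\<^sub>o x))" "e' \<in> topspace (tot (p\<^sub>o x))"
    "prj (p\<^sub>o x) e = prj (p\<^sub>o x) e'" "tmap (p\<^sub>m m) e = tmap (p\<^sub>m m) e'" for e e'
    using bundle_morphism_inj[OF M(1), of e e'] M that by simp
  show "\<exists>e\<in>topspace (tot (p\<^sub>o x)). prj (p\<^sub>o x) e = s \<and> tmap (p\<^sub>m m) e = d"
    if "s \<in> topspace (sp X x)" "d \<in> topspace (tot (p\<^sub>o y))" "prj (p\<^sub>o y) d = mp X m s" for s d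
    using bundle_morphism_surj[OF M(1), of s d] M that bundle_stack_map(2)[OF p Homs_Ob(1)[OF m]] by auto
next
  show "prj (p\<^sub>o x) e \<in> topspace (sp X x)" if "x \<in> Ob X" "e \<in> topspace (tot (p\<^sub>o x))" for x e
    using bundle_stack_map[OF p that(1)] principal_bundle_prj[OF _ that(2)] by simp
qed (use p D tmap_stack_map_Cmp in auto)

section \<open>The bar construction and the Bockstein boundary\<close>

text \<open>Each \<open>a g\<close> is the image under \<open>q\<close> of a lift, so functoriality
  descends from \<open>src_lift\<close> and \<open>prd_lift\<close> at \<open>z = 1\<close>.\<close>

lemma (in circle_lift) arrow_functor_one_object:
  "arrow_functor (one_object_groupoid \<Gamma>) Y a"
  unfolding arrow_functor_def
proof (intro conjI ballI impI)
  have a: "a g = q (R (A g) 1)" "a g = q (R (A g) (1 * \<zeta> h))" "R (A g) 1 \<in> topspace (arr E)"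
    "R (A g) (1 * \<zeta> h) \<in> topspace (arr E)"
    if "g \<in> carrier \<Gamma>" "h \<in> carrier \<Gamma>" for g h
    using that q_lift lift_in_arr by auto
  show "a ` topspace (arr (one_object_groupoid \<Gamma>)) \<subseteq> topspace (arr Y)"
    using a(1,3) q unfolding arrow_functor_def one_object_groupoid_def by fastforce
  fix g h assume "g \<in> topspace (arr (one_object_groupoid \<Gamma>))" "h \<in> topspace (arr (one_object_groupoid \<Gamma>))"
  then have gh: "g \<in> carrier \<Gamma>" "h \<in> carrier \<Gamma>" by (auto simp: one_object_groupoid_def)
  have s: "src E (R (A g) (1 * \<zeta> h)) = rng E (R (A h) 1)"
    and p: "prd E (R (A g) (1 * \<zeta> h)) (R (A h) 1) = R (A (g \<otimes> h)) 1"
    using src_lift[OF gh, of 1] prd_lift[OF gh, of 1] by auto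
  have "R (A (g \<otimes> h)) 1 \<in> topspace (arr E)" using gh by (simp add: lift_in_arr)
  then have "src Y (q (R (A g) (1 * \<zeta> h))) = rng Y (q (R (A h) 1)) \<and>
    prd Y (q (R (A g) (1 * \<zeta> h))) (q (R (A h) 1)) = q (R (A (g \<otimes> h)) 1)"
    using q a(4)[OF gh] a(3)[OF gh(2,1)] s p unfolding arrow_functor_def by metis
  then have "src Y (a g) = rng Y (a h) \<and> prd Y (a g) (a h) = a (g \<otimes> h)"
    using a(2)[OF gh] a(1)[OF gh(2,1)] q_lift[of "g \<otimes> h" 1] gh by simp
  then show "src Y (a g) = rng Y (a h)" "prd Y (a g) (a h) = a (prd (one_object_groupoid \<Gamma>) g h)"
    by (auto simp: one_object_groupoid_def)
qed

lemma (in group) bar_in_nerve_one_object: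
  assumes "\<And>i. i \<le> n \<Longrightarrow> v i \<in> carrier G"
  shows "bar G (\<lambda>g. g) n v \<in> topspace (nerve_space (one_object_groupoid G) n)"
  using assms unfolding topspace_nerve_space
  by (auto simp: bar_def one_object_groupoid_def m_assoc inv_mult_cancel)

lemma bar_simplex2_eq:
  "bar_simplex2 \<Gamma> g h =
    bar_cell (one_object_groupoid \<Gamma>) \<Gamma> (\<lambda>g. g) 2 (tri \<one>\<^bsub>\<Gamma>\<^esub> g (g \<otimes>\<^bsub>\<Gamma>\<^esub> h))"
  by (simp add: bar_simplex2_def bar_cell_def cell_simplex_def bar_def tri_def Let_def)

text \<open>Two real lifts of the same character differ by an integer-valued cochain, so the
  coboundaries of all lifts form one class.\<close>

lemma (in group) group_class2_eq_bockstein: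
  assumes \<psi>: "\<And>g. g \<in> carrier G \<Longrightarrow> \<psi> g = circle (\<theta> g)"
    and z: "\<And>g h. \<lbrakk>g \<in> carrier G; h \<in> carrier G\<rbrakk> \<Longrightarrow>
      of_int (z g h) = \<theta> h - \<theta> (g \<otimes> h) + \<theta> g - of_int (bar_coboundary G C g h)"
  shows "group_class2 G z = bockstein G \<psi>"
proof (rule Set.set_eqI, rule iffI)
  fix z' assume "z' \<in> group_class2 G z"
  then obtain b where z': "\<And>g h. \<not> (g \<in> carrier G \<and> h \<in> carrier G) \<Longrightarrow> z' g h = 0"
    and b: "\<And>g h. \<lbrakk>g \<in> carrier G; h \<in> carrier G\<rbrakk> \<Longrightarrow> z' g h = z g h + (b h - b (g \<otimes> h) + b g)"
    unfolding group_class2_def by blast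
  \<comment> \<open>Changing \<open>\<theta>\<close> by integers leaves \<open>\<psi>\<close>
    unchanged, and \<open>- C\<close> accounts for the correction in the hypothesis on
    \<open>z\<close>.\<close>
  define f where "f g = \<theta> g + of_int (b g - C g)" for g
  have "\<psi> g = exp (2 * of_real pi * \<i> * of_real (f g))" if "g \<in> carrier G" for g
    using \<psi>[OF that] circle_eq_1[of "of_int (b g - C g)"]
    by (simp only: f_def circle_add flip: circle_def) simp
  moreover have "of_int (z' g h) = f h - f (g \<otimes> h) + f g" if "g \<in> carrier G" "h \<in> carrier G" for g h
    using b[OF that] z[OF that] by (simp add: f_def bar_coboundary_def)
  ultimately show "z' \<in> bockstein G \<psi>"
    unfolding bockstein_def using z' by blast
next
  fix z' assume "z' \<in> bockstein G \<psi>"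
  then obtain f where z': "\<And>g h. \<not> (g \<in> carrier G \<and> h \<in> carrier G) \<Longrightarrow> z' g h = 0"
    and f: "\<And>g. g \<in> carrier G \<Longrightarrow> \<psi> g = circle (f g)"
    and zf: "\<And>g h. \<lbrakk>g \<in> carrier G; h \<in> carrier G\<rbrakk> \<Longrightarrow> of_int (z' g h) = f h - f (g \<otimes> h) + f g"
    unfolding bockstein_def circle_def[symmetric] by blast
  have "f g - \<theta> g \<in> \<int>" if "g \<in> carrier G" for g
    using f[OF that] \<psi>[OF that] norm_circle[of "\<theta> g"]
    by (simp only: circle_eq_1[symmetric] circle_diff) (metis norm_zero right_inverse zero_neq_one)
  then have n: "f g - \<theta> g = of_int \<lfloor>f g - \<theta> g\<rfloor>" if "g \<in> carrier G" for g
    using that by (metis Ints_cases floor_of_int)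
  define b where "b g = \<lfloor>f g - \<theta> g\<rfloor> + C g" for g
  have "z' g h = z g h + (b h - b (g \<otimes> h) + b g)" if gh: "g \<in> carrier G" "h \<in> carrier G" for g h
  proof -
    have "real_of_int (z' g h) = of_int (z g h + (b h - b (g \<otimes> h) + b g))"
      using zf[OF gh] z[OF gh] n[OF gh(1)] n[OF gh(2)] n[OF m_closed[OF gh]]
      by (simp add: b_def bar_coboundary_def)
    then show ?thesis by linarith
  qed
  then show "z' \<in> group_class2 G z"
    unfolding group_class2_def using z' by blast
qed

text \<open>Two real lifts with the same coboundary differ by a homomorphism to the additive group
  of reals, which vanishes on elements of finite order.\<close>

lemma (in group) bockstein_inject:
  assumes fin: "finite (carrier G)" and \<psi>: "\<psi> \<in> characters G" "\<psi>' \<in> characters G"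
    and z: "z \<in> bockstein G \<psi>" "z \<in> bockstein G \<psi>'"
  shows "\<psi> = \<psi>'"
proof -
  obtain f where f: "\<And>g. g \<in> carrier G \<Longrightarrow> \<psi> g = circle (f g)"
    and zf: "\<And>g h. \<lbrakk>g \<in> carrier G; h \<in> carrier G\<rbrakk> \<Longrightarrow> of_int (z g h) = f h - f (g \<otimes> h) + f g"
    using z(1) unfolding bockstein_def circle_def[symmetric] by blast
  obtain f' where f': "\<And>g. g \<in> carrier G \<Longrightarrow> \<psi>' g = circle (f' g)"
    and zf': "\<And>g h. \<lbrakk>g \<in> carrier G; h \<in> carrier G\<rbrakk> \<Longrightarrow> of_int (z g h) = f' h - f' (g \<otimes> h) + f' g"
    using z(2) unfolding bockstein_def circle_def[symmetric] by blast
  define d where "d g = f g - f' g" for g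
  have d: "d (g \<otimes> h) = d g + d h" if "g \<in> carrier G" "h \<in> carrier G" for g h
    using zf[OF that] zf'[OF that] by (simp add: d_def)
  have pow: "d (g [^] n) = n * d g" if "g \<in> carrier G" for g and n :: nat
  proof (induction n)
    case 0
    then show ?case using d[of \<one> \<one>] by simp
  next
    case (Suc n)
    then show ?case using that d[of "g [^] n" g] by (simp add: algebra_simps)
  qed
  have "\<psi> g = \<psi>' g" if g: "g \<in> carrier G" for g
  proof -
    have "real (ord g) * d g = 0"
      using pow[OF g, of "ord g"] pow[OF g, of 0] g by simp
    moreover have "ord g \<noteq> 0" using ord_ge_1[OF fin g] by simp
    ultimately show ?thesis using f[OF g] f'[OF g] by (simp add: d_def)
  qed
  then show ?thesis
    using \<psi> by (auto simp: characters_def intro: extensionalityI)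
qed

section \<open>Isotropy groups\<close>

text \<open>Properness makes this preimage of a point compact. Finitely many open sets on which the
  source is injective cover it, and each contains at most one of its arrows, the source being
  constant on it.\<close>

lemma finite_isotropy:
  assumes "proper_groupoid G" "etale_groupoid G" "x \<in> topspace (obj G)" "y \<in> topspace (obj G)"
  shows "finite {g \<in> topspace (arr G). src G g = x \<and> rng G g = y}" (is "finite ?I")
proof -
  have cpt: "compactin (arr G) ?I"
    using assms(1,3,4) unfolding proper_groupoid_def proper_map_def by auto
  have "\<exists>U. openin (arr G) U \<and> g \<in> U \<and> inj_on (src G) U" if "g \<in> topspace (arr G)" for g
  proof -
    obtain U where U: "openin (arr G) U" "g \<in> U"
      "homeomorphic_map (subtopology (arr G) U) (subtopology (obj G) (src G ` U)) (src G)"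
    proof -
      from assms(2) have "etale_map (arr G) (obj G) (src G)" by (simp add: etale_groupoid_def)
      then show thesis using \<open>g \<in> topspace (arr G)\<close> that unfolding etale_map_def by meson
    qed
    then show ?thesis
      using homeomorphic_imp_injective_map[OF U(3)] openin_subset[OF U(1)]
      by (auto simp: Int_absorb1 inf.absorb2)
  qed
  then obtain U where U: "\<And>g. g \<in> topspace (arr G) \<Longrightarrow> openin (arr G) (U g) \<and> g \<in> U g \<and> inj_on (src G) (U g)"
    by metis
  have "\<exists>\<F>. finite \<F> \<and> \<F> \<subseteq> U ` ?I \<and> ?I \<subseteq> \<Union>\<F>"
    by (rule compactinD[OF cpt]) (use U in auto)
  then obtain \<F> where \<F>: "finite \<F>" "\<F> \<subseteq> U ` ?I" "?I \<subseteq> \<Union>\<F>" by blast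
  have "finite (V \<inter> ?I)" if "V \<in> \<F>" for V
  proof -
    have "inj_on (src G) V" using that \<F>(2) U by auto
    then have "inj_on (src G) (V \<inter> ?I)" by (rule inj_on_subset) auto
    moreover have "finite (src G ` (V \<inter> ?I))" by (rule finite_subset[of _ "{x}"]) auto
    ultimately show ?thesis using finite_imageD by blast
  qed
  then have "finite (\<Union>V\<in>\<F>. V \<inter> ?I)" using \<F>(1) by blast
  moreover have "?I \<subseteq> (\<Union>V\<in>\<F>. V \<inter> ?I)" using \<F>(3) by blast
  ultimately show ?thesis by (rule rev_finite_subset)
qed

section \<open>Automorphisms of a point as arrows of the atlas groupoid\<close>

locale groupoid_atlas = fibred_groupoids X
  for X :: "('u, 'o, 'm) fibred" +
  fixes D :: "('o, 'm) atlas_data"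
  assumes double: "fibre_product X (atl D) (atl D) (dbl D) (p_src D) (p_rng D)"
begin

sublocale Y: fibred_space_functor X D "sp X" "mp X" "\<lambda>_ t. t"
  using double by (rule fibred_space_functor_sp)

text \<open>\<open>point_arrow\<close> is its map of spaces evaluated at the point. The morphism
  itself is kept because a bundle sends it to a map of total spaces, which lifts the arrow.\<close>

definition point_mor :: "'o \<Rightarrow> 'm \<Rightarrow> 'm \<Rightarrow> 'm" where
  "point_mor v k \<phi> =
     (THE m. m \<in> Homs X v (dbl D) \<and> Cmp X (p_src D) m = k \<and> Cmp X (p_rng D) m = Cmp X k \<phi>)"

lemma point_arrow_eq:
  "topspace (sp X v) = {p} \<Longrightarrow> point_arrow X D v k \<phi> = mp X (point_mor v k \<phi>) p"
  by (simp add: point_arrow_def point_mor_def)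

context
  fixes v k
  assumes k: "k \<in> Homs X v (atl D)"
begin

lemma point_mor:
  assumes "\<phi> \<in> carrier (Auts X v)"
  shows "point_mor v k \<phi> \<in> Homs X v (dbl D)" "Cmp X (p_src D) (point_mor v k \<phi>) = k"
    "Cmp X (p_rng D) (point_mor v k \<phi>) = Cmp X k \<phi>"
proof -
  have "\<phi> \<in> Homs X v v" using assms by (simp add: carrier_Auts)
  from theI'[OF Y.dbl_universal[OF k Cmp_Homs[OF k this]]]
  show "point_mor v k \<phi> \<in> Homs X v (dbl D)" "Cmp X (p_src D) (point_mor v k \<phi>) = k"
    "Cmp X (p_rng D) (point_mor v k \<phi>) = Cmp X k \<phi>"
    unfolding point_mor_def by blast+
qed

text \<open>Precomposing the first factor with \<open>\<psi>\<close> changes its span to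
  \<open>k \<circ> \<psi>\<close> and \<open>k \<circ> \<phi> \<circ> \<psi>\<close>, whose source
  leg is the range leg of the second factor.\<close>

lemma arrow_product_point_mor:
  assumes "\<phi> \<in> carrier (Auts X v)" "\<psi> \<in> carrier (Auts X v)"
  shows "Y.arrow_product v (Cmp X (point_mor v k \<phi>) \<psi>) (point_mor v k \<psi>) (point_mor v k (Cmp X \<phi> \<psi>))"
proof -
  interpret group "Auts X v" using Homs_Ob[OF k] group_Auts by blast
  have H: "\<phi> \<in> Homs X v v" "\<psi> \<in> Homs X v v" using assms by (auto simp: carrier_Auts)
  have "Cmp X \<phi> \<psi> \<in> carrier (Auts X v)" using m_closed[OF assms] by simp
  then show ?thesis
    unfolding Y.arrow_product_def
    using point_mor[OF assms(1)] point_mor[OF assms(2)] point_mor[of "Cmp X \<phi> \<psi>"] H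
      Homs_Ob[OF k] Cmp_Homs[OF point_mor(1)[OF assms(1)] H(2)]
    by (simp add: Cmp_assoc[OF Y.dbl_Homs(1)] Cmp_assoc[OF Y.dbl_Homs(2)] Cmp_assoc[OF k])
qed

text \<open>The value at the only point determines the map of spaces. Together with the source leg
  \<open>k\<close> this determines the morphism, hence its range leg, from which \<open>k\<close>
  can be cancelled.\<close>

lemma inj_on_point_arrow:
  assumes p: "topspace (sp X v) = {p}"
  shows "inj_on (point_arrow X D v k) (carrier (Auts X v))"
proof (rule inj_onI)
  fix \<phi> \<psi> assume \<phi>: "\<phi> \<in> carrier (Auts X v)" and \<psi>: "\<psi> \<in> carrier (Auts X v)"
    and eq: "point_arrow X D v k \<phi> = point_arrow X D v k \<psi>"
  have "mp X (point_mor v k \<phi>) = mp X (point_mor v k \<psi>)"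
    using eq mp_eq_point[OF point_mor(1)[OF \<phi>] point_mor(1)[OF \<psi>] p] by (simp add: point_arrow_eq[OF p])
  then have "point_mor v k \<phi> = point_mor v k \<psi>"
    using Cmp_cancel_left[OF Y.dbl_Homs(1) point_mor(1)[OF \<phi>] point_mor(1)[OF \<psi>]]
      point_mor(2)[OF \<phi>] point_mor(2)[OF \<psi>] by simp
  then have "Cmp X k \<phi> = Cmp X k \<psi>"
    using point_mor(3)[OF \<phi>] point_mor(3)[OF \<psi>] by simp
  then show "\<phi> = \<psi>"
    using Cmp_cancel_left[OF k] \<phi> \<psi> by (auto simp: carrier_Auts)
qed

lemma finite_Auts:
  assumes p: "topspace (sp X v) = {p}"
    and G: "proper_groupoid (atlas_groupoid X D)" "etale_groupoid (atlas_groupoid X D)"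
  shows "finite (carrier (Auts X v))"
proof -
  let ?G = "atlas_groupoid X D" and ?x = "mp X k p"
  have x: "?x \<in> topspace (obj ?G)"
    using mp_in[OF k] p by (simp add: atlas_groupoid_def span_groupoid_def)
  have "point_arrow X D v k ` carrier (Auts X v) \<subseteq>
      {g \<in> topspace (arr ?G). src ?G g = ?x \<and> rng ?G g = ?x}"
  proof (clarify, intro CollectI conjI)
    fix \<phi> assume \<phi>: "\<phi> \<in> carrier (Auts X v)"
    note m = point_mor[OF \<phi>]
    show "point_arrow X D v k \<phi> \<in> topspace (arr ?G)"
      using mp_in[OF m(1)] p by (simp add: point_arrow_eq[OF p] atlas_groupoid_def span_groupoid_def)
    show "src ?G (point_arrow X D v k \<phi>) = ?x"
      using mp_Cmp_apply[OF Y.dbl_Homs(1) m(1)] m(2) p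
      by (simp add: point_arrow_eq[OF p] atlas_groupoid_def span_groupoid_def)
    have "mp X (Cmp X k \<phi>) p = ?x"
      using mp_Cmp_apply[OF k, of \<phi> v p] \<phi> p by (simp add: carrier_Auts)
    then show "rng ?G (point_arrow X D v k \<phi>) = ?x"
      using mp_Cmp_apply[OF Y.dbl_Homs(2) m(1)] m(3) p
      by (simp add: point_arrow_eq[OF p] atlas_groupoid_def span_groupoid_def)
  qed
  then have "finite (point_arrow X D v k ` carrier (Auts X v))"
    using finite_isotropy[OF G x x] finite_subset by blast
  then show ?thesis
    using finite_imageD inj_on_point_arrow[OF p] by blast
qed

end

end

text \<open>Surjectivity gives a point of the fibre product over \<open>p\<close>. The restriction
  \<open>w\<close> of \<open>z\<close> to it maps to \<open>v\<close> over the identity, hence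
  \<open>v\<close> maps to \<open>w\<close> and on to the atlas.\<close>

lemma (in fibred_groupoids) atlas_point_lift:
  assumes "is_atlas X a" "v \<in> Ob X" "topspace (sp X v) = {p}"
  shows "\<exists>k. k \<in> Homs X v a"
proof -
  obtain z k l where zkl: "fibre_product X a v z k l" "mp X l ` topspace (sp X z) = topspace (sp X v)"
    using assms(1,2) unfolding is_atlas_def by blast
  then have z: "z \<in> Ob X" "k \<in> Homs X z a" "l \<in> Homs X z v"
    by (auto simp: fibre_product_def)
  obtain s where s: "s \<in> topspace (sp X z)" "mp X l s = p"
  proof -
    have "p \<in> mp X l ` topspace (sp X z)" using zkl(2) assms(3) by simp
    then show thesis using that by auto
  qed
  obtain w j where w: "w \<in> Ob X" "sp X w = sp X v" "j \<in> Homs X w z" "mp X j p = s"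
    using pullback_point[OF z(1) s(1) assms(3)] by metis
  have p: "topspace (sp X w) = {p}" using w assms by simp
  have "mp X (Cmp X l j) = mp X (Idm X v)"
  proof -
    have "mp X (Cmp X l j) = restrict id {p}"
      using w s p by (auto simp: mp_Cmp[OF z(3) w(3)] compose_def fun_eq_iff)
    then show ?thesis using mp_Idm[OF assms(2)] assms(3) by simp
  qed
  then obtain i where "i \<in> Homs X v w"
    using vertical_iso[OF Cmp_Homs[OF z(3) w(3)] Idm_Homs[OF assms(2)]] w(2) by metis
  then show ?thesis
    using Cmp_Homs[OF z(2) Cmp_Homs[OF w(3)]] by blast
qed

section \<open>The holonomy of a principal bundle\<close>

locale circle_bundle = fibred_groupoids X
  for X :: "('u, 'o, 'm) fibred" +
  fixes p\<^sub>o :: "'o \<Rightarrow> 'u pbundle" and p\<^sub>m :: "'m \<Rightarrow> 'u pmorphism"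
  assumes stack_map: "stack_map X BU1 p\<^sub>o p\<^sub>m"
begin

lemma tmap_facts:
  assumes "m \<in> Homs X x y"
  shows "e \<in> topspace (tot (p\<^sub>o x)) \<Longrightarrow> tmap (p\<^sub>m m) e \<in> topspace (tot (p\<^sub>o y))"
    "e \<in> topspace (tot (p\<^sub>o x)) \<Longrightarrow> prj (p\<^sub>o y) (tmap (p\<^sub>m m) e) = mp X m (prj (p\<^sub>o x) e)"
    "\<lbrakk>e \<in> topspace (tot (p\<^sub>o x)); norm \<zeta> = 1\<rbrakk> \<Longrightarrow>
       tmap (p\<^sub>m m) (act (p\<^sub>o x) e \<zeta>) = act (p\<^sub>o y) (tmap (p\<^sub>m m) e) \<zeta>"
  using bundle_morphism_facts[OF bundle_morphism_stack_map(1)[OF stack_map assms]]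
    bundle_morphism_stack_map(2-4)[OF stack_map assms] by auto

text \<open>The scalar found at one point of the fibre serves at all of them, since the morphism is
  equivariant and \<open>U(1)\<close> commutative; the THE in \<open>h_fun\<close> is therefore well
  posed.\<close>

lemma h_fun:
  assumes u: "u \<in> Ob X" and \<phi>: "\<phi> \<in> carrier (Auts X u)" and t: "t \<in> topspace (sp X u)"
  shows "norm (h_fun X p\<^sub>o p\<^sub>m (u, \<phi>) t) = 1"
    "\<lbrakk>x \<in> topspace (tot (p\<^sub>o u)); prj (p\<^sub>o u) x = t\<rbrakk> \<Longrightarrow>
       tmap (p\<^sub>m \<phi>) x = act (p\<^sub>o u) x (h_fun X p\<^sub>o p\<^sub>m (u, \<phi>) t)"
proof -
  let ?P = "p\<^sub>o u"
  have P: "principal_bundle ?P" "base ?P = sp X u" using bundle_stack_map[OF stack_map u] by auto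
  have id: "mp X \<phi> s = s" if "s \<in> topspace (sp X u)" for s
    using \<phi> that by (auto simp: carrier_Auts)
  have H: "\<phi> \<in> Homs X u u" using \<phi> by (simp add: carrier_Auts)
  note T = tmap_facts[OF H]
  obtain e where e: "e \<in> topspace (tot ?P)" "prj ?P e = t"
    using principal_bundle_torsor[OF P(1)] P(2) t by metis
  have prj: "prj ?P (tmap (p\<^sub>m \<phi>) e) = prj ?P e" using T(2)[OF e(1)] id[OF t] e(2) by simp
  obtain \<zeta> where \<zeta>: "norm \<zeta> = 1" "act ?P e \<zeta> = tmap (p\<^sub>m \<phi>) e"
    and uniq: "\<And>\<zeta>'. norm \<zeta>' = 1 \<Longrightarrow> act ?P e \<zeta>' = tmap (p\<^sub>m \<phi>) e \<Longrightarrow> \<zeta>' = \<zeta>"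
    using principal_bundle_transitive[OF P(1) e(1) T(1)[OF e(1)]] prj by auto
  have all: "tmap (p\<^sub>m \<phi>) x = act ?P x \<zeta>" if x: "x \<in> topspace (tot ?P)" "prj ?P x = t" for x
  proof -
    obtain \<xi> where \<xi>: "norm \<xi> = 1" "act ?P e \<xi> = x"
      using principal_bundle_transitive[OF P(1) e(1) x(1)] e x by auto
    then show ?thesis
      using T(3)[OF e(1) \<xi>(1)] \<zeta> principal_bundle_act_act[OF P(1) e(1) \<zeta>(1) \<xi>(1)]
        principal_bundle_act_act[OF P(1) e(1) \<xi>(1) \<zeta>(1)] by (simp add: mult.commute)
  qed
  have "h_fun X p\<^sub>o p\<^sub>m (u, \<phi>) t = \<zeta>"
    unfolding h_fun_def prod.case restrict_apply'[OF t]
  proof (rule the_equality)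
    show "\<zeta> \<in> sphere 0 1 \<and> (\<forall>x\<in>topspace (tot ?P). prj ?P x = t \<longrightarrow> tmap (p\<^sub>m \<phi>) x = act ?P x \<zeta>)"
      using \<zeta>(1) all by simp
  qed (use e uniq in auto)
  then show "norm (h_fun X p\<^sub>o p\<^sub>m (u, \<phi>) t) = 1"
    "\<lbrakk>x \<in> topspace (tot ?P); prj ?P x = t\<rbrakk> \<Longrightarrow> tmap (p\<^sub>m \<phi>) x = act ?P x (h_fun X p\<^sub>o p\<^sub>m (u, \<phi>) t)"
    using \<zeta> all by auto
qed

text \<open>The map of total spaces over \<open>m\<close> intertwines the two automorphisms and is
  equivariant, so both scalars have the same effect on the image of \<open>e\<close>; the action is
  free.\<close>

lemma h_fun_restriction:
  assumes u: "u \<in> Ob X" "\<phi> \<in> carrier (Auts X u)"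
    and v: "v \<in> Ob X" "\<gamma> \<in> carrier (Auts X v)"
    and m: "m \<in> Homs X v u" "Cmp X \<phi> m = Cmp X m \<gamma>" and p: "p \<in> topspace (sp X v)"
  shows "h_fun X p\<^sub>o p\<^sub>m (v, \<gamma>) p = h_fun X p\<^sub>o p\<^sub>m (u, \<phi>) (mp X m p)"
proof -
  have P: "principal_bundle (p\<^sub>o v)" "base (p\<^sub>o v) = sp X v" "principal_bundle (p\<^sub>o u)"
    using bundle_stack_map[OF stack_map] u v by auto
  obtain e where e: "e \<in> topspace (tot (p\<^sub>o v))" "prj (p\<^sub>o v) e = p"
    using principal_bundle_torsor[OF P(1)] P(2) p by metis
  let ?\<zeta> = "h_fun X p\<^sub>o p\<^sub>m (v, \<gamma>) p" and ?\<xi> = "h_fun X p\<^sub>o p\<^sub>m (u, \<phi>) (mp X m p)" and ?d = "tmap (p\<^sub>m m) e"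
  have d: "?d \<in> topspace (tot (p\<^sub>o u))" "prj (p\<^sub>o u) ?d = mp X m p"
    using tmap_facts[OF m(1) e(1)] e(2) by auto
  have H: "\<gamma> \<in> Homs X v v" "\<phi> \<in> Homs X u u" using u v by (auto simp: carrier_Auts)
  have \<zeta>: "norm ?\<zeta> = 1" by (rule h_fun(1)[OF v p])
  have \<xi>: "norm ?\<xi> = 1" by (rule h_fun(1)[OF u mp_in[OF m(1) p]])
  have "act (p\<^sub>o u) ?d ?\<xi> = tmap (p\<^sub>m \<phi>) ?d"
    using h_fun(2)[OF u mp_in[OF m(1) p] d] by simp
  also have "\<dots> = tmap (p\<^sub>m m) (tmap (p\<^sub>m \<gamma>) e)"
    using tmap_stack_map_Cmp[OF stack_map H(2) m(1) e(1)] tmap_stack_map_Cmp[OF stack_map m(1) H(1) e(1)] m(2)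
    by simp
  also have "\<dots> = act (p\<^sub>o u) ?d ?\<zeta>"
    using h_fun(2)[OF v p e] tmap_facts(3)[OF m(1) e(1) \<zeta>] by simp
  finally show ?thesis
    using principal_bundle_transitive[OF P(3) d(1), of "act (p\<^sub>o u) ?d ?\<zeta>"]
      principal_bundle_act[OF P(3) d(1) \<zeta>] \<zeta> \<xi> by metis
qed

end

text \<open>Justifies the SOME in \<open>chi_bar\<close>. As \<open>\<phi>\<close> lies over the
  identity, \<open>\<phi> \<circ> m\<close> lies over the same map as \<open>m\<close> and factors
  through it; the factor is the restricted automorphism.\<close>

lemma (in fibred_groupoids) loop_restriction_exists:
  assumes u: "u \<in> Ob X" "\<phi> \<in> carrier (Auts X u)" and t: "t \<in> topspace (sp X u)"
  shows "\<exists>l. loop_restriction X (u, \<phi>) t l"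
proof -
  obtain v m where v: "v \<in> Ob X" "sp X v = discrete_topology {t}" "m \<in> Homs X v u" "mp X m t = t"
    using pullback_point[OF u(1) t, of "discrete_topology {t}" t] by auto
  have H: "\<phi> \<in> Homs X u u" using u by (simp add: carrier_Auts)
  have "mp X m = mp X (Cmp X \<phi> m)"
  proof (rule mp_eq_point[OF v(3) Cmp_Homs[OF H v(3)]])
    show "mp X m t = mp X (Cmp X \<phi> m) t"
      using v t u by (simp add: mp_Cmp_apply[OF H v(3)] carrier_Auts)
  qed (simp add: v)
  then obtain \<gamma> where \<gamma>: "\<gamma> \<in> Homs X v v" "mp X \<gamma> = restrict id (topspace (sp X v))" "Cmp X m \<gamma> = Cmp X \<phi> m"
    using vertical_iso[OF v(3) Cmp_Homs[OF H v(3)]] by metis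
  have "loop_restriction X (u, \<phi>) t (v, \<gamma>)"
    unfolding loop_restriction_def
  proof (intro conjI exI[of _ t] bexI[of _ "((v, \<gamma>), m, (u, \<phi>))"])
    show "((v, \<gamma>), m, (u, \<phi>)) \<in> Homs (loop_stack X) (v, \<gamma>) (u, \<phi>)"
      unfolding Homs_def[of "loop_stack X"]
      using v \<gamma> u by (auto simp: loop_stack_def carrier_Auts)
  qed (use v \<gamma> in \<open>auto simp: loop_stack_def carrier_Auts\<close>)
  then show ?thesis ..
qed

lemma loop_restrictionD:
  assumes "loop_restriction X (u, \<phi>) t l"
  obtains v \<gamma> p m where "l = (v, \<gamma>)" "v \<in> Ob X" "\<gamma> \<in> carrier (Auts X v)" "topspace (sp X v) = {p}"
    "m \<in> Homs X v u" "Cmp X \<phi> m = Cmp X m \<gamma>" "mp X m p = t"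
proof -
  obtain v \<gamma> where l: "l = (v, \<gamma>)" by (cases l)
  show thesis
    using assms that[of v \<gamma>] unfolding l loop_restriction_def Homs_def[of "loop_stack X"]
    by (auto simp: loop_stack_def)
qed

section \<open>Comparison with the character\<close>

text \<open>Relates the cocycle provided by \<open>is_chern_class\<close> to the one chosen by SOME
  from the same class.\<close>

lemma cohomology_class_diff:
  assumes \<kappa>: "\<kappa> \<in> carrier (cohomology_group (Suc n) Z)" and c: "c \<in> \<kappa>" "c' \<in> \<kappa>"
  obtains \<beta> \<beta>' where "\<And>\<tau>. c' \<tau> = c \<tau> + (coboundary n Z \<beta> \<tau> - coboundary n Z \<beta>' \<tau>)"
proof -
  obtain s where s: "\<kappa> = coboundary_set (Suc n) Z #>\<^bsub>cocycle_group (Suc n) Z\<^esub> s"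
    using \<kappa> by (auto simp: cohomology_group_def FactGroup_def RCOSETS_def)
  obtain \<beta> where \<beta>: "c = (\<lambda>\<tau>. coboundary n Z \<beta> \<tau> + s \<tau>)"
    using c(1) by (auto simp: s r_coset_def coboundary_set_def cocycle_group_def)
  obtain \<beta>' where \<beta>': "c' = (\<lambda>\<tau>. coboundary n Z \<beta>' \<tau> + s \<tau>)"
    using c(2) by (auto simp: s r_coset_def coboundary_set_def cocycle_group_def)
  show thesis by (rule that[of \<beta>' \<beta>]) (simp add: \<beta> \<beta>')
qed

lemma cohomology_pullback_some:
  obtains \<beta> where "\<And>\<tau>. (SOME c. c \<in> cohomology_pullback (Suc n) Z f \<kappa>) \<tau> =
    coboundary n Z \<beta> \<tau> + cochain_pullback (Suc n) Z f (SOME c. c \<in> \<kappa>) \<tau>"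
proof -
  let ?\<xi> = "cohomology_pullback (Suc n) Z f \<kappa>" and ?s = "cochain_pullback (Suc n) Z f (SOME c. c \<in> \<kappa>)"
  have \<xi>: "?\<xi> = {\<lambda>\<tau>. coboundary n Z \<beta> \<tau> + ?s \<tau> | \<beta>. \<beta> \<in> cochain_set n Z}"
    by (auto simp: cohomology_pullback_def r_coset_def coboundary_set_def cocycle_group_def)
  \<comment> \<open>The zero cochain shows that the coset is nonempty, so that SOME picks one of its
    members.\<close>
  have "(\<lambda>\<tau>. coboundary n Z (\<lambda>_. 0) \<tau> + ?s \<tau>) \<in> ?\<xi>"
    unfolding \<xi> by (auto simp: cochain_set_def)
  then have "(SOME c. c \<in> ?\<xi>) \<in> ?\<xi>" by (rule someI[of "\<lambda>c. c \<in> ?\<xi>"])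
  then have "\<exists>\<beta>. (SOME c. c \<in> ?\<xi>) = (\<lambda>\<tau>. coboundary n Z \<beta> \<tau> + ?s \<tau>)"
    by (subst (asm) (2) \<xi>) blast
  then show thesis using that by metis
qed

lemma (in circle_lift) character_of_class_lift:
  assumes fin: "finite (carrier \<Gamma>)"
    and chern: "is_chern_class (realization E) (realization Y) (realization_map Y q)
      (\<lambda>x z. realization_map E (\<lambda>g. R g z) x) \<kappa>"
    and \<gamma>: "\<gamma> \<in> carrier \<Gamma>"
  shows "character_of_class \<Gamma>
    (cohomology_pullback 2 (realization (one_object_groupoid \<Gamma>)) (realization_map Y a) \<kappa>) \<gamma> = \<zeta> \<gamma>"
proof -
  let ?B = "one_object_groupoid \<Gamma>"
  let ?\<xi> = "cohomology_pullback 2 (realization ?B) (realization_map Y a) \<kappa>"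
  obtain c \<omega> where \<kappa>: "\<kappa> \<in> carrier (cohomology_group 2 (realization Y))" and c: "c \<in> \<kappa>"
    and \<omega>: "coboundary 1 (realization E) \<omega> = (\<lambda>\<tau>. - cochain_pullback 2 (realization E) (realization_map Y q) c \<tau>)"
    and fib: "\<And>y \<tau>. \<lbrakk>y \<in> topspace (realization Y); \<tau> \<in> singular_simplex_set 2
        (subtopology (realization E) {x \<in> topspace (realization E). realization_map Y q x = y})\<rbrakk> \<Longrightarrow>
        coboundary 1 (realization E) \<omega> \<tau> = 0"
    and loop: "\<And>x. x \<in> topspace (realization E) \<Longrightarrow>
        \<omega> (fibre_loop (\<lambda>x z. realization_map E (\<lambda>g. R g z) x) x) = 1"
    using chern unfolding is_chern_class_def by blast
  have "\<forall>g\<in>carrier \<Gamma>. \<exists>x. \<zeta> g = circle x"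
    by (simp add: circle_surj)
  from bchoice[OF this] obtain \<theta> where \<theta>: "\<And>g. g \<in> carrier \<Gamma> \<Longrightarrow> \<zeta> g = circle (\<theta> g)"
    by blast
  obtain C where C: "\<And>g h. \<lbrakk>g \<in> carrier \<Gamma>; h \<in> carrier \<Gamma>\<rbrakk> \<Longrightarrow>
      of_int (c (bar_cell Y \<Gamma> a 2 (tri \<one> g (g \<otimes> h)))) =
        \<theta> h - \<theta> (g \<otimes> h) + \<theta> g - of_int (bar_coboundary \<Gamma> C g h)"
  proof (rule circle_lift_Bockstein[OF \<omega>, of \<theta>])
    show "coboundary 1 (realization E) \<omega> \<tau> = 0"
      if "y \<in> topspace (realization Y)" "\<tau> \<in> singular_simplex_set 2
        (subtopology (realization E) {x \<in> topspace (realization E). realization_map Y q x = y})" for y \<tau>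
      using that by (rule fib)
    show "\<omega> (fibre_loop (\<lambda>x z. realization_map E (\<lambda>g. R g z) x) x) = 1"
      if "x \<in> topspace (realization E)" for x
      using that by (rule loop)
  qed (use \<theta> in simp_all)
  define c0 where "c0 = (SOME c. c \<in> \<kappa>)"
  have "c0 \<in> \<kappa>" unfolding c0_def using c by (rule someI[of "\<lambda>c. c \<in> \<kappa>"])
  then obtain \<beta> \<beta>' where \<beta>: "\<And>\<tau>. c0 \<tau> = c \<tau> + (coboundary 1 (realization Y) \<beta> \<tau> - coboundary 1 (realization Y) \<beta>' \<tau>)"
    using cohomology_class_diff[of \<kappa> 1 "realization Y" c c0] \<kappa> c by (auto simp: numeral_2_eq_2)
  define c1 where "c1 = (SOME c. c \<in> ?\<xi>)"
  obtain \<delta> where \<delta>: "\<And>\<tau>. c1 \<tau> = coboundary 1 (realization ?B) \<delta> \<tau> + cochain_pullback 2 (realization ?B) (realization_map Y a) c0 \<tau>"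
    using cohomology_pullback_some[where n = 1 and Z = "realization ?B" and f = "realization_map Y a" and \<kappa> = \<kappa>]
    unfolding c0_def c1_def numeral_2_eq_2 One_nat_def by metis
  \<comment> \<open>Collects all changes of representative: \<open>C\<close> enters the value of
    \<open>c\<close> negatively, while the chosen cocycle adds the coboundaries of
    \<open>\<delta>\<close> and \<open>\<beta>\<close> and subtracts that of
    \<open>\<beta>'\<close>.\<close>
  define b where "b g = C g - \<delta> (bar_cell ?B \<Gamma> (\<lambda>g. g) 1 (pr \<one> g)) -
    \<beta> (bar_cell Y \<Gamma> a 1 (pr \<one> g)) + \<beta>' (bar_cell Y \<Gamma> a 1 (pr \<one> g))" for g
  have val: "of_int (c1 (bar_simplex2 \<Gamma> g h)) = \<theta> h - \<theta> (g \<otimes> h) + \<theta> g - of_int (bar_coboundary \<Gamma> b g h)"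
    if gh: "g \<in> carrier \<Gamma>" "h \<in> carrier \<Gamma>" for g h
  proof -
    let ?v = "tri \<one> g (g \<otimes> h)"
    have v: "?v i \<in> carrier \<Gamma>" for i using gh by (simp add: tri_def)
    have "bar_simplex2 \<Gamma> g h \<in> singular_simplex_set 2 (realization ?B)"
      unfolding bar_simplex2_eq bar_cell_def
      by (intro cell_simplex_in_const bar_in_nerve_one_object) (rule v)
    moreover have "simplex_map 2 (realization_map Y a) (bar_simplex2 \<Gamma> g h) = bar_cell Y \<Gamma> a 2 ?v"
      unfolding bar_simplex2_eq bar_cell_def simplex_map_cell_simplex[OF arrow_functor_one_object]
      by (intro cell_simplex_cong) (auto simp: nerve_map_def bar_def fun_eq_iff)
    ultimately have "c1 (bar_simplex2 \<Gamma> g h) =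
        coboundary 1 (realization ?B) \<delta> (bar_cell ?B \<Gamma> (\<lambda>g. g) 2 ?v) + c0 (bar_cell Y \<Gamma> a 2 ?v)"
      unfolding \<delta> by (simp add: cochain_pullback_def bar_simplex2_eq)
    then show ?thesis
      using C[OF gh] coboundary_bar_cell[OF bar_in_nerve_one_object gh, of \<delta>]
        coboundary_bar_cell[OF bar_in_nerve gh, of \<beta>] coboundary_bar_cell[OF bar_in_nerve gh, of \<beta>']
      by (simp add: \<beta> bar_coboundary_def b_def)
  qed
  let ?\<psi> = "restrict \<zeta> (carrier \<Gamma>)"
  have \<psi>: "?\<psi> \<in> characters \<Gamma>"
    using \<zeta> by (auto simp: characters_def hom_def Pi_iff)
  have bock: "bockstein \<Gamma> ?\<psi> = nerve_to_group_class \<Gamma> ?\<xi>"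
    unfolding nerve_to_group_class_def c1_def[symmetric]
    by (rule group_class2_eq_bockstein[symmetric, where \<theta> = \<theta> and C = b]) (simp_all add: \<theta> val)
  \<comment> \<open>Characters with this Bockstein class then share a cocycle, which
    \<open>bockstein_inject\<close> needs.\<close>
  have ne: "nerve_to_group_class \<Gamma> ?\<xi> \<noteq> {}"
    unfolding nerve_to_group_class_def group_class2_def c1_def[symmetric]
    by (simp add: set_eq_iff)
      (rule exI[of _ "\<lambda>g h. if g \<in> carrier \<Gamma> \<and> h \<in> carrier \<Gamma> then c1 (bar_simplex2 \<Gamma> g h) else 0"],
        auto intro!: exI[of _ "\<lambda>_. 0"])
  have "character_of_class \<Gamma> ?\<xi> = ?\<psi>"
    unfolding character_of_class_def
    by (rule the_equality) (use \<psi> bock ne bockstein_inject[OF fin _ \<psi>] in blast)+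
  then show ?thesis using \<gamma> by simp
qed

theorem lemma2p38:
  fixes B :: "('u, 'o, 'm) fibred"
    and D :: "('o, 'm) atlas_data"
    and p\<^sub>o :: "'o \<Rightarrow> 'u pbundle" and p\<^sub>m :: "'m \<Rightarrow> 'u pmorphism"
    and \<kappa> :: "'u cell set cochain set"
  assumes "orbispace B" and "orbispace_atlas B D"
    and "\<kappa> \<in> carrier (orbispace_cohomology 2 B D)"
    and "stack_map B BU1 p\<^sub>o p\<^sub>m" and "classified_by B D p\<^sub>o p\<^sub>m \<kappa>"
  shows "\<forall>l\<in>Ob (loop_stack B). h_fun B p\<^sub>o p\<^sub>m l = chi_bar B D \<kappa> l"
proof -
  have atlas: "is_atlas B (atl D)"
    and double: "fibre_product B (atl D) (atl D) (dbl D) (p_src D) (p_rng D)"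
    and proper: "proper_groupoid (atlas_groupoid B D)" "etale_groupoid (atlas_groupoid B D)"
    using assms(2) by (auto simp: orbispace_atlas_def very_proper_groupoid_def)
  interpret fibred_groupoids B
    by unfold_locales (use assms(1) in \<open>simp add: orbispace_def stack_def\<close>)
  interpret groupoid_atlas B D by unfold_locales (rule double)
  interpret circle_bundle B p\<^sub>o p\<^sub>m by unfold_locales (rule assms(4))
  let ?F = "\<lambda>x. tot (p\<^sub>o x)" and ?f = "\<lambda>m. tmap (p\<^sub>m m)"
  interpret E: fibred_space_functor B D ?F ?f "\<lambda>x. prj (p\<^sub>o x)"
    using assms(4) double by (rule fibred_space_functor_tot)
  have Eeq: "bundle_groupoid B D p\<^sub>o p\<^sub>m = E.G" by (simp add: bundle_groupoid_def)
  have Yeq: "atlas_groupoid B D = Y.G" by (simp add: atlas_groupoid_def)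
  have point: "chi_bar_point B D \<kappa> (v, \<gamma>) = h_fun B p\<^sub>o p\<^sub>m (v, \<gamma>) p"
    if v: "v \<in> Ob B" "\<gamma> \<in> carrier (Auts B v)" "topspace (sp B v) = {p}" for v \<gamma> p
  proof -
    let ?\<Gamma> = "subgroup_generated (Auts B v) {\<gamma>}"
    interpret Aut: group "Auts B v" using v(1) by (rule group_Auts)
    \<comment> \<open>The same choice as in \<open>point_pullback\<close>, to which the result is
      folded back at the end.\<close>
    define k where "k = (SOME k. k \<in> Homs B v (atl D))"
    have k: "k \<in> Homs B v (atl D)"
      unfolding k_def using atlas_point_lift[OF atlas v(1,3)] by (rule someI_ex)
    have P: "principal_bundle (p\<^sub>o v)" "base (p\<^sub>o v) = sp B v"
      using bundle_stack_map[OF assms(4) v(1)] by auto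
    obtain e where e: "e \<in> topspace (tot (p\<^sub>o v))" "prj (p\<^sub>o v) e = p"
    proof -
      have "p \<in> topspace (base (p\<^sub>o v))" using P(2) v(3) by simp
      from principal_bundle_torsor[OF P(1) this] show thesis using that by metis
    qed
    have prj: "prj (p\<^sub>o v) x = p" if "x \<in> topspace (tot (p\<^sub>o v))" for x
      using principal_bundle_prj[OF P(1) that] P(2) v(3) by simp
    let ?h = "\<lambda>\<phi>. h_fun B p\<^sub>o p\<^sub>m (v, \<phi>) p"
    \<comment> \<open>The lift of the arrow of \<open>\<phi>\<close> that starts at the image of the
      base point \<open>e\<close>.\<close>
    let ?A = "\<lambda>\<phi>. tmap (p\<^sub>m (point_mor v k \<phi>)) e"
    let ?R = "act (p\<^sub>o (dbl D))"
    have sub: "carrier ?\<Gamma> \<subseteq> carrier (Auts B v)" by (rule Aut.carrier_subgroup_generated_subset)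
    have p: "p \<in> topspace (sp B v)" using v(3) by simp
    have Q: "principal_bundle (p\<^sub>o (dbl D))" "base (p\<^sub>o (dbl D)) = sp B (dbl D)"
      using bundle_stack_map[OF assms(4)] Homs_Ob Y.dbl_Homs by blast+
    have h: "norm (?h \<phi>) = 1" if "\<phi> \<in> carrier (Auts B v)" for \<phi>
      using h_fun(1)[OF v(1) that p] .
    have hx: "tmap (p\<^sub>m \<phi>) x = act (p\<^sub>o v) x (?h \<phi>)"
      if "\<phi> \<in> carrier (Auts B v)" "x \<in> topspace (tot (p\<^sub>o v))" for \<phi> x
      using h_fun(2)[OF v(1) that(1) p that(2) prj[OF that(2)]] .
    have A: "?A \<phi> \<in> topspace (tot (p\<^sub>o (dbl D)))" if "\<phi> \<in> carrier (Auts B v)" for \<phi>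
      using tmap_facts(1)[OF point_mor(1)[OF k that] e(1)] .
    have RA: "?R (?A \<phi>) z = tmap (p\<^sub>m (point_mor v k \<phi>)) (act (p\<^sub>o v) e z)"
      if "\<phi> \<in> carrier (Auts B v)" "norm z = 1" for \<phi> z
      using tmap_facts(3)[OF point_mor(1)[OF k that(1)] e(1) that(2)] by simp
    have hom: "?h (Cmp B \<phi> \<psi>) = ?h \<phi> * ?h \<psi>"
      if "\<phi> \<in> carrier (Auts B v)" "\<psi> \<in> carrier (Auts B v)" for \<phi> \<psi>
    proof -
      have c: "Cmp B \<phi> \<psi> \<in> carrier (Auts B v)" using Aut.m_closed[OF that] by simp
      have H: "\<phi> \<in> Homs B v v" "\<psi> \<in> Homs B v v" using that by (auto simp: carrier_Auts)
      have "act (p\<^sub>o v) e (?h (Cmp B \<phi> \<psi>)) = tmap (p\<^sub>m \<phi>) (act (p\<^sub>o v) e (?h \<psi>))"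
        using hx[OF c e(1)] hx[OF that(2) e(1)] tmap_stack_map_Cmp[OF assms(4) H e(1)] by simp
      also have "\<dots> = act (p\<^sub>o v) e (?h \<phi> * ?h \<psi>)"
        using hx[OF that(1) principal_bundle_act(1)[OF P(1) e(1) h[OF that(2)]]]
          principal_bundle_act_act[OF P(1) e(1) h[OF that(2)] h[OF that(1)]] by (simp add: mult.commute)
      finally have eq: "act (p\<^sub>o v) e (?h (Cmp B \<phi> \<psi>)) = act (p\<^sub>o v) e (?h \<phi> * ?h \<psi>)" .
      have n: "norm (?h \<phi> * ?h \<psi>) = 1" using h that by (simp add: norm_mult)
      show ?thesis
        using principal_bundle_transitive[OF P(1) e(1) principal_bundle_act(1)[OF P(1) e(1) n]]
          principal_bundle_act(2)[OF P(1) e(1) n] eq n h[OF c] by metis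
    qed
    \<comment> \<open>Evaluates the first factor of \<open>arrow_product_point_mor\<close>:
      \<open>\<psi>\<close> acts first and rotates the starting point by its scalar.\<close>
    have m1: "tmap (p\<^sub>m (Cmp B (point_mor v k \<phi>) \<psi>)) (act (p\<^sub>o v) e z) = ?R (?A \<phi>) (z * ?h \<psi>)"
      if "\<phi> \<in> carrier (Auts B v)" "\<psi> \<in> carrier (Auts B v)" "norm z = 1" for \<phi> \<psi> z
    proof -
      have H: "\<psi> \<in> Homs B v v" using that by (auto simp: carrier_Auts)
      have ez: "act (p\<^sub>o v) e z \<in> topspace (tot (p\<^sub>o v))"
        by (rule principal_bundle_act(1)[OF P(1) e(1) that(3)])
      have n: "norm (z * ?h \<psi>) = 1" using h that by (simp add: norm_mult)
      show ?thesis
        using tmap_stack_map_Cmp[OF assms(4) point_mor(1)[OF k that(1)] H ez] hx[OF that(2) ez]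
          principal_bundle_act_act[OF P(1) e(1) that(3) h[OF that(2)]] RA[OF that(1) n] by simp
    qed
    interpret L: circle_lift ?\<Gamma> E.G Y.G "prj (p\<^sub>o (dbl D))" ?R "point_arrow B D v k" ?A ?h
    proof (intro circle_lift.intro circle_lift_axioms.intro)
      show "group ?\<Gamma>" by (rule Aut.group_subgroup_generated)
      show "arrow_functor E.G Y.G (prj (p\<^sub>o (dbl D)))"
        by (rule arrow_functor_span_groupoid[OF E.fibred_space_functor_axioms Y.fibred_space_functor_axioms,
              where \<eta> = "\<lambda>x. prj (p\<^sub>o x)"])
          (auto intro: E.proj_in E.proj_map)
      show "arrow_functor E.G E.G (\<lambda>x. ?R x z)" if "norm z = 1" for z
        by (rule arrow_functor_span_groupoid[OF E.fibred_space_functor_axioms E.fibred_space_functor_axioms,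
              where \<eta> = "\<lambda>x e. act (p\<^sub>o x) e z"])
          (use that tmap_facts(3) bundle_stack_map(1)[OF assms(4)] in \<open>auto intro: principal_bundle_act(1)\<close>)
      show "?h \<in> hom ?\<Gamma> U1"
        using h hom sub by (auto simp: hom_def U1_def subset_iff)
    next
      fix \<phi> assume "\<phi> \<in> carrier ?\<Gamma>"
      then have \<phi>: "\<phi> \<in> carrier (Auts B v)" using sub by blast
      show "continuous_map U1_top (arr E.G) (?R (?A \<phi>))"
        using principal_bundle_act_continuous[OF Q(1) A[OF \<phi>]] by (simp add: span_groupoid_def)
      show "prj (p\<^sub>o (dbl D)) (?R (?A \<phi>) z) = point_arrow B D v k \<phi>" if "norm z = 1" for z
        using principal_bundle_act(2)[OF Q(1) A[OF \<phi>] that] e tmap_facts(2)[OF point_mor(1)[OF k \<phi>] e(1)]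
        by (simp add: point_arrow_eq[OF v(3)])
      show "?R (?R (?A \<phi>) z) w = ?R (?A \<phi>) (z * w)" if "norm z = 1" "norm w = 1" for z w
        by (rule principal_bundle_act_act[OF Q(1) A[OF \<phi>] that])
      fix \<psi> z assume "\<psi> \<in> carrier ?\<Gamma>" and z: "norm (z :: complex) = 1"
      then have \<psi>: "\<psi> \<in> carrier (Auts B v)" using sub by blast
      have ez: "act (p\<^sub>o v) e z \<in> topspace (tot (p\<^sub>o v))"
        by (rule principal_bundle_act(1)[OF P(1) e(1) z])
      \<comment> \<open>\<open>arrow_product\<close> involves only the stack and the span, so the
        witness found for base spaces also serves for total spaces.\<close>
      have prod: "E.arrow_product v (Cmp B (point_mor v k \<phi>) \<psi>) (point_mor v k \<psi>) (point_mor v k (Cmp B \<phi> \<psi>))"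
        using arrow_product_point_mor[OF k \<phi> \<psi>] by (simp add: E.arrow_product_def Y.arrow_product_def)
      have c: "Cmp B \<phi> \<psi> \<in> carrier (Auts B v)" using Aut.m_closed[OF \<phi> \<psi>] by simp
      show "src E.G (?R (?A \<phi>) (z * ?h \<psi>)) = rng E.G (?R (?A \<psi>) z)"
        using E.src_span_groupoid[OF prod ez] m1[OF \<phi> \<psi> z] RA[OF \<psi> z] by simp
      show "prd E.G (?R (?A \<phi>) (z * ?h \<psi>)) (?R (?A \<psi>) z) = ?R (?A (\<phi> \<otimes>\<^bsub>?\<Gamma>\<^esub> \<psi>)) z"
        using E.prd_span_groupoid[OF prod ez] m1[OF \<phi> \<psi> z] RA[OF \<psi> z] RA[OF c z] by simp
    qed
    have "finite (carrier ?\<Gamma>)"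
      using finite_Auts[OF k v(3) proper] sub finite_subset by blast
    moreover have "\<gamma> \<in> carrier ?\<Gamma>"
      using v(2) by (simp add: carrier_subgroup_generated generate.incl)
    moreover have "is_chern_class (realization E.G) (realization Y.G) (realization_map Y.G (prj (p\<^sub>o (dbl D))))
      (\<lambda>x z. realization_map E.G (\<lambda>g. ?R g z) x) \<kappa>"
      using assms(5) by (simp only: classified_by_def Eeq Yeq)
    ultimately show ?thesis
      using L.character_of_class_lift[of \<kappa> \<gamma>]
      by (simp add: chi_bar_point_def point_pullback_def Let_def Yeq flip: k_def)
  qed
  show ?thesis
  proof
    fix l assume "l \<in> Ob (loop_stack B)"
    then obtain u \<phi> where l: "l = (u, \<phi>)" "u \<in> Ob B" "\<phi> \<in> carrier (Auts B u)"
      by (auto simp: loop_stack_def)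
    have "h_fun B p\<^sub>o p\<^sub>m l t = chi_bar_point B D \<kappa> (SOME l'. loop_restriction B l t l')"
      if t: "t \<in> topspace (sp B u)" for t
    proof -
      define l' where "l' = (SOME l'. loop_restriction B l t l')"
      have "loop_restriction B (u, \<phi>) t l'"
        using someI_ex[OF loop_restriction_exists[OF l(2,3) t]] by (simp add: l'_def l(1))
      then obtain v \<gamma> p m where l': "l' = (v, \<gamma>)" and v: "v \<in> Ob B" "\<gamma> \<in> carrier (Auts B v)" "topspace (sp B v) = {p}"
        and m: "m \<in> Homs B v u" "Cmp B \<phi> m = Cmp B m \<gamma>" "mp B m p = t"
        by (rule loop_restrictionD)
      \<comment> \<open>The value of \<open>h_fun\<close> at \<open>t\<close> is unchanged on
        passing to the chosen restriction, where the comparison at points applies.\<close>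
      have "chi_bar_point B D \<kappa> l' = h_fun B p\<^sub>o p\<^sub>m l t"
        unfolding l' point[OF v] l(1)
        using h_fun_restriction[OF l(2,3) v(1,2) m(1,2), of p] v(3) m(3) by simp
      then show ?thesis by (simp add: l'_def)
    qed
    then show "h_fun B p\<^sub>o p\<^sub>m l = chi_bar B D \<kappa> l"
      by (auto simp: l(1) chi_bar_def h_fun_def loop_stack_def fun_eq_iff)
  qed
qed

end
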